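(* Assume that the shift $\theta$ preserves $\mathbb{P}$ and is ergodic; that there exist constants $\beta\in[1,\infty)$, $(\varepsilon_-,\varepsilon_+)\in(0,\infty)^2$ and a probability measure $\nu$ on $(\mathsf{X},\mathcal{X})$ such that $$\frac{G(\omega,x)}{G(\omega',x')}\le\beta\quad\forall(\omega,\omega',x,x')\in\Omega^2\times\mathsf{X}^2,\qquad \varepsilon_-\nu(\cdot)\le M(\omega,x,\cdot)\le\varepsilon_+\nu(\cdot)\quad\forall(\omega,x)\in\Omega\times\mathsf{X};$$ and that $\sup_{\omega,\omega',x,x'}\psi^\omega(x)/\psi^{\omega'}(x')<\infty$. Let $\widetilde{\mathbf{M}}$ be the kernel $$\widetilde{\mathbf{M}}^\omega(x,dx')=\frac{\mathbf{M}^\omega(x,dx')\boldsymbol\psi^{\theta\omega}(x')}{\int_{\mathsf{X}^N}\mathbf{M}^\omega(x,dz)\boldsymbol\psi^{\theta\omega}(z)}.$$ Then for any $N\ge2$, $$\Upsilon_N(\widetilde{\mathbf{M}})\le\log\left[1+\frac1{N-1}\mathcal{D}_{\mathbb{P}}(\psi,h)\right],$$ where $$\mathcal{D}_{\mathbb{P}}(\psi,h)=\mathbb{P}\text{-}\operatorname*{ess\,sup}_{\omega}\left\{C_\omega\sup_{(z,z')\in\mathsf{X}^2}\left|\frac{h^\omega(z)}{\psi^\omega(z)}-\frac{h^\omega(z')}{\psi^\omega(z')}\right|\right\},$$ $$C_\omega=\left(2\sup_{z,z'\in\mathsf{X}}\frac{\psi^\omega(z)}{\psi^\omega(z')}-1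\right)\sup_{z\in\mathsf{X}}\left(\frac{\psi^\omega(z)}{h^\omega(z)}\right).$$
   Context: Let $(\mathsf{X},\mathcal{X})$ and $(\mathsf{Y},\mathcal{Y})$ be measurable spaces, $\Omega=\mathsf{Y}^{\mathbb{Z}}$, $\mathcal{F}=\mathcal{Y}^{\otimes\mathbb{Z}}$, $\mathbb{P}$ a probability measure on $(\Omega,\mathcal{F})$, and $\theta:\Omega\to\Omega$ the shift, $(\theta\omega)(n)=\omega(n+1)$, with iterates $\theta^n$ ($n\in\mathbb{Z}$). Let $\mu_0$ be a probability measure on $(\mathsf{X},\mathcal{X})$. Let $M:\Omega\times\mathsf{X}\times\mathcal{X}\to[0,1]$ be such that $M(\omega,x,\cdot)$ is a probability measure for each $(\omega,x)$ and $M(\cdot,\cdot,A)$ is $\mathcal{F}\otimes\mathcal{X}$-measurable for each $A\in\mathcal{X}$. Let $G,\psi:\Omega\times\mathsf{X}\to\mathbb{R}_+$ be $\mathcal{F}\otimes\mathcal{X}$-measurable, strictly positive and bounded. A superscript $\omega$ denotes the $\omega$-section, e.g. $G^\omega(x)=G(\omega,x)$. For fixed $\omega$, $\mathsf{E}^\omega$ denotes expectation under the law of the Markov chain $(X_n)_{n\ge0}$ on $\mathsf{X}$ with $X_0\sim\mu_0$ and $X_n\mid X_{n-1}=x\sim M^{\theta^{n-1}\omega}(x,\cdot)$, $n\ge1$. Let $Q^\omega(x,dx')=G^\omega(x)M^\omega(x,dx')$, acting on bounded measurable functions by $Q^\omega(\varphi)(x)=\int Q^\omega(x,dx')\varphi(x')$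 and on measures by $\mu Q^\omega(\cdot)=\int\mu(dx)Q^\omega(x,\cdot)$; $Q_0^\omega=\mathrm{Id}$, $Q_n^\omega=Q_{n-1}^\omega Q^{\theta^{n-1}\omega}$; $\Phi_n^\omega(\mu)=\mu Q_n^\omega/\mu Q_n^\omega(1)$ for probability measures $\mu$. Under the two-sided bounds on $G$ and $M$ in the claim, the limit $$h(\omega,x)=\lim_{n\to\infty}\frac{Q_n^\omega(1)(x)}{\Phi_n^{\theta^{-n}\omega}(\mu)Q_n^\omega(1)}$$ exists for all $(\omega,x)$ and every probability measure $\mu$ on $\mathsf{X}$, does not depend on $\mu$, and is $\mathcal{F}\otimes\mathcal{X}$-measurable and strictly positive. For $x=(x^1,\dots,x^N),z=(z^1,\dots,z^N)\in\mathsf{X}^N$ put $$\mathbf{M}^\omega(x,dz)=\prod_{i=1}^N\frac{\sum_{j=1}^N G^\omega(x^j)M^\omega(x^j,dz^i)}{\sum_{j=1}^N G^\omega(x^j)},\quad \mathbf{G}^\omega(x)=\frac1N\sum_{i=1}^N G^\omega(x^i),\quad \boldsymbol\psi^\omega(x)=\frac1N\sum_{i=1}^N\psi^\omega(x^i).$$ For the kernel $\widetilde{\mathbf{M}}$ of the claim write $$\phi^\omega(x,x')=\frac{d\mathbf{M}^\omega(x,\cdot)}{d\widetilde{\mathbf{M}}^\omega(x,\cdot)}(x')=\frac{\int_{\mathsf{X}^N}\mathbf{M}^\omega(x,dz)\boldsymbol\psi^{\theta\omega}(z)}{\boldsymbol\psi^{\theta\omega}(x')}.$$ For fixed $\omega$,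 $\widetilde{\mathsf{E}}_N^\omega$ denotes expectation under the law of the $\mathsf{X}^N$-valued Markov chain $(\zeta_n)_{n\ge0}$ with $\zeta_0\sim\mu_0^{\otimes N}$ and $\zeta_n\mid\zeta_{n-1}\sim\widetilde{\mathbf{M}}^{\theta^{n-1}\omega}(\zeta_{n-1},\cdot)$. Put $$\widetilde{\mathcal{V}}^\omega_{n,N}=\frac{\widetilde{\mathsf{E}}_N^\omega\left[\prod_{p=0}^{n-1}\mathbf{G}^{\theta^p\omega}(\zeta_p)^2\,\phi^{\theta^p\omega}(\zeta_p,\zeta_{p+1})^2\right]}{\mathsf{E}^\omega\left[\prod_{p=0}^{n-1}G^{\theta^p\omega}(X_p)\right]^2}.$$ Under the hypotheses of the claim there is a constant $\Upsilon_N(\widetilde{\mathbf{M}})\in[0,\infty)$, independent of $\mu_0$, such that $\frac1n\log\widetilde{\mathcal{V}}^\omega_{n,N}\to\Upsilon_N(\widetilde{\mathbf{M}})$ as $n\to\infty$ for $\mathbb{P}$-almost all $\omega$; this defines $\Upsilon_N(\widetilde{\mathbf{M}})$. *)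

theory Defs
  imports "HOL-Probability.Probability"
begin

definition env_space :: "'y measure \<Rightarrow> (int \<Rightarrow> 'y) measure" where
  "env_space Y = PiM (UNIV :: int set) (\<lambda>_. Y)"

text \<open>\<open>env_shift k\<close> is the iterate \<open>\<theta>\<^sup>k\<close>, for every integer \<open>k\<close>.\<close>

definition env_shift :: "int \<Rightarrow> (int \<Rightarrow> 'y) \<Rightarrow> int \<Rightarrow> 'y" where
  "env_shift k \<omega> = (\<lambda>n. \<omega> (n + k))"

lemma env_shift_0: "env_shift 0 = id"
  by (simp add: env_shift_def fun_eq_iff)

lemma env_shift_env_shift: "env_shift j (env_shift k \<omega>) = env_shift (j + k) \<omega>"
  by (simp add: env_shift_def add.assoc)

lemma env_shift_funpow: "env_shift (int n) = env_shift 1 ^^ n"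
  by (induction n) (auto simp: env_shift_def fun_eq_iff ac_simps)

definition preserves :: "'w measure \<Rightarrow> ('w \<Rightarrow> 'w) \<Rightarrow> bool" where
  "preserves P T \<longleftrightarrow> T \<in> measurable P P \<and> distr P P T = P"

definition ergodic :: "'w measure \<Rightarrow> ('w \<Rightarrow> 'w) \<Rightarrow> bool" where
  "ergodic P T \<longleftrightarrow>
     (\<forall>A\<in>sets P. T -` A \<inter> space P = A \<longrightarrow> measure P A = 0 \<or> measure P A = 1)"

text \<open>
  The law of the inhomogeneous Markov chain on \<open>S\<close> with initial law \<open>\<mu>\<close> and with \<open>K n\<close> as
  transition kernel from time \<open>n\<close> to time \<open>n + 1\<close>, as a measure on \<open>S\<^sup>\<nat>\<close> (the Ionescu-Tulcea
  measure).  The kernel \<open>chain_step\<close> at time \<open>n\<close> only sees the history at times below \<open>n\<close>.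
\<close>

definition chain_step ::
    "'s measure \<Rightarrow> (nat \<Rightarrow> 's \<Rightarrow> 's measure) \<Rightarrow> nat \<Rightarrow> (nat \<Rightarrow> 's) \<Rightarrow> 's measure" where
  "chain_step \<mu> K n x = (case n of 0 \<Rightarrow> \<mu> | Suc m \<Rightarrow> K m (x m))"

definition chain_law ::
    "'s measure \<Rightarrow> 's measure \<Rightarrow> (nat \<Rightarrow> 's \<Rightarrow> 's measure) \<Rightarrow> (nat \<Rightarrow> 's) measure" where
  "chain_law S \<mu> K =
     projective_family.lim UNIV (Ionescu_Tulcea.CI (chain_step \<mu> K) (\<lambda>_. S)) (\<lambda>_. S)"

lemma Ionescu_Tulcea_chain_step:
  fixes S :: "'s measure"
  assumes "prob_space \<mu>" "sets \<mu> = sets S" "\<And>n. K n \<in> measurable S (prob_algebra S)"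
  shows "Ionescu_Tulcea (chain_step \<mu> K) (\<lambda>_. S)"
proof (rule Ionescu_Tulcea.intro)
  have K: "K n \<in> measurable S (subprob_algebra S)" for n
    using assms(3) by (rule measurable_prob_algebraD)
  show "chain_step \<mu> K i \<in> measurable (PiM {0..<i} (\<lambda>_. S)) (subprob_algebra S)" for i
  proof (cases i)
    case 0
    have "\<mu> \<in> space (subprob_algebra S)"
      using assms by (simp add: space_subprob_algebra prob_space_imp_subprob_space)
    then show ?thesis
      by (simp add: chain_step_def[abs_def] 0)
  next
    case (Suc m)
    have "(\<lambda>x. K m (x m)) \<in> measurable (PiM {0..<Suc m} (\<lambda>_. S)) (subprob_algebra S)"
      using measurable_compose[OF measurable_component_singleton[of m "{0..<Suc m}" "\<lambda>_. S"] K]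
      by simp
    then show ?thesis
      by (simp add: chain_step_def[abs_def] Suc)
  qed
  fix i and x :: "nat \<Rightarrow> 's"
  assume x: "x \<in> space (PiM {0..<i} (\<lambda>_. S))"
  show "prob_space (chain_step \<mu> K i x)"
  proof (cases i)
    case 0
    then show ?thesis using assms by (simp add: chain_step_def)
  next
    case (Suc m)
    then have "x m \<in> space S" using x by (auto simp: space_PiM)
    then have "K m (x m) \<in> space (prob_algebra S)"
      using assms(3) by (rule measurable_space[rotated])
    then show ?thesis by (simp add: chain_step_def Suc space_prob_algebra)
  qed
qed

text \<open>
  The kernels \<open>Q\<close> are not sub-Markovian (\<open>G\<close> may exceed \<open>1\<close>), so the bind of the Giry monad does
  not apply to them; \<open>act S \<mu> K\<close> is the measure \<open>\<mu>K\<close> on \<open>S\<close>.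
\<close>

definition act :: "'s measure \<Rightarrow> 's measure \<Rightarrow> ('s \<Rightarrow> 's measure) \<Rightarrow> 's measure" where
  "act S \<mu> K = measure_of (space S) (sets S) (\<lambda>A. \<integral>\<^sup>+x. emeasure (K x) A \<partial>\<mu>)"

definition Q_kernel :: "('w \<Rightarrow> 'x \<Rightarrow> real) \<Rightarrow> ('w \<Rightarrow> 'x \<Rightarrow> 'x measure) \<Rightarrow> 'w \<Rightarrow> 'x \<Rightarrow> 'x measure" where
  "Q_kernel G M \<omega> x = scale_measure (ennreal (G \<omega> x)) (M \<omega> x)"

primrec Qn :: "'x measure \<Rightarrow> ((int \<Rightarrow> 'y) \<Rightarrow> 'x \<Rightarrow> real) \<Rightarrow> ((int \<Rightarrow> 'y) \<Rightarrow> 'x \<Rightarrow> 'x measure) \<Rightarrow>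
    nat \<Rightarrow> (int \<Rightarrow> 'y) \<Rightarrow> 'x \<Rightarrow> 'x measure" where
  "Qn X G M 0 \<omega> x = return X x"
| "Qn X G M (Suc n) \<omega> x = act X (Qn X G M n \<omega> x) (Q_kernel G M (env_shift (int n) \<omega>))"

definition Phi :: "'x measure \<Rightarrow> ((int \<Rightarrow> 'y) \<Rightarrow> 'x \<Rightarrow> real) \<Rightarrow> ((int \<Rightarrow> 'y) \<Rightarrow> 'x \<Rightarrow> 'x measure) \<Rightarrow>
    nat \<Rightarrow> (int \<Rightarrow> 'y) \<Rightarrow> 'x measure \<Rightarrow> 'x measure" where
  "Phi X G M n \<omega> \<mu> =
     scale_measure (inverse (emeasure (act X \<mu> (Qn X G M n \<omega>)) (space X)))
       (act X \<mu> (Qn X G M n \<omega>))"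

definition h_fun :: "'x measure \<Rightarrow> ((int \<Rightarrow> 'y) \<Rightarrow> 'x \<Rightarrow> real) \<Rightarrow> ((int \<Rightarrow> 'y) \<Rightarrow> 'x \<Rightarrow> 'x measure) \<Rightarrow>
    'x measure \<Rightarrow> (int \<Rightarrow> 'y) \<Rightarrow> 'x \<Rightarrow> real" where
  "h_fun X G M \<mu> \<omega> x =
     lim (\<lambda>n. measure (Qn X G M n \<omega> x) (space X) /
              measure (act X (Phi X G M n (env_shift (- int n) \<omega>) \<mu>) (Qn X G M n \<omega>)) (space X))"

text \<open>Points of \<open>X\<^sup>N\<close> are functions on \<open>{..<N}\<close>.\<close>

abbreviation pow_space :: "nat \<Rightarrow> 'x measure \<Rightarrow> (nat \<Rightarrow> 'x) measure" where
  "pow_space N X \<equiv> PiM {..<N} (\<lambda>_. X)"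

definition particle_mean :: "nat \<Rightarrow> ('w \<Rightarrow> 'x \<Rightarrow> real) \<Rightarrow> 'w \<Rightarrow> (nat \<Rightarrow> 'x) \<Rightarrow> real" where
  "particle_mean N f \<omega> x = (\<Sum>i<N. f \<omega> (x i)) / real N"

definition mixture :: "'x measure \<Rightarrow> ('w \<Rightarrow> 'x \<Rightarrow> real) \<Rightarrow> ('w \<Rightarrow> 'x \<Rightarrow> 'x measure) \<Rightarrow> nat \<Rightarrow>
    'w \<Rightarrow> (nat \<Rightarrow> 'x) \<Rightarrow> 'x measure" where
  "mixture X G M N \<omega> x = measure_of (space X) (sets X)
     (\<lambda>A. (\<Sum>j<N. ennreal (G \<omega> (x j)) * emeasure (M \<omega> (x j)) A) / ennreal (\<Sum>j<N. G \<omega> (x j)))"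

definition particle_kernel :: "'x measure \<Rightarrow> ('w \<Rightarrow> 'x \<Rightarrow> real) \<Rightarrow> ('w \<Rightarrow> 'x \<Rightarrow> 'x measure) \<Rightarrow> nat \<Rightarrow>
    'w \<Rightarrow> (nat \<Rightarrow> 'x) \<Rightarrow> (nat \<Rightarrow> 'x) measure" where
  "particle_kernel X G M N \<omega> x = PiM {..<N} (\<lambda>_. mixture X G M N \<omega> x)"

definition twist_norm :: "'x measure \<Rightarrow> ((int \<Rightarrow> 'y) \<Rightarrow> 'x \<Rightarrow> real) \<Rightarrow>
    ((int \<Rightarrow> 'y) \<Rightarrow> 'x \<Rightarrow> 'x measure) \<Rightarrow> ((int \<Rightarrow> 'y) \<Rightarrow> 'x \<Rightarrow> real) \<Rightarrow> nat \<Rightarrow>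
    (int \<Rightarrow> 'y) \<Rightarrow> (nat \<Rightarrow> 'x) \<Rightarrow> real" where
  "twist_norm X G M \<psi> N \<omega> x =
     (\<integral>z. particle_mean N \<psi> (env_shift 1 \<omega>) z \<partial>particle_kernel X G M N \<omega> x)"

definition twisted_kernel :: "'x measure \<Rightarrow> ((int \<Rightarrow> 'y) \<Rightarrow> 'x \<Rightarrow> real) \<Rightarrow>
    ((int \<Rightarrow> 'y) \<Rightarrow> 'x \<Rightarrow> 'x measure) \<Rightarrow> ((int \<Rightarrow> 'y) \<Rightarrow> 'x \<Rightarrow> real) \<Rightarrow> nat \<Rightarrow>
    (int \<Rightarrow> 'y) \<Rightarrow> (nat \<Rightarrow> 'x) \<Rightarrow> (nat \<Rightarrow> 'x) measure" where
  "twisted_kernel X G M \<psi> N \<omega> x = density (particle_kernel X G M N \<omega> x)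
     (\<lambda>x'. ennreal (particle_mean N \<psi> (env_shift 1 \<omega>) x' / twist_norm X G M \<psi> N \<omega> x))"

text \<open>The density of \<open>particle_kernel\<close> with respect to \<open>twisted_kernel\<close>.\<close>

definition phi :: "'x measure \<Rightarrow> ((int \<Rightarrow> 'y) \<Rightarrow> 'x \<Rightarrow> real) \<Rightarrow>
    ((int \<Rightarrow> 'y) \<Rightarrow> 'x \<Rightarrow> 'x measure) \<Rightarrow> ((int \<Rightarrow> 'y) \<Rightarrow> 'x \<Rightarrow> real) \<Rightarrow> nat \<Rightarrow>
    (int \<Rightarrow> 'y) \<Rightarrow> (nat \<Rightarrow> 'x) \<Rightarrow> (nat \<Rightarrow> 'x) \<Rightarrow> real" where
  "phi X G M \<psi> N \<omega> x x' = twist_norm X G M \<psi> N \<omega> x / particle_mean N \<psi> (env_shift 1 \<omega>) x'"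

definition V_tilde :: "'x measure \<Rightarrow> ((int \<Rightarrow> 'y) \<Rightarrow> 'x \<Rightarrow> real) \<Rightarrow> ((int \<Rightarrow> 'y) \<Rightarrow> 'x \<Rightarrow> 'x measure) \<Rightarrow>
    ((int \<Rightarrow> 'y) \<Rightarrow> 'x \<Rightarrow> real) \<Rightarrow> nat \<Rightarrow> 'x measure \<Rightarrow> nat \<Rightarrow> (int \<Rightarrow> 'y) \<Rightarrow> real" where
  "V_tilde X G M \<psi> N \<mu>0 n \<omega> =
     (\<integral>\<zeta>. (\<Prod>p<n. (particle_mean N G (env_shift (int p) \<omega>) (\<zeta> p))\<^sup>2 *
                 (phi X G M \<psi> N (env_shift (int p) \<omega>) (\<zeta> p) (\<zeta> (Suc p)))\<^sup>2)
        \<partial>chain_law (pow_space N X) (PiM {..<N} (\<lambda>_. \<mu>0))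
           (\<lambda>p. twisted_kernel X G M \<psi> N (env_shift (int p) \<omega>))) /
     (\<integral>\<xi>. (\<Prod>p<n. G (env_shift (int p) \<omega>) (\<xi> p))
        \<partial>chain_law X \<mu>0 (\<lambda>p. M (env_shift (int p) \<omega>)))\<^sup>2"

definition Upsilon :: "(int \<Rightarrow> 'y) measure \<Rightarrow> 'x measure \<Rightarrow> ((int \<Rightarrow> 'y) \<Rightarrow> 'x \<Rightarrow> real) \<Rightarrow>
    ((int \<Rightarrow> 'y) \<Rightarrow> 'x \<Rightarrow> 'x measure) \<Rightarrow> ((int \<Rightarrow> 'y) \<Rightarrow> 'x \<Rightarrow> real) \<Rightarrow> nat \<Rightarrow> real" where
  "Upsilon P X G M \<psi> N = (THE c. \<forall>\<mu>0. prob_space \<mu>0 \<and> sets \<mu>0 = sets X \<longrightarrow>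
     (AE \<omega> in P. (\<lambda>n. ln (V_tilde X G M \<psi> N \<mu>0 n \<omega>) / real n) \<longlonglongrightarrow> c))"

text \<open>
  The essential supremum of a function that is essentially bounded but possibly not measurable
  (below it is applied to suprema over an uncountable \<open>X\<close>); \<open>esssup\<close> of the library is \<open>top\<close>
  for non-measurable functions.
\<close>

definition ess_sup :: "'w measure \<Rightarrow> ('w \<Rightarrow> real) \<Rightarrow> real" where
  "ess_sup P f = Inf {c. AE \<omega> in P. f \<omega> \<le> c}"

text \<open>
  The suprema in \<open>C_const\<close> and \<open>D_const\<close> are real-valued: they are used only where
  \<open>\<psi>\<close> and \<open>h\<close> are bounded above and bounded away from \<open>0\<close>.
\<close>

definition C_const :: "'x measure \<Rightarrow> ('w \<Rightarrow> 'x \<Rightarrow> real) \<Rightarrow> ('w \<Rightarrow> 'x \<Rightarrow> real) \<Rightarrow> 'w \<Rightarrow> real" where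
  "C_const X \<psi> h \<omega> =
     (2 * (SUP (z, z')\<in>space X \<times> space X. \<psi> \<omega> z / \<psi> \<omega> z') - 1) *
     (SUP z\<in>space X. \<psi> \<omega> z / h \<omega> z)"

definition D_const :: "'w measure \<Rightarrow> 'x measure \<Rightarrow> ('w \<Rightarrow> 'x \<Rightarrow> real) \<Rightarrow> ('w \<Rightarrow> 'x \<Rightarrow> real) \<Rightarrow> real"
  where
  "D_const P X \<psi> h = ess_sup P (\<lambda>\<omega>. C_const X \<psi> h \<omega> *
     (SUP (z, z')\<in>space X \<times> space X. \<bar>h \<omega> z / \<psi> \<omega> z - h \<omega> z' / \<psi> \<omega> z'\<bar>))"

end

theory Submission
  imports Defs
begin

text \<open>
  Both expectations in \<open>V_tilde\<close> are total masses of iterated positive kernels: the kernel \<open>Q\<close> on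
  \<open>X\<close> and, on \<open>X\<^sup>N\<close>, the kernel \<open>G\<^sup>2 \<phi>\<^sup>2\<close> times the twisted transition.  Both kernels are
  comparable with a fixed probability measure, so the logarithms of the masses are additive along
  the shift up to a bounded error, and an ergodic theorem for almost additive sequences gives
  deterministic exponential rates; \<open>Upsilon\<close> is the rate of the numerator minus twice the rate of
  the denominator.

  The same comparability makes ratios of iterates contract geometrically, which yields the limit
  \<open>h\<close> and an equivariant eigenvalue relation \<open>Q h = \<lambda> h\<close>.  For the second kernel the square of
  the particle mean of \<open>h\<close> is a test function: one step multiplies it by at most
  \<open>\<lambda>\<^sup>2 (1 + D / (N - 1))\<close>, since conditionally the particles are independent with a common law and the
  excess is the variance of a sum of centred independent terms \<open>h - c \<psi>\<close>.
\<close>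

subsection \<open>An ergodic theorem for almost additive sequences\<close>

text \<open>The density of the twisted kernel is 1 / \<open>phi\<close>, so it uses up one of the
  two factors \<open>phi\<close> in the weight: against the untwisted kernel the integrand is the
  squared sum of \<open>h\<close> divided by the sum of \<psi>. For \<psi> proportional to
  \<open>h\<close> this is linear in the particles and its mean is explicit. In general the excess
  is the variance of a sum of N terms over a sum of N positive terms, small of order 1/N relative to
  the main term, and the variance can be bounded linearly in the oscillation of h/\<psi>. The
  argument gives the factor r/N with r the supremum of \<psi>(z)/\<psi>(z'); the stated (2r - 1)/(N
  - 1) is larger because r \<ge> 1. The products of eigenvalues cancel between the numerator and the
  squared denominator, so only factors 1 + D/(N - 1) at shifted environments survive. Because the
  shift preserves P, the essential supremum bounds all of them along almost every orbit.
  \<open>Upsilon\<close> is a definite description over all starting laws, so existence of a common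
  rate and its uniqueness have to be proved before it can be estimated; this is why an ergodic
  theorem is needed although only an upper bound is claimed.\<close>

locale ergodic_system = prob_space P for P :: "'w measure" and T :: "'w \<Rightarrow> 'w" +
  assumes preserves_T: "preserves P T" and ergodic_T: "ergodic P T"
begin

lemma measurable_T [measurable]: "T \<in> measurable P P"
  using preserves_T by (simp add: preserves_def)

lemma measurable_funpow_T [measurable]: "T ^^ n \<in> measurable P P"
  by (rule measurable_compose_n) measurable

lemma distr_funpow_T: "distr P P (T ^^ n) = P"
proof (induction n)
  case (Suc n)
  have "distr P P (T ^^ Suc n) = distr (distr P P (T ^^ n)) P T"
    by (subst distr_distr) auto
  also have "\<dots> = P"
    using Suc preserves_T by (simp add: preserves_def)
  finally show ?case .
qed (simp add: distr_id2)

lemma funpow_T_space: "x \<in> space P \<Longrightarrow> (T ^^ n) x \<in> space P"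
  by (rule measurable_space[OF measurable_funpow_T])

lemma AE_funpow_T:
  assumes "AE x in P. Q x"
  shows "AE x in P. \<forall>n. Q ((T ^^ n) x)"
proof -
  have "AE x in P. Q ((T ^^ n) x)" for n
    by (rule AE_distrD[OF measurable_funpow_T]) (unfold distr_funpow_T, rule assms)
  then show ?thesis
    by (simp add: AE_all_countable)
qed

lemma integral_funpow_T:
  fixes f :: "'w \<Rightarrow> real"
  assumes [measurable]: "f \<in> borel_measurable P"
  shows "(\<integral>x. f ((T ^^ n) x) \<partial>P) = (\<integral>x. f x \<partial>P)"
  by (metis integral_distr distr_funpow_T measurable_funpow_T assms)

text \<open>The superlevel sets of u are exactly invariant, so each has probability 0 or 1; the
  constant is the supremum of the levels whose superlevel set has full probability.\<close>

lemma invariant_AE_const: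
  fixes u :: "'w \<Rightarrow> real"
  assumes [measurable]: "u \<in> borel_measurable P"
    and inv: "\<And>x. x \<in> space P \<Longrightarrow> u (T x) = u x"
    and bound: "\<And>x. x \<in> space P \<Longrightarrow> \<bar>u x\<bar> \<le> B"
  obtains s where "AE x in P. u x = s"
proof -
  define A where "A c = {x \<in> space P. c \<le> u x}" for c
  have A_sets [measurable]: "A c \<in> sets P" for c
    unfolding A_def by measurable
  have zero_one: "prob (A c) = 0 \<or> prob (A c) = 1" for c
  proof -
    have "T -` A c \<inter> space P = A c"
      using inv measurable_space[OF measurable_T] by (auto simp: A_def)
    then show ?thesis
      using ergodic_T A_sets by (simp add: ergodic_def)
  qed
  define S where "S = {c. prob (A c) = 1}"
  have "A (- B) = space P"
    using bound by (fastforce simp: A_def)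
  then have S_ne: "- B \<in> S"
    by (simp add: S_def prob_space)
  have "c \<le> B" if "c \<in> S" for c
  proof (rule ccontr)
    assume "\<not> c \<le> B"
    then have "A c = {}"
      using bound by (fastforce simp: A_def)
    then show False using that by (simp add: S_def)
  qed
  then have S_bdd: "bdd_above S"
    by (rule bdd_aboveI)
  define s where "s = Sup S"
  have low: "AE x in P. s - 1 / real (Suc n) \<le> u x" for n
  proof -
    have "s - 1 / real (Suc n) < Sup S"
      by (simp add: s_def)
    then obtain c where c: "c \<in> S" "s - 1 / real (Suc n) < c"
      using S_ne by (subst (asm) less_cSup_iff[OF _ S_bdd]) auto
    then have "AE x in P. x \<in> A c"
      by (simp add: prob_eq_1 S_def)
    then show ?thesis
      by eventually_elim (use c in \<open>auto simp: A_def\<close>)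
  qed
  have up: "AE x in P. u x < s + 1 / real (Suc n)" for n
  proof -
    have "s + 1 / real (Suc n) \<notin> S"
      using cSup_upper[OF _ S_bdd, of "s + 1 / real (Suc n)"] by (auto simp: s_def)
    then have "prob (A (s + 1 / real (Suc n))) = 0"
      using zero_one by (auto simp: S_def)
    then have "AE x in P. x \<notin> A (s + 1 / real (Suc n))"
      by (simp add: prob_eq_0)
    then show ?thesis
      using AE_space by eventually_elim (auto simp: A_def)
  qed
  have "AE x in P. \<forall>n. s - 1 / real (Suc n) \<le> u x \<and> u x < s + 1 / real (Suc n)"
    using low up by (simp add: AE_all_countable)
  then have "AE x in P. u x = s"
  proof eventually_elim
    case (elim x)
    have "(\<lambda>n. s - 1 / real (Suc n)) \<longlonglongrightarrow> s - 0" "(\<lambda>n. s + 1 / real (Suc n)) \<longlonglongrightarrow> s + 0"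
      by (intro tendsto_intros LIMSEQ_Suc[OF lim_1_over_n])+
    then have "s - 0 \<le> u x" "u x \<le> s + 0"
      using elim by (blast intro: LIMSEQ_le_const2 LIMSEQ_le_const less_imp_le)+
    then show ?case by simp
  qed
  then show ?thesis by (rule that)
qed

text \<open>The orbit segment of length \<open>N\<close> is covered greedily by blocks on which \<open>b\<close> grows at rate at
  least \<open>s\<close>, and by single bad steps; the last block, of length at most \<open>M\<close>, costs a constant.\<close>

lemma superadditive_block_bound:
  fixes b :: "nat \<Rightarrow> 'w \<Rightarrow> real" and x :: 'w
  assumes super: "\<And>m n x. x \<in> space P \<Longrightarrow> b n x + b m ((T ^^ n) x) \<le> b (n + m) x"
    and lower: "\<And>n x. x \<in> space P \<Longrightarrow> 1 \<le> n \<Longrightarrow> - (real n * B) \<le> b n x"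
    and zero: "\<And>x. x \<in> space P \<Longrightarrow> b 0 x \<ge> - B" and "B \<ge> 0"
    and x: "x \<in> space P"
    and g: "\<And>x :: 'w. g x = s - (\<bar>s\<bar> + B) * indicat_real {x \<in> space P. \<forall>n\<in>{1..M}. b n x < real n * s} x"
  shows "(\<Sum>i<N. g ((T ^^ i) x)) - (real M + 1) * (\<bar>s\<bar> + B) \<le> b N x"
  using x
proof (induction N arbitrary: x rule: less_induct)
  case (less N)
  have g_le: "g x \<le> s" for x
    using \<open>B \<ge> 0\<close> by (auto simp: g indicator_def)
  have sum_le: "(\<Sum>i<n. g ((T ^^ i) y)) \<le> real n * s" for n and y :: 'w
    using sum_bounded_above[of "{..<n}" "\<lambda>i. g ((T ^^ i) y)" s] g_le by simp
  have shift: "(\<Sum>i<n + k. g ((T ^^ i) y)) = (\<Sum>i<n. g ((T ^^ i) y)) + (\<Sum>i<k. g ((T ^^ i) ((T ^^ n) y)))"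
    for n k and y :: 'w
    by (induction k) (simp_all add: funpow_add[symmetric] add.commute flip: comp_apply[of "_ ^^ _"])
  consider "N \<le> M" | "N > M" "\<forall>n\<in>{1..M}. b n x < real n * s"
    | n where "N > M" "n \<in> {1..M}" "b n x \<ge> real n * s"
    by force
  then show ?case
  proof cases
    case 1
    \<comment> \<open>A segment of length at most M is paid for by the constant alone; the
      additional 1 in M + 1 absorbs the lower bound - B at N = 0.\<close>
    have "real N * s \<le> real N * \<bar>s\<bar>" by (simp add: mult_left_mono)
    moreover have "real N * (\<bar>s\<bar> + B) \<le> real M * (\<bar>s\<bar> + B)"
      using 1 \<open>B \<ge> 0\<close> by (intro mult_right_mono) auto
    moreover have "- (real N * B) - B \<le> b N x"
      using lower[OF less.prems, of N] zero[OF less.prems] \<open>B \<ge> 0\<close>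
      by (cases "N = 0") auto
    ultimately show ?thesis
      using sum_le[of x N] by (simp add: algebra_simps)
  next
    case 2
    then have N: "1 + (N - 1) = N" by simp
    \<comment> \<open>On the bad set g equals s - \<bar>s\<bar> - B, which is chosen so that the
      trivial bound for a single step already pays for it.\<close>
    have "g x \<le> - B"
      using 2 less.prems by (simp add: g)
    moreover have "- B \<le> b 1 x"
      using lower[OF less.prems, of 1] by simp
    moreover have "b 1 x + b (N - 1) ((T ^^ 1) x) \<le> b N x"
      using super[OF less.prems, of 1 "N - 1"] N by simp
    moreover have "(\<Sum>i<N. g ((T ^^ i) x)) = g x + (\<Sum>i<N - 1. g ((T ^^ i) ((T ^^ 1) x)))"
      using shift[of x 1 "N - 1"] N by simp
    moreover have "(\<Sum>i<N - 1. g ((T ^^ i) ((T ^^ 1) x))) - (real M + 1) * (\<bar>s\<bar> + B)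
        \<le> b (N - 1) ((T ^^ 1) x)"
      using 2 less.prems by (intro less.IH funpow_T_space) auto
    ultimately show ?thesis by linarith
  next
    case 3
    then have N: "n + (N - n) = N" by simp
    have "b n x + b (N - n) ((T ^^ n) x) \<le> b N x"
      using super[OF less.prems, of n "N - n"] N by simp
    moreover have "(\<Sum>i<N. g ((T ^^ i) x)) = (\<Sum>i<n. g ((T ^^ i) x)) + (\<Sum>i<N - n. g ((T ^^ i) ((T ^^ n) x)))"
      using shift[of x n "N - n"] N by simp
    moreover have "(\<Sum>i<N - n. g ((T ^^ i) ((T ^^ n) x))) - (real M + 1) * (\<bar>s\<bar> + B)
        \<le> b (N - n) ((T ^^ n) x)"
      using 3 less.prems by (intro less.IH funpow_T_space) auto
    ultimately show ?thesis using sum_le[of x n] 3(3) by linarith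
  qed
qed

text \<open>Integrate the block bound. By invariance each term of the orbit sum has the same mean s
  - (\<bar>s\<bar> + B) \<open>prob (E M)\<close>, where \<open>E M\<close> is the set of points
  without a good block of length at most M. These sets decrease to a null set, so one M makes the
  loss at most e, and the remaining cost does not depend on n.\<close>

lemma superadditive_integral_lower:
  fixes b :: "nat \<Rightarrow> 'w \<Rightarrow> real"
  assumes b_int: "\<And>n. integrable P (b n)"
    and super: "\<And>m n x. x \<in> space P \<Longrightarrow> b n x + b m ((T ^^ n) x) \<le> b (n + m) x"
    and lower: "\<And>n x. x \<in> space P \<Longrightarrow> 1 \<le> n \<Longrightarrow> - (real n * B) \<le> b n x"
    and zero: "\<And>x. x \<in> space P \<Longrightarrow> b 0 x \<ge> - B" and "B \<ge> 0"
    and often: "AE x in P. \<exists>n\<ge>1. real n * s \<le> b n x"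
    and "0 < e"
  shows "\<exists>D. \<forall>n. real n * (s - e) - D \<le> (\<integral>x. b n x \<partial>P)"
proof -
  have [measurable]: "b n \<in> borel_measurable P" for n
    using b_int by auto
  define E where "E M = {x \<in> space P. \<forall>n\<in>{1..M}. b n x < real n * s}" for M
  have E_sets [measurable]: "E M \<in> sets P" for M
    unfolding E_def by measurable
  have "(\<lambda>M. prob (E M)) \<longlonglongrightarrow> prob (\<Inter>M. E M)"
    by (rule finite_Lim_measure_decseq) (auto simp: decseq_def E_def)
  moreover have "AE x in P. x \<notin> (\<Inter>M. E M)"
    using often by eventually_elim (force simp: E_def)
  then have "prob (\<Inter>M. E M) = 0"
    by (subst prob_eq_0) auto
  ultimately have lim: "(\<lambda>M. prob (E M)) \<longlonglongrightarrow> 0" by simp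
  \<comment> \<open>The summand 1 keeps the denominator positive when s and B both vanish.\<close>
  have "0 < e / (\<bar>s\<bar> + B + 1)"
    using \<open>0 < e\<close> \<open>B \<ge> 0\<close> by simp
  from order_tendstoD(2)[OF lim this] obtain M where M: "prob (E M) < e / (\<bar>s\<bar> + B + 1)"
    by (auto simp: eventually_sequentially)
  have "(\<bar>s\<bar> + B) * prob (E M) \<le> (\<bar>s\<bar> + B + 1) * prob (E M)"
    by (simp add: mult_right_mono)
  also have "\<dots> \<le> e"
    using M \<open>B \<ge> 0\<close> by (simp add: pos_less_divide_eq mult.commute less_imp_le)
  finally have small: "(\<bar>s\<bar> + B) * prob (E M) \<le> e" .
  define g where "g x = s - (\<bar>s\<bar> + B) * indicat_real (E M) x" for x
  have [measurable]: "g \<in> borel_measurable P"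
    unfolding g_def by measurable
  have g_int: "integrable P (\<lambda>x. g ((T ^^ i) x))" for i
    by (rule integrable_const_bound[where B = "\<bar>s\<bar> + (\<bar>s\<bar> + B)"])
      (use \<open>B \<ge> 0\<close> in \<open>auto simp: g_def indicator_def intro!: AE_I2\<close>)
  have "(\<integral>x. g x \<partial>P) = s - (\<bar>s\<bar> + B) * prob (E M)"
    unfolding g_def by (subst Bochner_Integration.integral_diff) (auto simp: prob_space emeasure_eq_measure)
  then have g_ge: "s - e \<le> (\<integral>x. g x \<partial>P)"
    using small by simp
  define D where "D = (real M + 1) * (\<bar>s\<bar> + B)"
  have "real n * (s - e) - D \<le> (\<integral>x. b n x \<partial>P)" for n
  proof -
    have "real n * (s - e) - D \<le> (\<Sum>i<n. \<integral>x. g ((T ^^ i) x) \<partial>P) - D"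
      using g_ge by (simp add: integral_funpow_T mult_left_mono)
    also have "\<dots> = (\<integral>x. (\<Sum>i<n. g ((T ^^ i) x)) - D \<partial>P)"
      using g_int by (subst Bochner_Integration.integral_diff) (auto simp: prob_space Bochner_Integration.integral_sum)
    also have "\<dots> \<le> (\<integral>x. b n x \<partial>P)"
    proof (rule integral_mono)
      fix x assume x: "x \<in> space P"
      show "(\<Sum>i<n. g ((T ^^ i) x)) - D \<le> b n x"
        unfolding D_def
        by (rule superadditive_block_bound[OF super lower zero \<open>B \<ge> 0\<close> x]) (auto simp: g_def E_def)
    qed (use g_int b_int in auto)
    finally show ?thesis .
  qed
  then show ?thesis by blast
qed

text \<open>Replacing a(n + 1) at x by a(n) at T x changes the value by a bounded amount, which
  disappears after division by n. So the limsup of the averages is invariant at every point, and it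
  is real because the averages are bounded.\<close>

lemma real_average_AE_limsup:
  fixes a :: "nat \<Rightarrow> 'w \<Rightarrow> real"
  assumes [measurable]: "\<And>n. a n \<in> borel_measurable P"
    and bound: "\<And>n x. x \<in> space P \<Longrightarrow> \<bar>a n x\<bar> \<le> real n * B"
    and additive: "\<And>n x. x \<in> space P \<Longrightarrow> \<bar>a (Suc n) x - a n (T x)\<bar> \<le> C"
  obtains s where "AE x in P. limsup (\<lambda>n. ereal (a n x / real n)) = ereal s"
proof -
  define U where "U x = limsup (\<lambda>n. ereal (a n x / real n))" for x
  have "0 \<le> B" using bound[of _ 1] not_empty by force
  \<comment> \<open>At n = 0 the quotient is 0 by the convention for division, and the bound reduces
    to 0 \<le> B.\<close>
  have avg: "\<bar>a n x / real n\<bar> \<le> B" if "x \<in> space P" for x n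
    using bound[OF that, of n] \<open>0 \<le> B\<close> by (cases "n = 0") (auto simp: divide_le_eq mult.commute)
  have U_bound: "ereal (- B) \<le> U x" "U x \<le> ereal B" if "x \<in> space P" for x
  proof -
    show "U x \<le> ereal B"
      unfolding U_def by (rule Limsup_bounded) (intro always_eventually allI, use avg[OF that] in \<open>simp only: abs_le_iff ereal_less_eq\<close>)
    have "ereal (- B) \<le> liminf (\<lambda>n. ereal (a n x / real n))"
      by (rule Liminf_bounded) (intro always_eventually allI, use avg[OF that] in \<open>simp only: abs_le_iff ereal_less_eq minus_le_iff\<close>)
    also have "\<dots> \<le> U x" unfolding U_def by (rule Liminf_le_Limsup) simp
    finally show "ereal (- B) \<le> U x" .
  qed
  have U_fin: "\<bar>U x\<bar> \<noteq> \<infinity>" if "x \<in> space P" for x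
    using U_bound[OF that] by (cases "U x") auto
  have inv: "U (T x) = U x" if x: "x \<in> space P" for x
  proof -
    have Tx: "T x \<in> space P" using x by (rule measurable_space[OF measurable_T])
    define d where "d n = a (Suc n) x / real (Suc n) - a n (T x) / real n" for n
    have d: "d \<longlonglongrightarrow> 0"
    proof (rule Lim_null_comparison)
      show "\<forall>\<^sub>F n in sequentially. norm (d n) \<le> (C + B) * (1 / real n)"
      proof (rule eventually_sequentiallyI[of 1])
        fix n :: nat assume n: "1 \<le> n"
        \<comment> \<open>Both quotients are put over n + 1: the difference of the values is bounded
          by C, and the correction from 1/n - 1/(n + 1) = 1/(n (n + 1)) is a bounded average divided
          by n + 1.\<close>
        have "d n = (a (Suc n) x - a n (T x)) / real (Suc n) - a n (T x) / real n / real (Suc n)"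
          proof -
          have "a n (T x) / real n = a n (T x) / real (Suc n) + a n (T x) / real n / real (Suc n)"
          proof -
            have "0 < real n" "real (Suc n) = real n + 1" using n by auto
            then show ?thesis by (simp only:) (simp add: divide_simps, simp add: algebra_simps)
          qed
          then show ?thesis unfolding d_def diff_divide_distrib by linarith
        qed
        also have "\<bar>\<dots>\<bar> \<le> C / real (Suc n) + B / real (Suc n)"
        proof (intro order_trans[OF abs_triangle_ineq4] add_mono)
          show "\<bar>(a (Suc n) x - a n (T x)) / real (Suc n)\<bar> \<le> C / real (Suc n)"
            using additive[OF x, of n] by (simp add: abs_divide divide_right_mono)
          show "\<bar>a n (T x) / real n / real (Suc n)\<bar> \<le> B / real (Suc n)"
            unfolding abs_divide[of _ "real (Suc n)"] abs_of_nat
            by (rule divide_right_mono[OF avg[OF Tx]]) simp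
        qed
        also have "\<dots> \<le> (C + B) * (1 / real n)"
        proof -
          have "0 \<le> C + B" using additive[OF x, of 0] \<open>0 \<le> B\<close> by linarith
          then have "(C + B) / real (Suc n) \<le> (C + B) / real n"
            using n by (intro divide_left_mono) auto
          then show ?thesis by (simp add: add_divide_distrib)
        qed
        finally show "norm (d n) \<le> (C + B) * (1 / real n)" by simp
      qed
      show "(\<lambda>n. (C + B) * (1 / real n)) \<longlonglongrightarrow> 0"
        by (intro tendsto_mult_right_zero lim_1_over_n)
    qed
    have "U x = limsup (\<lambda>n. ereal (a (Suc n) x / real (Suc n)))"
      unfolding U_def using limsup_shift[of "\<lambda>n. ereal (a n x / real n)"] by simp
    also have "\<dots> = limsup (\<lambda>n. ereal (d n) + ereal (a n (T x) / real n))"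
      by (simp add: d_def)
    also have "\<dots> = 0 + limsup (\<lambda>n. ereal (a n (T x) / real n))"
      by (rule ereal_limsup_lim_add) (use d in \<open>auto simp: zero_ereal_def\<close>)
    finally show ?thesis by (simp add: U_def)
  qed
  have [measurable]: "U \<in> borel_measurable P"
    unfolding U_def by measurable
  obtain s where "AE x in P. real_of_ereal (U x) = s"
  proof (rule invariant_AE_const[of "\<lambda>x. real_of_ereal (U x)" B])
    show "\<bar>real_of_ereal (U x)\<bar> \<le> B" if "x \<in> space P" for x
      using U_bound[OF that] by (cases "U x") auto
  qed (auto simp: inv)
  then have "AE x in P. U x = ereal s"
    using AE_space by eventually_elim (use U_fin in \<open>auto simp: ereal_real'\<close>)
  then show ?thesis
    unfolding U_def by (rule that)
qed

text \<open>Subtracting the constant C turns an almost additive sequence into a superadditive one.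
  Almost every point then has a block with rate at least s - e/2, because the limsup of the averages
  is s and C is negligible for long blocks.\<close>

lemma almost_additive_limsup_le_integral:
  fixes a :: "nat \<Rightarrow> 'w \<Rightarrow> real"
  assumes [measurable]: "\<And>n. a n \<in> borel_measurable P"
    and bound: "\<And>n x. x \<in> space P \<Longrightarrow> \<bar>a n x\<bar> \<le> real n * B"
    and additive: "\<And>m n x. x \<in> space P \<Longrightarrow> \<bar>a (n + m) x - a n x - a m ((T ^^ n) x)\<bar> \<le> C"
    and lim_sup: "AE x in P. limsup (\<lambda>n. ereal (a n x / real n)) = ereal s"
    and "0 < e"
  shows "\<exists>D. \<forall>n. real n * (s - e) - D \<le> (\<integral>x. a n x \<partial>P)"
proof -
  obtain x0 where x0: "x0 \<in> space P" using not_empty by blast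
  have "0 \<le> B" using bound[OF x0, of 1] by simp
  have "0 \<le> C" using additive[OF x0, of 0 0] by linarith
  define b where "b n x = a n x - C" for n x
  have a_int: "integrable P (a n)" for n
    by (rule integrable_const_bound[where B = "real n * B"]) (use bound in auto)
  have "\<exists>D. \<forall>n. real n * ((s - e / 2) - e / 2) - D \<le> (\<integral>x. b n x \<partial>P)"
  proof (rule superadditive_integral_lower)
    show "integrable P (b n)" for n unfolding b_def using a_int by simp
    show "b n x + b m ((T ^^ n) x) \<le> b (n + m) x" if "x \<in> space P" for m n x
      using additive[OF that, of n m] by (simp add: b_def abs_le_iff)
    show "- (real n * (B + C)) \<le> b n x" if "x \<in> space P" "1 \<le> n" for n x
    proof -
      have "1 * C \<le> real n * C" using that \<open>0 \<le> C\<close> by (intro mult_right_mono) auto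
      then show ?thesis using bound[OF that(1), of n] by (simp add: b_def algebra_simps)
    qed
    show "- (B + C) \<le> b 0 x" if "x \<in> space P" for x
      using bound[OF that, of 0] \<open>0 \<le> B\<close> by (simp add: b_def)
    show "0 \<le> B + C" using \<open>0 \<le> B\<close> \<open>0 \<le> C\<close> by simp
    show "0 < e / 2" using \<open>0 < e\<close> by simp
    show "AE x in P. \<exists>n\<ge>1. real n * (s - e / 2) \<le> b n x"
      using lim_sup
    proof eventually_elim
      case (elim x)
      \<comment> \<open>The slack e/2 is spent in two halves: e/4 on the average coming close to its
        limsup, and e/4 on C, which is at most n e/4 once n is at least n0.\<close>
      obtain n0 :: nat where n0: "C / (e / 4) < real n0"
        using reals_Archimedean2 by blast
      have "ereal (s - e / 4) < limsup (\<lambda>n. ereal (a n x / real n))"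
        using elim \<open>0 < e\<close> by simp
      then have "\<exists>\<^sub>F n in sequentially. ereal (s - e / 4) < ereal (a n x / real n)"
        using Limsup_bounded[where F = sequentially and C = "ereal (s - e / 4)" and X = "\<lambda>n. ereal (a n x / real n)"]
        by (force simp: frequently_def not_less)
      then obtain n where n: "n \<ge> max n0 1" "s - e / 4 < a n x / real n"
        unfolding frequently_sequentially by (metis less_ereal.simps(1))
      have "C \<le> real n * (e / 4)"
      proof -
        have "C < real n0 * (e / 4)" using n0 \<open>0 < e\<close> by (simp add: field_simps)
        also have "\<dots> \<le> real n * (e / 4)" using n \<open>0 < e\<close> by (intro mult_right_mono) auto
        finally show ?thesis by simp
      qed
      moreover have "real n * (s - e / 4) \<le> a n x"
        using n by (simp add: field_simps)
      ultimately have "real n * (s - e / 2) \<le> b n x"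
        by (simp add: b_def algebra_simps)
      then show ?case using n by auto
    qed
  qed
  then obtain D where D: "\<And>n. real n * ((s - e / 2) - e / 2) - D \<le> (\<integral>x. b n x \<partial>P)" by blast
  have b_a: "(\<integral>x. b n x \<partial>P) = (\<integral>x. a n x \<partial>P) - C" for n
    unfolding b_def using a_int by (subst Bochner_Integration.integral_diff) (auto simp: prob_space)
  have "real n * (s - e) - (D - C) \<le> (\<integral>x. a n x \<partial>P)" for n
    using D[of n] b_a[of n] by (simp add: algebra_simps)
  then show ?thesis by blast
qed

text \<open>The hypotheses are symmetric under a sign change, so the lower bound for integrals
  applies to a and to - a. With s the limsup and - i the liminf of the averages, adding the two
  bounds cancels the integrals and leaves n (s + i - e/2) bounded in n. Hence s \<le> - i, and
  limsup and liminf agree.\<close>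

theorem almost_additive_ergodic:
  fixes a :: "nat \<Rightarrow> 'w \<Rightarrow> real"
  assumes meas [measurable]: "\<And>n. a n \<in> borel_measurable P"
    and bound: "\<And>n x. x \<in> space P \<Longrightarrow> \<bar>a n x\<bar> \<le> real n * B"
    and additive: "\<And>m n x. x \<in> space P \<Longrightarrow> \<bar>a (n + m) x - a n x - a m ((T ^^ n) x)\<bar> \<le> C"
  obtains c where "AE x in P. (\<lambda>n. a n x / real n) \<longlonglongrightarrow> c"
proof -
  have step: "\<bar>a (Suc n) x - a n (T x)\<bar> \<le> C + B" if "x \<in> space P" for n x
    using additive[OF that, of 1 n] bound[OF that, of 1] by simp
  obtain s where s: "AE x in P. limsup (\<lambda>n. ereal (a n x / real n)) = ereal s"
    using real_average_AE_limsup[OF meas bound step] by blast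
  define a' where "a' n x = - a n x" for n x
  have meas': "a' n \<in> borel_measurable P" for n
    unfolding a'_def by measurable
  have bound': "\<bar>a' n x\<bar> \<le> real n * B" if "x \<in> space P" for n x
    using bound[OF that] by (simp add: a'_def)
  have additive': "\<bar>a' (n + m) x - a' n x - a' m ((T ^^ n) x)\<bar> \<le> C" if "x \<in> space P" for m n x
    using additive[OF that, of n m] by (simp add: a'_def)
  have step': "\<bar>a' (Suc n) x - a' n (T x)\<bar> \<le> C + B" if "x \<in> space P" for n x
    using step[OF that, of n] by (simp add: a'_def)
  obtain i where i: "AE x in P. limsup (\<lambda>n. ereal (a' n x / real n)) = ereal i"
    using real_average_AE_limsup[OF meas' bound' step'] by blast
  have "s + i \<le> 0"
  proof (rule field_le_epsilon)
    fix e :: real assume "0 < e"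
    then have "0 < e / 4" by simp
    obtain D where D: "\<And>n. real n * (s - e / 4) - D \<le> (\<integral>x. a n x \<partial>P)"
      using almost_additive_limsup_le_integral[OF meas bound additive s \<open>0 < e / 4\<close>] by blast
    obtain D' where D': "\<And>n. real n * (i - e / 4) - D' \<le> (\<integral>x. a' n x \<partial>P)"
      using almost_additive_limsup_le_integral[OF meas' bound' additive' i \<open>0 < e / 4\<close>] by blast
    have sum: "real n * (s + i - e / 2) \<le> D + D'" for n
      using D[of n] D'[of n] by (simp add: a'_def algebra_simps)
    show "s + i \<le> 0 + e"
    proof (rule ccontr)
      assume "\<not> s + i \<le> 0 + e"
      then have pos: "0 < s + i - e / 2" using \<open>0 < e\<close> by simp
      obtain n :: nat where "(D + D') / (s + i - e / 2) < real n"
        using reals_Archimedean2 by blast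
      then show False using sum[of n] pos by (simp add: pos_divide_less_eq)
    qed
  qed
  have "AE x in P. (\<lambda>n. a n x / real n) \<longlonglongrightarrow> s"
    using s i
  proof eventually_elim
    case (elim x)
    have "liminf (\<lambda>n. ereal (a n x / real n)) = - limsup (\<lambda>n. ereal (a' n x / real n))"
      using ereal_Limsup_uminus[of sequentially "\<lambda>n. ereal (a n x / real n)"] by (simp add: a'_def)
    also have "\<dots> = ereal (- i)" using elim by simp
    finally have liminf: "liminf (\<lambda>n. ereal (a n x / real n)) = ereal (- i)" .
    have "ereal (- i) \<le> ereal s"
      using Liminf_le_Limsup[of sequentially "\<lambda>n. ereal (a n x / real n)"] elim liminf by simp
    then have "- i = s" using \<open>s + i \<le> 0\<close> by simp
    then have "(\<lambda>n. ereal (a n x / real n)) \<longlonglongrightarrow> ereal s"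
      using elim liminf by (intro tendsto_iff_Liminf_eq_Limsup[THEN iffD2]) auto
    then show ?case by simp
  qed
  then show ?thesis by (rule that)
qed

end

subsection \<open>Kernels and the law of a Markov chain\<close>

text \<open>The same measure as \<open>act\<close>, but the kernel may start from another type: the
  mixture of the particle system averages a kernel over particle indices.\<close>

definition kernel_comp :: "'s measure \<Rightarrow> 'a measure \<Rightarrow> ('a \<Rightarrow> 's measure) \<Rightarrow> 's measure" where
  "kernel_comp S \<mu> K = measure_of (space S) (sets S) (\<lambda>A. \<integral>\<^sup>+x. emeasure (K x) A \<partial>\<mu>)"

lemma act_eq_kernel_comp: "act = kernel_comp"
  by (simp add: fun_eq_iff act_def kernel_comp_def)

lemma
  fixes S :: "'s measure"
  assumes sets_K: "\<And>x. x \<in> space \<mu> \<Longrightarrow> sets (K x) = sets S"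
    and meas_K: "\<And>A. A \<in> sets S \<Longrightarrow> (\<lambda>x. emeasure (K x) A) \<in> borel_measurable \<mu>"
  shows sets_kernel_comp: "sets (kernel_comp S \<mu> K) = sets S"
    and space_kernel_comp: "space (kernel_comp S \<mu> K) = space S"
    and emeasure_kernel_comp: "A \<in> sets S \<Longrightarrow> emeasure (kernel_comp S \<mu> K) A = (\<integral>\<^sup>+x. emeasure (K x) A \<partial>\<mu>)"
proof -
  show "sets (kernel_comp S \<mu> K) = sets S" "space (kernel_comp S \<mu> K) = space S"
    by (simp_all add: kernel_comp_def)
  show "emeasure (kernel_comp S \<mu> K) A = (\<integral>\<^sup>+x. emeasure (K x) A \<partial>\<mu>)" if "A \<in> sets S"
    unfolding kernel_comp_def
  proof (rule emeasure_measure_of_sigma)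
    show "sigma_algebra (space S) (sets S)" ..
    show "positive (sets S) (\<lambda>A. \<integral>\<^sup>+x. emeasure (K x) A \<partial>\<mu>)"
      by (simp add: positive_def)
    show "countably_additive (sets S) (\<lambda>A. \<integral>\<^sup>+x. emeasure (K x) A \<partial>\<mu>)"
    proof (rule countably_additiveI)
      fix A :: "nat \<Rightarrow> _" assume A: "range A \<subseteq> sets S" "disjoint_family A"
      then have "(\<Sum>i. \<integral>\<^sup>+x. emeasure (K x) (A i) \<partial>\<mu>) = (\<integral>\<^sup>+x. (\<Sum>i. emeasure (K x) (A i)) \<partial>\<mu>)"
        by (intro nn_integral_suminf[symmetric] meas_K) auto
      also have "\<dots> = (\<integral>\<^sup>+x. emeasure (K x) (\<Union>i. A i) \<partial>\<mu>)"
        using A by (intro nn_integral_cong suminf_emeasure) (auto simp: sets_K)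
      finally show "(\<Sum>i. \<integral>\<^sup>+x. emeasure (K x) (A i) \<partial>\<mu>) = (\<integral>\<^sup>+x. emeasure (K x) (\<Union>i. A i) \<partial>\<mu>)" .
    qed
  qed fact
qed

lemma nn_integral_kernel_comp:
  fixes S :: "'s measure"
  assumes sets_K: "\<And>x. x \<in> space \<mu> \<Longrightarrow> sets (K x) = sets S"
    and meas_K: "\<And>A. A \<in> sets S \<Longrightarrow> (\<lambda>x. emeasure (K x) A) \<in> borel_measurable \<mu>"
    and f: "f \<in> borel_measurable S"
  shows "(\<integral>\<^sup>+y. f y \<partial>kernel_comp S \<mu> K) = (\<integral>\<^sup>+x. \<integral>\<^sup>+y. f y \<partial>K x \<partial>\<mu>)"
proof -
  note comp = sets_kernel_comp[OF sets_K meas_K] space_kernel_comp[OF sets_K meas_K] emeasure_kernel_comp[OF sets_K meas_K]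
  have cong1: "h \<in> borel_measurable (kernel_comp S \<mu> K) \<longleftrightarrow> h \<in> borel_measurable S" for h :: "'s \<Rightarrow> ennreal"
    by (simp add: measurable_cong_sets[OF comp(1) refl])
  have cong2: "h \<in> borel_measurable (K x) \<longleftrightarrow> h \<in> borel_measurable S"
    if "x \<in> space \<mu>" for h :: "'s \<Rightarrow> ennreal" and x
    by (simp add: measurable_cong_sets[OF sets_K[OF that] refl])
  have space_K: "space (K x) = space S" if "x \<in> space \<mu>" for x
    using sets_K[OF that] by (rule sets_eq_imp_space_eq)
  \<comment> \<open>Measurability of the inner integral is carried through the same induction,
    because the cases of sums and suprema integrate it against \<mu>.\<close>
  have "(\<lambda>x. \<integral>\<^sup>+y. f y \<partial>K x) \<in> borel_measurable \<mu> \<and>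
      (\<integral>\<^sup>+y. f y \<partial>kernel_comp S \<mu> K) = (\<integral>\<^sup>+x. \<integral>\<^sup>+y. f y \<partial>K x \<partial>\<mu>)"
    using f
  proof (induction rule: borel_measurable_induct)
    case (cong f g)
    have eq: "(\<integral>\<^sup>+y. f y \<partial>K x) = (\<integral>\<^sup>+y. g y \<partial>K x)" if "x \<in> space \<mu>" for x
      by (rule nn_integral_cong) (simp add: cong.hyps space_K that)
    have "(\<lambda>x. \<integral>\<^sup>+y. f y \<partial>K x) \<in> borel_measurable \<mu> \<longleftrightarrow> (\<lambda>x. \<integral>\<^sup>+y. g y \<partial>K x) \<in> borel_measurable \<mu>"
      "(\<integral>\<^sup>+x. \<integral>\<^sup>+y. f y \<partial>K x \<partial>\<mu>) = (\<integral>\<^sup>+x. \<integral>\<^sup>+y. g y \<partial>K x \<partial>\<mu>)"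
      by (rule measurable_cong, erule eq) (rule nn_integral_cong, erule eq)
    moreover have "(\<integral>\<^sup>+y. f y \<partial>kernel_comp S \<mu> K) = (\<integral>\<^sup>+y. g y \<partial>kernel_comp S \<mu> K)"
      by (rule nn_integral_cong) (simp add: cong.hyps comp)
    ultimately show ?case using cong.IH by simp
  next
    case (set A)
    have "(\<integral>\<^sup>+y. indicator A y \<partial>K x) = emeasure (K x) A" if "x \<in> space \<mu>" for x
      using set by (simp add: sets_K that)
    then show ?case
      using set meas_K[OF set]
      by (auto simp: comp nn_integral_indicator cong: measurable_cong nn_integral_cong)
  next
    case (mult u c)
    have "(\<integral>\<^sup>+y. c * u y \<partial>K x) = c * (\<integral>\<^sup>+y. u y \<partial>K x)" if "x \<in> space \<mu>" for x
      using mult that by (intro nn_integral_cmult) (simp add: cong2)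
    moreover have "(\<lambda>x. c * (\<integral>\<^sup>+y. u y \<partial>K x)) \<in> borel_measurable \<mu>"
      using mult by (intro borel_measurable_times_ennreal) auto
    ultimately show ?case
      using mult by (simp add: nn_integral_cmult cong1 cong: measurable_cong nn_integral_cong)
  next
    case (add u v)
    have "(\<integral>\<^sup>+y. v y + u y \<partial>K x) = (\<integral>\<^sup>+y. v y \<partial>K x) + (\<integral>\<^sup>+y. u y \<partial>K x)" if "x \<in> space \<mu>" for x
      using add that by (intro nn_integral_add) (simp_all add: cong2)
    moreover have "(\<lambda>x. (\<integral>\<^sup>+y. v y \<partial>K x) + (\<integral>\<^sup>+y. u y \<partial>K x)) \<in> borel_measurable \<mu>"
      using add by (intro borel_measurable_add) auto
    ultimately show ?case
      using add by (simp add: nn_integral_add cong1 cong: measurable_cong nn_integral_cong)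
  next
    case (seq U)
    have "(\<integral>\<^sup>+y. (SUP i. U i) y \<partial>K x) = (SUP i. \<integral>\<^sup>+y. U i y \<partial>K x)" if "x \<in> space \<mu>" for x
      unfolding SUP_apply using seq that
      by (intro nn_integral_monotone_convergence_SUP) (simp_all add: cong2)
    moreover have "(\<integral>\<^sup>+y. (SUP i. U i) y \<partial>kernel_comp S \<mu> K) = (SUP i. \<integral>\<^sup>+y. U i y \<partial>kernel_comp S \<mu> K)"
      unfolding SUP_apply using seq
      by (intro nn_integral_monotone_convergence_SUP) (simp_all add: cong1)
    moreover have "(\<integral>\<^sup>+x. (SUP i. \<integral>\<^sup>+y. U i y \<partial>K x) \<partial>\<mu>) = (SUP i. \<integral>\<^sup>+x. \<integral>\<^sup>+y. U i y \<partial>K x \<partial>\<mu>)"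
      using seq by (intro nn_integral_monotone_convergence_SUP)
        (auto simp: mono_def le_fun_def intro!: nn_integral_mono)
    moreover have "(\<lambda>x. SUP i. \<integral>\<^sup>+y. U i y \<partial>K x) \<in> borel_measurable \<mu>"
      using seq by (intro borel_measurable_SUP) auto
    ultimately show ?case
      using seq by (simp cong: measurable_cong nn_integral_cong)
  qed
  then show "(\<integral>\<^sup>+y. f y \<partial>kernel_comp S \<mu> K) = (\<integral>\<^sup>+x. \<integral>\<^sup>+y. f y \<partial>K x \<partial>\<mu>)" by auto
qed

lemma nn_integral_mono_kernel_bound:
  assumes sets: "sets m = sets \<nu>"
    and bound: "\<And>A. A \<in> sets \<nu> \<Longrightarrow> emeasure m A \<le> c * emeasure \<nu> A"
    and f: "f \<in> borel_measurable \<nu>"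
  shows "(\<integral>\<^sup>+x. f x \<partial>m) \<le> c * (\<integral>\<^sup>+x. f x \<partial>\<nu>)"
proof -
  have "(\<integral>\<^sup>+x. f x \<partial>m) \<le> (\<integral>\<^sup>+x. f x \<partial>scale_measure c \<nu>)"
  proof (rule nn_integral_mono_measure)
    show "m \<le> scale_measure c \<nu>"
      by (subst le_measure) (auto simp: sets bound)
  qed (use sets in auto)
  also have "\<dots> = c * (\<integral>\<^sup>+x. f x \<partial>\<nu>)"
    using f by (rule nn_integral_scale_measure)
  finally show ?thesis .
qed

text \<open>The recursion applies the latest transition to g first, in the order in which the
  coordinates of a chain law are integrated out.\<close>

primrec kernel_iter :: "(nat \<Rightarrow> 's \<Rightarrow> 's \<Rightarrow> ennreal) \<Rightarrow> (nat \<Rightarrow> 's \<Rightarrow> 's measure) \<Rightarrow> nat \<Rightarrow>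
    ('s \<Rightarrow> ennreal) \<Rightarrow> 's \<Rightarrow> ennreal" where
  "kernel_iter w K 0 g = g"
| "kernel_iter w K (Suc n) g = kernel_iter w K n (\<lambda>x. \<integral>\<^sup>+y. w n x y * g y \<partial>K n x)"

text \<open>On finitely many coordinates the projective limit is an iterated bind. Integrating out
  its last coordinate replaces g by a test function of the coordinate before it, and the product
  loses one factor.\<close>

lemma nn_integral_chain_law:
  fixes S :: "'s measure" and w :: "nat \<Rightarrow> 's \<Rightarrow> 's \<Rightarrow> ennreal"
  assumes \<mu>: "prob_space \<mu>" "sets \<mu> = sets S"
    and K: "\<And>n. K n \<in> measurable S (prob_algebra S)"
    and w: "\<And>n. (\<lambda>(x, y). w n x y) \<in> borel_measurable (S \<Otimes>\<^sub>M S)"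
    and g: "g \<in> borel_measurable S"
  shows "(\<integral>\<^sup>+\<zeta>. (\<Prod>p<n. w p (\<zeta> p) (\<zeta> (Suc p))) * g (\<zeta> n) \<partial>chain_law S \<mu> K) =
    (\<integral>\<^sup>+x. kernel_iter w K n g x \<partial>\<mu>)"
    and sets_chain_law: "sets (chain_law S \<mu> K) = sets (PiM UNIV (\<lambda>_. S))"
proof -
  interpret IT: Ionescu_Tulcea "chain_step \<mu> K" "\<lambda>_. S"
    by (rule Ionescu_Tulcea_chain_step[OF \<mu> K])
  let ?L = "chain_law S \<mu> K" and ?C = "\<lambda>n. IT.C 0 n (\<lambda>_. undefined)"
  have L: "?L = IT.PF.lim" by (simp add: chain_law_def)
  show sets_L: "sets ?L = sets (PiM UNIV (\<lambda>_. S))"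
    unfolding L by (rule IT.PF.sets_lim)
  have K': "K n \<in> measurable S (subprob_algebra S)" for n
    using K by (rule measurable_prob_algebraD)
  have prefix: "(\<integral>\<^sup>+\<zeta>. f (restrict \<zeta> {0..<n}) \<partial>?L) = (\<integral>\<^sup>+x. f x \<partial>?C n)"
    if f: "f \<in> borel_measurable (PiM {0..<n} (\<lambda>_. S))" for f :: "(nat \<Rightarrow> 's) \<Rightarrow> ennreal" and n
  proof -
    have up: "IT.up_to {0..<n} = n"
      using IT.up_to_iff_Ico[of "{0..<n}" n] IT.up_to[of "{0..<n}"] by auto
    have "(\<integral>\<^sup>+\<zeta>. f (restrict \<zeta> {0..<n}) \<partial>?L) =
        (\<integral>\<^sup>+x. f x \<partial>distr ?L (PiM {0..<n} (\<lambda>_. S)) (\<lambda>\<zeta>. restrict \<zeta> {0..<n}))"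
      by (rule nn_integral_distr[symmetric]) (simp_all only: measurable_cong_sets[OF sets_L refl] measurable_distr_eq1 f measurable_restrict_subset subset_UNIV)
    also have "\<dots> = (\<integral>\<^sup>+x. f x \<partial>IT.CI {0..<n})"
      unfolding L by (subst IT.distr_lim) auto
    also have "\<dots> = (\<integral>\<^sup>+x. f (restrict x {0..<n}) \<partial>?C n)"
      unfolding IT.CI_def up
      by (rule nn_integral_distr) (use f in \<open>auto simp: measurable_cong_sets[OF IT.sets_C refl]\<close>)
    also have "\<dots> = (\<integral>\<^sup>+x. f x \<partial>?C n)"
      by (intro nn_integral_cong) (auto simp: IT.space_C space_PiM)
    finally show ?thesis .
  qed
  have C_Suc: "(\<integral>\<^sup>+x. f x \<partial>?C (Suc n)) = (\<integral>\<^sup>+x. \<integral>\<^sup>+y. f (x(n := y)) \<partial>chain_step \<mu> K n x \<partial>?C n)"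
    if f [measurable]: "f \<in> borel_measurable (PiM {0..<Suc n} (\<lambda>_. S))" for f :: "(nat \<Rightarrow> 's) \<Rightarrow> ennreal" and n
  proof -
    have "(\<integral>\<^sup>+x. f x \<partial>?C (Suc n)) = (\<integral>\<^sup>+x. \<integral>\<^sup>+y. f y \<partial>IT.eP n x \<partial>?C n)"
      unfolding IT.C.simps add_0
      by (rule nn_integral_bind[where B="PiM {0..<Suc n} (\<lambda>_. S)"])
        (auto simp: measurable_cong_sets[OF IT.sets_C refl])
    also have "\<dots> = (\<integral>\<^sup>+x. \<integral>\<^sup>+y. f (x(n := y)) \<partial>chain_step \<mu> K n x \<partial>?C n)"
      by (intro nn_integral_cong IT.nn_integral_eP) (auto simp: IT.space_C)
    finally show ?thesis .
  qed
  \<comment> \<open>A product of n weights reads the coordinates 0, ..., n, hence the marginal at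
    \<open>Suc n\<close>. The function g is general because each step of the induction absorbs the
    last transition into it.\<close>
  have C_prod: "(\<integral>\<^sup>+x. (\<Prod>p<n. w p (x p) (x (Suc p))) * g (x n) \<partial>?C (Suc n)) =
      (\<integral>\<^sup>+x. kernel_iter w K n g x \<partial>\<mu>)" if "g \<in> borel_measurable S" for n g
    using that
  proof (induction n arbitrary: g)
    case 0
    note [measurable] = \<open>g \<in> borel_measurable S\<close>
    have "(\<integral>\<^sup>+x. g (x 0) \<partial>?C (Suc 0)) = (\<integral>\<^sup>+x. \<integral>\<^sup>+y. g y \<partial>\<mu> \<partial>?C 0)"
      by (subst C_Suc) (auto simp: chain_step_def)
    also have "\<dots> = (\<integral>\<^sup>+y. g y \<partial>\<mu>)"
      by (simp del: IT.C.simps add: prob_space.emeasure_space_1[OF IT.prob_space_C])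
    finally show ?case by simp
  next
    case (Suc n)
    note [measurable] = Suc.prems w K'
    define g' where "g' x = (\<integral>\<^sup>+y. w n x y * g y \<partial>K n x)" for x
    have g' [measurable]: "g' \<in> borel_measurable S"
      unfolding g'_def by (rule nn_integral_measurable_subprob_algebra2[OF _ K']) measurable
    have meas: "(\<lambda>x. w p (x p) (x (Suc p))) \<in> borel_measurable (PiM {0..<Suc (Suc n)} (\<lambda>_. S))"
      if "p < Suc n" for p
      by (rule measurable_compose[of "\<lambda>x. (x p, x (Suc p))" _ "S \<Otimes>\<^sub>M S" "\<lambda>(x, y). w p x y", simplified, OF _ w])
        (use that in \<open>intro measurable_Pair measurable_component_singleton; simp\<close>)
    have "(\<integral>\<^sup>+x. (\<Prod>p<Suc n. w p (x p) (x (Suc p))) * g (x (Suc n)) \<partial>?C (Suc (Suc n))) =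
      (\<integral>\<^sup>+x. \<integral>\<^sup>+y. (\<Prod>p<Suc n. w p ((x(Suc n := y)) p) ((x(Suc n := y)) (Suc p))) * g y
        \<partial>chain_step \<mu> K (Suc n) x \<partial>?C (Suc n))"
    proof (subst C_Suc)
      show "(\<lambda>x. (\<Prod>p<Suc n. w p (x p) (x (Suc p))) * g (x (Suc n)))
          \<in> borel_measurable (PiM {0..<Suc (Suc n)} (\<lambda>_. S))"
        by (intro borel_measurable_times_ennreal borel_measurable_prod_ennreal meas) auto
    qed simp
    also have "\<dots> = (\<integral>\<^sup>+x. (\<Prod>p<n. w p (x p) (x (Suc p))) * g' (x n) \<partial>?C (Suc n))"
    proof (rule nn_integral_cong)
      fix x assume "x \<in> space (?C (Suc n))"
      then have "x \<in> space (PiM {0..<Suc n} (\<lambda>_. S))"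
        using IT.space_C[of "\<lambda>_. undefined" 0 "Suc n"] by (simp del: IT.C.simps)
      then have x: "x n \<in> space S" by (auto simp: space_PiM)
      then have sets_Kx: "sets (K n (x n)) = sets S"
        using subprob_measurableD(2)[OF K'] by blast
      have "(\<integral>\<^sup>+y. (\<Prod>p<Suc n. w p ((x(Suc n := y)) p) ((x(Suc n := y)) (Suc p))) * g y
          \<partial>chain_step \<mu> K (Suc n) x) =
        (\<integral>\<^sup>+y. (\<Prod>p<n. w p (x p) (x (Suc p))) * (w n (x n) y * g y) \<partial>K n (x n))"
        by (simp add: chain_step_def mult.assoc)
      also have "\<dots> = (\<Prod>p<n. w p (x p) (x (Suc p))) * g' (x n)"
        unfolding g'_def
      proof (rule nn_integral_cmult)
        have "(\<lambda>y. w n (x n) y) \<in> borel_measurable S"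
          using measurable_compose[OF measurable_Pair1'[OF x] w[of n]] by simp
        then show "(\<lambda>y. w n (x n) y * g y) \<in> borel_measurable (K n (x n))"
          unfolding measurable_cong_sets[OF sets_Kx refl] by measurable
      qed
      finally show "(\<integral>\<^sup>+y. (\<Prod>p<Suc n. w p ((x(Suc n := y)) p) ((x(Suc n := y)) (Suc p))) * g y
          \<partial>chain_step \<mu> K (Suc n) x) = (\<Prod>p<n. w p (x p) (x (Suc p))) * g' (x n)" .
    qed
    also have "\<dots> = (\<integral>\<^sup>+x. kernel_iter w K n g' x \<partial>\<mu>)"
      by (rule Suc.IH[OF g'])
    finally show ?case by (simp add: g'_def[abs_def])
  qed
  have meas: "(\<lambda>x. w p (x p) (x (Suc p))) \<in> borel_measurable (PiM {0..<Suc n} (\<lambda>_. S))"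
    if "p < n" for p
    by (rule measurable_compose[of "\<lambda>x. (x p, x (Suc p))" _ "S \<Otimes>\<^sub>M S" "\<lambda>(x, y). w p x y", simplified, OF _ w])
      (use that in \<open>intro measurable_Pair measurable_component_singleton; simp\<close>)
  have "(\<integral>\<^sup>+\<zeta>. (\<Prod>p<n. w p (\<zeta> p) (\<zeta> (Suc p))) * g (\<zeta> n) \<partial>?L) =
    (\<integral>\<^sup>+x. (\<Prod>p<n. w p (x p) (x (Suc p))) * g (x n) \<partial>?C (Suc n))"
  proof (subst prefix[symmetric])
    show "(\<lambda>x. (\<Prod>p<n. w p (x p) (x (Suc p))) * g (x n)) \<in> borel_measurable (PiM {0..<Suc n} (\<lambda>_. S))"
      by (intro borel_measurable_times_ennreal borel_measurable_prod_ennreal meas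
          measurable_compose[OF measurable_component_singleton[of n "{0..<Suc n}" "\<lambda>_. S"] g]) auto
  qed simp
  also have "\<dots> = (\<integral>\<^sup>+x. kernel_iter w K n g x \<partial>\<mu>)"
    by (rule C_prod[OF g])
  finally show "(\<integral>\<^sup>+\<zeta>. (\<Prod>p<n. w p (\<zeta> p) (\<zeta> (Suc p))) * g (\<zeta> n) \<partial>?L) =
    (\<integral>\<^sup>+x. kernel_iter w K n g x \<partial>\<mu>)" .
qed

subsection \<open>Iterated weighted kernels\<close>

text \<open>The class of test functions on which all kernels below act and all integrals are finite.
  The bound is asked only on the space, since nothing is known about the model outside it.\<close>

definition bounded_measurable :: "'s measure \<Rightarrow> ('s \<Rightarrow> real) \<Rightarrow> bool" where
  "bounded_measurable S f \<longleftrightarrow> f \<in> borel_measurable S \<and> (\<exists>B. \<forall>x\<in>space S. \<bar>f x\<bar> \<le> B)"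

lemma bounded_measurableI:
  "f \<in> borel_measurable S \<Longrightarrow> (\<And>x. x \<in> space S \<Longrightarrow> \<bar>f x\<bar> \<le> B) \<Longrightarrow> bounded_measurable S f"
  by (auto simp: bounded_measurable_def)

lemma bounded_measurableD [dest]: "bounded_measurable S f \<Longrightarrow> f \<in> borel_measurable S"
  by (simp add: bounded_measurable_def)

lemma bounded_measurable_const [simp]: "bounded_measurable S (\<lambda>_. c)"
  by (auto simp: bounded_measurable_def)

lemma bounded_measurable_mult:
  assumes "bounded_measurable S f" "bounded_measurable S g"
  shows "bounded_measurable S (\<lambda>x. f x * g x)"
proof -
  obtain A B where "\<And>x. x \<in> space S \<Longrightarrow> \<bar>f x\<bar> \<le> A" "\<And>x. x \<in> space S \<Longrightarrow> \<bar>g x\<bar> \<le> B"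
    using assms by (auto simp: bounded_measurable_def)
  then have "\<bar>f x * g x\<bar> \<le> A * B" if "x \<in> space S" for x
    unfolding abs_mult using that by (meson abs_ge_zero mult_mono order_trans)
  then show ?thesis
    using assms by (intro bounded_measurableI) (auto intro!: borel_measurable_times)
qed

lemma bounded_measurable_diff:
  assumes "bounded_measurable S f" "bounded_measurable S g"
  shows "bounded_measurable S (\<lambda>x. f x - g x)"
proof -
  obtain A B where "\<And>x. x \<in> space S \<Longrightarrow> \<bar>f x\<bar> \<le> A" "\<And>x. x \<in> space S \<Longrightarrow> \<bar>g x\<bar> \<le> B"
    using assms by (auto simp: bounded_measurable_def)
  then have "\<bar>f x - g x\<bar> \<le> A + B" if "x \<in> space S" for x
    using that by (meson abs_triangle_ineq4 add_mono order_trans)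
  then show ?thesis
    using assms by (intro bounded_measurableI) (auto intro!: borel_measurable_diff)
qed

lemma bounded_measurable_cmult: "bounded_measurable S f \<Longrightarrow> bounded_measurable S (\<lambda>x. c * f x)"
  by (rule bounded_measurable_mult) simp_all

lemma bounded_measurable_integrable:
  assumes "bounded_measurable S f" "prob_space m" "sets m = sets S"
  shows "integrable m f"
proof -
  interpret prob_space m by fact
  obtain B where "\<And>x. x \<in> space S \<Longrightarrow> \<bar>f x\<bar> \<le> B"
    using assms(1) by (auto simp: bounded_measurable_def)
  then show ?thesis
    using bounded_measurableD[OF assms(1)] sets_eq_imp_space_eq[OF assms(3)]
    by (intro integrable_const_bound[where B = B]) (auto simp: measurable_cong_sets[OF assms(3) refl])
qed

lemma nn_integral_bounded_measurable:
  assumes "bounded_measurable S f" "prob_space m" "sets m = sets S" "\<And>x. x \<in> space S \<Longrightarrow> 0 \<le> f x"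
  shows "(\<integral>\<^sup>+x. ennreal (f x) \<partial>m) = ennreal (\<integral>x. f x \<partial>m)"
  using assms(4) bounded_measurable_integrable[OF assms(1-3)] sets_eq_imp_space_eq[OF assms(3)]
  by (intro nn_integral_eq_integral) auto

lemma bounded_measurable_integral_ge:
  fixes c :: real
  assumes "bounded_measurable S f" "prob_space m" "sets m = sets S" "\<And>x. x \<in> space S \<Longrightarrow> c \<le> f x"
  shows "c \<le> (\<integral>x. f x \<partial>m)"
proof -
  interpret prob_space m by fact
  have "(\<integral>x. c \<partial>m) \<le> (\<integral>x. f x \<partial>m)"
    using assms(4) bounded_measurable_integrable[OF assms(1-3)] sets_eq_imp_space_eq[OF assms(3)]
    by (intro integral_mono) simp_all
  then show ?thesis by (simp add: prob_space)
qed

lemma bounded_measurable_integral_le: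
  fixes c :: real
  assumes "bounded_measurable S f" "prob_space m" "sets m = sets S" "\<And>x. x \<in> space S \<Longrightarrow> f x \<le> c"
  shows "(\<integral>x. f x \<partial>m) \<le> c"
proof -
  interpret prob_space m by fact
  have "(\<integral>x. f x \<partial>m) \<le> (\<integral>x. c \<partial>m)"
    using assms(4) bounded_measurable_integrable[OF assms(1-3)] sets_eq_imp_space_eq[OF assms(3)]
    by (intro integral_mono) simp_all
  then show ?thesis by (simp add: prob_space)
qed

lemma integral_mono_bounded_measurable:
  assumes "bounded_measurable S f" "bounded_measurable S g" "prob_space m" "sets m = sets S"
    "\<And>x. x \<in> space S \<Longrightarrow> f x \<le> g x"
  shows "(\<integral>x. f x \<partial>m) \<le> (\<integral>x. g x \<partial>m)"
  using assms(5) bounded_measurable_integrable[OF _ assms(3,4)] assms(1,2) sets_eq_imp_space_eq[OF assms(4)]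
  by (intro integral_mono) simp_all

text \<open>Pushing \<open>L x\<close> forward along y \<mapsto> (x, y) moves the parameter from the
  integrand into the measure; what remains is integration of one fixed function against a measurable
  kernel.\<close>

lemma measurable_lebesgue_integral_kernel:
  fixes f :: "'a \<Rightarrow> 'b \<Rightarrow> real"
  assumes f: "(\<lambda>(x, y). f x y) \<in> borel_measurable (M \<Otimes>\<^sub>M N)"
    and L: "L \<in> measurable M (subprob_algebra N)"
  shows "(\<lambda>x. \<integral>y. f x y \<partial>L x) \<in> borel_measurable M"
proof -
  have "(\<lambda>x. distr (L x) (M \<Otimes>\<^sub>M N) (\<lambda>y. (x, y))) \<in> measurable M (subprob_algebra (M \<Otimes>\<^sub>M N))"
    by (rule measurable_distr2[OF _ L]) simp
  from measurable_compose[OF this integral_measurable_subprob_algebra[OF f]]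
  have "(\<lambda>x. \<integral>p. (case p of (x, y) \<Rightarrow> f x y) \<partial>distr (L x) (M \<Otimes>\<^sub>M N) (\<lambda>y. (x, y)))
      \<in> borel_measurable M" .
  moreover have "(\<integral>p. (case p of (x, y) \<Rightarrow> f x y) \<partial>distr (L x) (M \<Otimes>\<^sub>M N) (\<lambda>y. (x, y))) =
      (\<integral>y. f x y \<partial>L x)" if x: "x \<in> space M" for x
  proof -
    have "(\<lambda>y. (x, y)) \<in> measurable (L x) (M \<Otimes>\<^sub>M N)"
      unfolding measurable_cong_sets[OF subprob_measurableD(2)[OF L x] refl]
      by (rule measurable_Pair1'[OF x])
    from integral_distr[OF this f] show ?thesis by simp
  qed
  ultimately show ?thesis
    by (rule measurable_cong[THEN iffD1, rotated])
qed

lemma abs_ln_diff_le: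
  fixes p q r :: real
  assumes "0 < p" "0 < q" "1 \<le> r" "p \<le> r * q" "q \<le> r * p"
  shows "\<bar>ln p - ln q\<bar> \<le> ln r"
proof -
  have "ln p \<le> ln (r * q)" "ln q \<le> ln (r * p)"
    using assms by (subst ln_le_cancel_iff; simp)+
  then show ?thesis using assms by (simp add: ln_mult)
qed

text \<open>One setting for both positive kernels. The weight takes two points because
  \<open>phi\<close> depends on the arrival point as well; for the kernel on \<open>X\<close> it is
  \<open>G\<close> at the departure point.\<close>

locale weighted_kernel =
  fixes W :: "'w measure" and \<tau> :: "'w \<Rightarrow> 'w" and S :: "'s measure"
    and \<kappa> :: "'w \<Rightarrow> 's \<Rightarrow> 's measure" and w :: "'w \<Rightarrow> 's \<Rightarrow> 's \<Rightarrow> real"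
    and \<nu> :: "'s measure" and wl wu cl cu :: real
  assumes \<tau>_measurable [measurable]: "\<tau> \<in> measurable W W"
    and \<kappa>_measurable: "(\<lambda>(\<omega>, x). \<kappa> \<omega> x) \<in> measurable (W \<Otimes>\<^sub>M S) (prob_algebra S)"
    and w_measurable: "(\<lambda>((\<omega>, x), y). w \<omega> x y) \<in> borel_measurable ((W \<Otimes>\<^sub>M S) \<Otimes>\<^sub>M S)"
    and prob_\<nu>: "prob_space \<nu>" and sets_\<nu>: "sets \<nu> = sets S"
    and wl_pos: "0 < wl" and cl_pos: "0 < cl" and cu_pos: "0 < cu"
    and w_ge: "\<And>\<omega> x y. \<omega> \<in> space W \<Longrightarrow> x \<in> space S \<Longrightarrow> y \<in> space S \<Longrightarrow> wl \<le> w \<omega> x y"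
    and w_le: "\<And>\<omega> x y. \<omega> \<in> space W \<Longrightarrow> x \<in> space S \<Longrightarrow> y \<in> space S \<Longrightarrow> w \<omega> x y \<le> wu"
    and \<kappa>_ge: "\<And>\<omega> x A. \<omega> \<in> space W \<Longrightarrow> x \<in> space S \<Longrightarrow> A \<in> sets S \<Longrightarrow>
      ennreal cl * emeasure \<nu> A \<le> emeasure (\<kappa> \<omega> x) A"
    and \<kappa>_le: "\<And>\<omega> x A. \<omega> \<in> space W \<Longrightarrow> x \<in> space S \<Longrightarrow> A \<in> sets S \<Longrightarrow>
      emeasure (\<kappa> \<omega> x) A \<le> ennreal cu * emeasure \<nu> A"
begin

abbreviation "BM \<equiv> bounded_measurable S"

definition L :: "'w \<Rightarrow> ('s \<Rightarrow> real) \<Rightarrow> 's \<Rightarrow> real" where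
  "L \<omega> f x = (\<integral>y. w \<omega> x y * f y \<partial>\<kappa> \<omega> x)"

text \<open>The step at \<omega> is outermost, so that \<open>T (m + n)\<close> splits into m steps
  at \<omega> followed by n steps at \<open>(\<tau> ^^ m) \<omega>\<close>. This is the opposite
  order to \<open>kernel_iter\<close>.\<close>

primrec T :: "nat \<Rightarrow> 'w \<Rightarrow> ('s \<Rightarrow> real) \<Rightarrow> 's \<Rightarrow> real" where
  "T 0 \<omega> f = f"
| "T (Suc n) \<omega> f = L \<omega> (T n (\<tau> \<omega>) f)"

definition U :: "nat \<Rightarrow> 'w \<Rightarrow> 's \<Rightarrow> real" where
  "U n \<omega> = T n \<omega> (\<lambda>_. 1)"

text \<open>A Harnack constant: for f \<ge> 0 every value of \<open>L \<omega> f\<close> lies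
  between wl cl and wu cu times the \<nu>-integral of f, so two values differ at most by this
  factor.\<close>

definition R :: real where "R = (wu * cu) / (wl * cl)"

lemma space_\<nu>: "space \<nu> = space S"
  using sets_\<nu> by (rule sets_eq_imp_space_eq)

lemma S_nonempty: "\<exists>x. x \<in> space S"
  using prob_space.not_empty[OF prob_\<nu>] space_\<nu> by auto

lemma prob_\<kappa>: "\<omega> \<in> space W \<Longrightarrow> x \<in> space S \<Longrightarrow> prob_space (\<kappa> \<omega> x)"
  and sets_\<kappa>: "\<omega> \<in> space W \<Longrightarrow> x \<in> space S \<Longrightarrow> sets (\<kappa> \<omega> x) = sets S"
  and space_\<kappa>: "\<omega> \<in> space W \<Longrightarrow> x \<in> space S \<Longrightarrow> space (\<kappa> \<omega> x) = space S"
proof -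
  assume "\<omega> \<in> space W" "x \<in> space S"
  then have "\<kappa> \<omega> x \<in> space (prob_algebra S)"
    using measurable_space[OF \<kappa>_measurable, of "(\<omega>, x)"] by (auto simp: space_pair_measure)
  then show "prob_space (\<kappa> \<omega> x)" and sets: "sets (\<kappa> \<omega> x) = sets S"
    by (simp_all add: space_prob_algebra)
  show "space (\<kappa> \<omega> x) = space S"
    using sets by (rule sets_eq_imp_space_eq)
qed

lemma funpow_\<tau>_space: "\<omega> \<in> space W \<Longrightarrow> (\<tau> ^^ n) \<omega> \<in> space W"
  by (induction n) (auto intro: measurable_space[OF \<tau>_measurable])

lemma \<tau>_space: "\<omega> \<in> space W \<Longrightarrow> \<tau> \<omega> \<in> space W"
  by (rule measurable_space[OF \<tau>_measurable])

text \<open>The locale admits an empty \<open>W\<close>, on which the bounds for w and \<kappa> are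
  vacuous; facts about the constants alone therefore carry a point of \<open>W\<close>, here and for
  \<open>R\<close>, \<open>rho\<close> and \<open>qf\<close>.\<close>

lemma wu_pos: "\<omega> \<in> space W \<Longrightarrow> 0 < wu"
  using S_nonempty w_ge w_le wl_pos by (meson less_le_trans order_trans)

lemma cl_le_1: "\<omega> \<in> space W \<Longrightarrow> cl \<le> 1" and cu_ge_1: "\<omega> \<in> space W \<Longrightarrow> 1 \<le> cu"
proof -
  assume \<omega>: "\<omega> \<in> space W"
  obtain x where x: "x \<in> space S" using S_nonempty by blast
  have 1: "emeasure \<nu> (space S) = 1" "emeasure (\<kappa> \<omega> x) (space S) = 1"
    using prob_space.emeasure_space_1[OF prob_\<nu>] prob_space.emeasure_space_1[OF prob_\<kappa>[OF \<omega> x]]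
    by (simp_all add: space_\<nu> space_\<kappa>[OF \<omega> x])
  show "cl \<le> 1" using \<kappa>_ge[OF \<omega> x sets.top] by (simp add: 1)
  show "1 \<le> cu" using \<kappa>_le[OF \<omega> x sets.top] by (simp add: 1)
qed

lemma R_ge_1: "\<omega> \<in> space W \<Longrightarrow> 1 \<le> R"
proof -
  assume \<omega>: "\<omega> \<in> space W"
  obtain x where x: "x \<in> space S" using S_nonempty by blast
  have "wl \<le> wu" using w_ge[OF \<omega> x x] w_le[OF \<omega> x x] by simp
  then have "wl * cl \<le> wu * cu"
    using cl_le_1[OF \<omega>] cu_ge_1[OF \<omega>] wl_pos cl_pos by (intro mult_mono) auto
  then show ?thesis using wl_pos cl_pos by (simp add: R_def)
qed

lemma w_section: "\<omega> \<in> space W \<Longrightarrow> x \<in> space S \<Longrightarrow> BM (w \<omega> x)"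
proof (rule bounded_measurableI[where B = wu])
  assume \<omega>: "\<omega> \<in> space W" and x: "x \<in> space S"
  have "(\<omega>, x) \<in> space (W \<Otimes>\<^sub>M S)" using \<omega> x by (simp add: space_pair_measure)
  from measurable_compose[OF measurable_Pair1'[OF this] w_measurable]
  show "w \<omega> x \<in> borel_measurable S" by simp
  show "\<bar>w \<omega> x y\<bar> \<le> wu" if "y \<in> space S" for y
    using w_ge[OF \<omega> x that] w_le[OF \<omega> x that] wl_pos by simp
qed

lemma L_integrable:
  assumes "\<omega> \<in> space W" "x \<in> space S" "BM f"
  shows "integrable (\<kappa> \<omega> x) (\<lambda>y. w \<omega> x y * f y)"
  using assms by (intro bounded_measurable_integrable[where S = S] bounded_measurable_mult w_section
      prob_\<kappa> sets_\<kappa>)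

lemma \<kappa>_integral_bounds:
  assumes \<omega>: "\<omega> \<in> space W" and x: "x \<in> space S" and f: "BM f" and nonneg: "\<And>y. y \<in> space S \<Longrightarrow> 0 \<le> f y"
  shows "cl * (\<integral>y. f y \<partial>\<nu>) \<le> (\<integral>y. f y \<partial>\<kappa> \<omega> x)" "(\<integral>y. f y \<partial>\<kappa> \<omega> x) \<le> cu * (\<integral>y. f y \<partial>\<nu>)"
proof -
  note nn = nn_integral_bounded_measurable[OF f prob_\<nu> sets_\<nu> nonneg]
    nn_integral_bounded_measurable[OF f prob_\<kappa>[OF \<omega> x] sets_\<kappa>[OF \<omega> x] nonneg]
  have pos: "0 \<le> (\<integral>y. f y \<partial>\<nu>)" "0 \<le> (\<integral>y. f y \<partial>\<kappa> \<omega> x)"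
    by (rule bounded_measurable_integral_ge[OF f prob_\<nu> sets_\<nu> nonneg]
        bounded_measurable_integral_ge[OF f prob_\<kappa>[OF \<omega> x] sets_\<kappa>[OF \<omega> x] nonneg]; assumption)+
  have f': "(\<lambda>x. ennreal (f x)) \<in> borel_measurable \<nu>" "(\<lambda>x. ennreal (f x)) \<in> borel_measurable (\<kappa> \<omega> x)"
    unfolding measurable_cong_sets[OF sets_\<nu> refl] measurable_cong_sets[OF sets_\<kappa>[OF \<omega> x] refl]
    using measurable_compose[OF bounded_measurableD[OF f] measurable_ennreal] by simp_all
  have "(\<integral>\<^sup>+y. f y \<partial>\<kappa> \<omega> x) \<le> ennreal cu * (\<integral>\<^sup>+y. f y \<partial>\<nu>)"
    by (rule nn_integral_mono_kernel_bound[OF _ _ f'(1)])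
      (simp_all add: sets_\<nu> sets_\<kappa>[OF \<omega> x] \<kappa>_le[OF \<omega> x])
  then show "(\<integral>y. f y \<partial>\<kappa> \<omega> x) \<le> cu * (\<integral>y. f y \<partial>\<nu>)"
    using pos cu_pos by (simp add: nn flip: ennreal_mult)
  \<comment> \<open>The lower bound is the upper bound with the two measures exchanged and the
    constant 1 / cl.\<close>
  have "(\<integral>\<^sup>+y. f y \<partial>\<nu>) \<le> ennreal (1 / cl) * (\<integral>\<^sup>+y. f y \<partial>\<kappa> \<omega> x)"
  proof (rule nn_integral_mono_kernel_bound)
    fix A assume "A \<in> sets (\<kappa> \<omega> x)"
    then have "ennreal cl * emeasure \<nu> A \<le> emeasure (\<kappa> \<omega> x) A"
      using \<kappa>_ge[OF \<omega> x] by (simp add: sets_\<kappa>[OF \<omega> x])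
    then have "ennreal (1 / cl) * (ennreal cl * emeasure \<nu> A) \<le> ennreal (1 / cl) * emeasure (\<kappa> \<omega> x) A"
      by (rule mult_left_mono) simp
    then show "emeasure \<nu> A \<le> ennreal (1 / cl) * emeasure (\<kappa> \<omega> x) A"
      using cl_pos by (simp add: mult.assoc[symmetric] ennreal_mult[symmetric])
  qed (simp_all add: sets_\<nu> sets_\<kappa>[OF \<omega> x] f')
  then have "(\<integral>y. f y \<partial>\<nu>) \<le> 1 / cl * (\<integral>y. f y \<partial>\<kappa> \<omega> x)"
    using pos cl_pos by (simp add: nn flip: ennreal_mult)
  then show "cl * (\<integral>y. f y \<partial>\<nu>) \<le> (\<integral>y. f y \<partial>\<kappa> \<omega> x)"
    using cl_pos by (simp add: field_simps)
qed

lemma L_mono: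
  assumes "\<omega> \<in> space W" "x \<in> space S" "BM f" "BM g" "\<And>y. y \<in> space S \<Longrightarrow> f y \<le> g y"
  shows "L \<omega> f x \<le> L \<omega> g x"
  unfolding L_def
proof (rule integral_mono)
  fix y assume "y \<in> space (\<kappa> \<omega> x)"
  then show "w \<omega> x y * f y \<le> w \<omega> x y * g y"
    using assms w_ge[of \<omega> x y] wl_pos by (simp add: space_\<kappa> mult_left_mono)
qed (use assms in \<open>auto intro: L_integrable\<close>)

lemma L_cong:
  assumes "\<omega> \<in> space W" "x \<in> space S" "\<And>y. y \<in> space S \<Longrightarrow> f y = g y"
  shows "L \<omega> f x = L \<omega> g x"
  unfolding L_def using assms by (intro Bochner_Integration.integral_cong) (auto simp: space_\<kappa>)

lemma L_cmult: "L \<omega> (\<lambda>y. c * f y) x = c * L \<omega> f x"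
  unfolding L_def by (simp add: mult.left_commute[of _ c] integral_mult_right_zero)

lemma L_diff:
  assumes "\<omega> \<in> space W" "x \<in> space S" "BM f" "BM g"
  shows "L \<omega> (\<lambda>y. f y - g y) x = L \<omega> f x - L \<omega> g x"
  unfolding L_def using assms
  by (simp add: right_diff_distrib L_integrable Bochner_Integration.integral_diff)

lemma L_bounds:
  assumes \<omega>: "\<omega> \<in> space W" and x: "x \<in> space S" and f: "BM f" and nonneg: "\<And>y. y \<in> space S \<Longrightarrow> 0 \<le> f y"
  shows "wl * cl * (\<integral>y. f y \<partial>\<nu>) \<le> L \<omega> f x" "L \<omega> f x \<le> wu * cu * (\<integral>y. f y \<partial>\<nu>)"
proof -
  note bounds = \<kappa>_integral_bounds[OF \<omega> x f nonneg]
  have f_int: "integrable (\<kappa> \<omega> x) f"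
    by (rule bounded_measurable_integrable[OF f prob_\<kappa>[OF \<omega> x] sets_\<kappa>[OF \<omega> x]])
  have "wl * (\<integral>y. f y \<partial>\<kappa> \<omega> x) = (\<integral>y. wl * f y \<partial>\<kappa> \<omega> x)" by simp
  also have "\<dots> \<le> L \<omega> f x"
    unfolding L_def using f_int L_integrable[OF \<omega> x f]
    by (intro integral_mono mult_right_mono w_ge \<omega> x) (auto simp: space_\<kappa>[OF \<omega> x] nonneg)
  finally show "wl * cl * (\<integral>y. f y \<partial>\<nu>) \<le> L \<omega> f x"
    using order_trans[OF mult_left_mono[OF bounds(1) less_imp_le[OF wl_pos]]] by (simp add: mult.assoc)
  have "L \<omega> f x \<le> (\<integral>y. wu * f y \<partial>\<kappa> \<omega> x)"
    unfolding L_def using f_int L_integrable[OF \<omega> x f]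
    by (intro integral_mono mult_right_mono w_le \<omega> x) (auto simp: space_\<kappa>[OF \<omega> x] nonneg)
  also have "\<dots> = wu * (\<integral>y. f y \<partial>\<kappa> \<omega> x)" by simp
  also have "\<dots> \<le> wu * (cu * (\<integral>y. f y \<partial>\<nu>))"
    using bounds(2) wu_pos[OF \<omega>] by (intro mult_left_mono) auto
  finally show "L \<omega> f x \<le> wu * cu * (\<integral>y. f y \<partial>\<nu>)" by (simp add: mult.assoc)
qed

text \<open>Joint measurability serves twice: its sections in x keep \<open>L\<close> within the
  bounded measurable functions, and the dependence on \<omega> makes the masses random variables for
  the ergodic theorem.\<close>

lemma L_joint_measurable:
  assumes [measurable]: "(\<lambda>(\<omega>, x). f \<omega> x) \<in> borel_measurable (W \<Otimes>\<^sub>M S)"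
  shows "(\<lambda>(\<omega>, x). L \<omega> (f \<omega>) x) \<in> borel_measurable (W \<Otimes>\<^sub>M S)"
proof -
  have [measurable]: "(\<lambda>p. f (fst (fst p)) (snd p)) \<in> borel_measurable ((W \<Otimes>\<^sub>M S) \<Otimes>\<^sub>M S)"
    by (rule measurable_compose[of "\<lambda>p. (fst (fst p), snd p)" _ "W \<Otimes>\<^sub>M S" "\<lambda>(\<omega>, x). f \<omega> x", simplified]) measurable
  have "(\<lambda>(p, y). w (fst p) (snd p) y * f (fst p) y) \<in> borel_measurable ((W \<Otimes>\<^sub>M S) \<Otimes>\<^sub>M S)"
    using w_measurable unfolding split_beta' by measurable
  moreover have "(\<lambda>p. \<kappa> (fst p) (snd p)) \<in> measurable (W \<Otimes>\<^sub>M S) (subprob_algebra S)"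
    using measurable_prob_algebraD[OF \<kappa>_measurable] by (simp add: split_beta')
  ultimately have "(\<lambda>p. \<integral>y. w (fst p) (snd p) y * f (fst p) y \<partial>\<kappa> (fst p) (snd p)) \<in> borel_measurable (W \<Otimes>\<^sub>M S)"
    by (rule measurable_lebesgue_integral_kernel)
  then show ?thesis by (simp add: L_def split_beta')
qed

lemma BM_L:
  assumes \<omega>: "\<omega> \<in> space W" and f: "BM f"
  shows "BM (L \<omega> f)"
proof -
  obtain B where B: "\<And>x. x \<in> space S \<Longrightarrow> \<bar>f x\<bar> \<le> B"
    using f by (auto simp: bounded_measurable_def)
  have [measurable]: "f \<in> borel_measurable S" using f by auto
  have "(\<lambda>(\<omega>, x). L \<omega> f x) \<in> borel_measurable (W \<Otimes>\<^sub>M S)"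
    by (rule L_joint_measurable) measurable
  from measurable_compose[OF measurable_Pair1'[OF \<omega>] this]
  have meas: "L \<omega> f \<in> borel_measurable S" by simp
  have "\<bar>L \<omega> f x\<bar> \<le> L \<omega> (\<lambda>_. B) x" if x: "x \<in> space S" for x
  proof -
    have "L \<omega> f x \<le> L \<omega> (\<lambda>_. B) x"
      by (rule L_mono[OF \<omega> x f]) (use B in \<open>auto simp: abs_le_iff\<close>)
    moreover have "L \<omega> (\<lambda>y. (- 1) * f y) x \<le> L \<omega> (\<lambda>_. B) x"
      by (rule L_mono[OF \<omega> x bounded_measurable_cmult[OF f]]) (use B in \<open>auto simp: abs_le_iff\<close>)
    ultimately show ?thesis unfolding L_cmult by simp
  qed
  moreover have "L \<omega> (\<lambda>_. B) x \<le> wu * cu * B" if x: "x \<in> space S" for x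
  proof -
    have "0 \<le> B" using B[OF x] by simp
    then show ?thesis
      using L_bounds(2)[OF \<omega> x, of "\<lambda>_. B"] by (simp add: prob_space.prob_space[OF prob_\<nu>])
  qed
  ultimately show ?thesis
    using meas by (intro bounded_measurableI[where B = "wu * cu * B"]) (auto intro: order_trans)
qed

lemma BM_T: "\<omega> \<in> space W \<Longrightarrow> BM f \<Longrightarrow> BM (T n \<omega> f)"
  by (induction n arbitrary: \<omega>) (auto intro: BM_L \<tau>_space)

lemma BM_U: "\<omega> \<in> space W \<Longrightarrow> BM (U n \<omega>)"
  unfolding U_def by (rule BM_T) simp_all

lemma T_add: "T (m + n) \<omega> f = T m \<omega> (T n ((\<tau> ^^ m) \<omega>) f)"
  by (induction m arbitrary: \<omega>) (simp_all add: funpow_swap1)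

lemma T_mono:
  assumes "\<omega> \<in> space W" "x \<in> space S" "BM f" "BM g" "\<And>y. y \<in> space S \<Longrightarrow> f y \<le> g y"
  shows "T n \<omega> f x \<le> T n \<omega> g x"
  using assms(1,2)
  by (induction n arbitrary: \<omega> x) (auto simp: assms(3-) intro!: L_mono BM_T \<tau>_space)

lemma T_cmult: "T n \<omega> (\<lambda>y. c * f y) = (\<lambda>x. c * T n \<omega> f x)"
  by (induction n arbitrary: \<omega>) (auto simp: L_cmult)

lemma U_add: "U (m + n) \<omega> = T m \<omega> (U n ((\<tau> ^^ m) \<omega>))"
  by (simp add: U_def T_add)

lemma T_const: "T n \<omega> (\<lambda>_. c) = (\<lambda>x. c * U n \<omega> x)"
  using T_cmult[of n \<omega> c "\<lambda>_. 1"] by (simp add: U_def)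

lemma U_0 [simp]: "U 0 \<omega> x = 1"
  by (simp add: U_def)

lemma U_Suc: "U (Suc n) \<omega> = L \<omega> (U n (\<tau> \<omega>))"
  by (simp add: U_def)

lemma L_1_bounds:
  assumes "\<omega> \<in> space W" "x \<in> space S"
  shows "wl \<le> L \<omega> (\<lambda>_. 1) x" "L \<omega> (\<lambda>_. 1) x \<le> wu"
  unfolding L_def mult_1_right
  by (rule bounded_measurable_integral_ge[OF w_section[OF assms] prob_\<kappa>[OF assms] sets_\<kappa>[OF assms] w_ge[OF assms]]
      bounded_measurable_integral_le[OF w_section[OF assms] prob_\<kappa>[OF assms] sets_\<kappa>[OF assms] w_le[OF assms]]; assumption)+

lemma U_bounds:
  assumes "\<omega> \<in> space W" "x \<in> space S"
  shows "wl ^ n \<le> U n \<omega> x" "U n \<omega> x \<le> wu ^ n"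
  using assms
proof (induction n arbitrary: \<omega> x)
  case (Suc n)
  { case 1
    have \<tau>\<omega>: "\<tau> \<omega> \<in> space W" using 1 \<tau>_space by blast
    have "wl ^ Suc n \<le> wl ^ n * L \<omega> (\<lambda>_. 1) x"
      using L_1_bounds[OF 1] wl_pos by (simp add: mult.commute[of wl])
    also have "\<dots> = L \<omega> (\<lambda>_. wl ^ n) x"
      using L_cmult[of \<omega> "wl ^ n" "\<lambda>_. 1" x] by simp
    also have "\<dots> \<le> U (Suc n) \<omega> x"
      unfolding U_Suc using 1 \<tau>\<omega> Suc.IH(1)[OF \<tau>\<omega>] by (intro L_mono BM_U) auto
    finally show ?case .
  next
    case 2
    have \<tau>\<omega>: "\<tau> \<omega> \<in> space W" using 2 \<tau>_space by blast
    have "U (Suc n) \<omega> x \<le> L \<omega> (\<lambda>_. wu ^ n) x"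
      unfolding U_Suc using 2 \<tau>\<omega> Suc.IH(2)[OF \<tau>\<omega>] by (intro L_mono BM_U) auto
    also have "\<dots> = wu ^ n * L \<omega> (\<lambda>_. 1) x"
      using L_cmult[of \<omega> "wu ^ n" "\<lambda>_. 1" x] by simp
    also have "\<dots> \<le> wu ^ Suc n"
      using L_1_bounds[OF 2] wu_pos[OF 2(1)] by (simp add: mult.commute[of wu])
    finally show ?case . }
qed simp_all

lemma U_pos: "\<omega> \<in> space W \<Longrightarrow> x \<in> space S \<Longrightarrow> 0 < U n \<omega> x"
  using U_bounds(1)[of \<omega> x n] wl_pos by (smt (verit) zero_less_power)

text \<open>The first step already hides the starting point up to the factor \<open>R\<close>, and
  the later steps are common to both points; hence the constant is free of n.\<close>

lemma U_harnack:
  assumes \<omega>: "\<omega> \<in> space W" and x: "x \<in> space S" and y: "y \<in> space S"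
  shows "U n \<omega> x \<le> R * U n \<omega> y"
proof (cases n)
  case 0
  then show ?thesis using R_ge_1[OF \<omega>] by simp
next
  case (Suc m)
  let ?I = "\<integral>y. U m (\<tau> \<omega>) y \<partial>\<nu>"
  have \<tau>\<omega>: "\<tau> \<omega> \<in> space W" using \<omega> \<tau>_space by blast
  note b = L_bounds[OF \<omega> _ BM_U[OF \<tau>\<omega>] less_imp_le[OF U_pos[OF \<tau>\<omega>]]]
  have "U n \<omega> x \<le> wu * cu * ?I"
    unfolding Suc U_Suc by (rule b(2)[OF x])
  also have "\<dots> = R * (wl * cl * ?I)"
    using wl_pos cl_pos by (simp add: R_def)
  also have "\<dots> \<le> R * U n \<omega> y"
    unfolding Suc U_Suc using R_ge_1[OF \<omega>] b(1)[OF y] by (intro mult_left_mono) auto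
  finally show ?thesis .
qed

lemma integral_harnack:
  assumes f: "BM f" and harnack: "\<And>x y. x \<in> space S \<Longrightarrow> y \<in> space S \<Longrightarrow> f x \<le> R * f y"
    and m: "prob_space m" "sets m = sets S" and x: "x \<in> space S"
  shows "(\<integral>y. f y \<partial>m) \<le> R * f x" "f x \<le> R * (\<integral>y. f y \<partial>m)"
proof -
  show "(\<integral>y. f y \<partial>m) \<le> R * f x"
    by (rule bounded_measurable_integral_le[OF f m]) (rule harnack[OF _ x])
  have "f x \<le> (\<integral>y. R * f y \<partial>m)"
    by (rule bounded_measurable_integral_ge[OF bounded_measurable_cmult[OF f] m]) (rule harnack[OF x])
  then show "f x \<le> R * (\<integral>y. f y \<partial>m)" by simp
qed

lemma U_joint_measurable: "(\<lambda>(\<omega>, x). U n \<omega> x) \<in> borel_measurable (W \<Otimes>\<^sub>M S)"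
proof (induction n)
  case (Suc n)
  have "(\<lambda>(\<omega>, x). U n (\<tau> \<omega>) x) \<in> borel_measurable (W \<Otimes>\<^sub>M S)"
    using measurable_compose[of "\<lambda>p. (\<tau> (fst p), snd p)" "W \<Otimes>\<^sub>M S" "W \<Otimes>\<^sub>M S", OF _ Suc]
    by (simp add: split_beta')
  from L_joint_measurable[OF this] show ?case by (simp add: U_Suc)
qed simp

lemma integral_U_measurable:
  assumes "prob_space m" "sets m = sets S"
  shows "(\<lambda>\<omega>. \<integral>x. U n \<omega> x \<partial>m) \<in> borel_measurable W"
proof -
  interpret prob_space m by fact
  have "sets (W \<Otimes>\<^sub>M m) = sets (W \<Otimes>\<^sub>M S)"
    using assms by (intro sets_pair_measure_cong) simp_all
  then have "(\<lambda>(\<omega>, x). U n \<omega> x) \<in> borel_measurable (W \<Otimes>\<^sub>M m)"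
    using U_joint_measurable by (simp cong: measurable_cong_sets)
  then show ?thesis by (rule borel_measurable_lebesgue_integral)
qed

lemma integral_U_bounds:
  assumes "\<omega> \<in> space W" "prob_space m" "sets m = sets S"
  shows "wl ^ n \<le> (\<integral>x. U n \<omega> x \<partial>m)" "(\<integral>x. U n \<omega> x \<partial>m) \<le> wu ^ n"
  using assms U_bounds[OF assms(1)]
  by (auto intro!: bounded_measurable_integral_ge[where S = S] bounded_measurable_integral_le[where S = S] BM_U)

lemma integral_U_pos:
  assumes "\<omega> \<in> space W" "prob_space m" "sets m = sets S"
  shows "0 < (\<integral>x. U n \<omega> x \<partial>m)"
  using integral_U_bounds(1)[OF assms, of n] wl_pos by (smt (verit) zero_less_power)

text \<open>After n steps the remaining mass \<open>U m\<close> is within the factor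
  \<open>R\<close> of its own \<nu>-mean. That mean is a constant, so it passes through
  \<open>T n\<close> and leaves a product of two masses.\<close>

lemma ln_integral_U_almost_additive:
  assumes \<omega>: "\<omega> \<in> space W"
  shows "\<bar>ln (\<integral>x. U (n + m) \<omega> x \<partial>\<nu>) - ln (\<integral>x. U n \<omega> x \<partial>\<nu>)
    - ln (\<integral>x. U m ((\<tau> ^^ n) \<omega>) x \<partial>\<nu>)\<bar> \<le> ln R"
proof -
  have \<omega>': "(\<tau> ^^ n) \<omega> \<in> space W" using \<omega> by (rule funpow_\<tau>_space)
  let ?I = "\<lambda>n \<omega>. \<integral>x. U n \<omega> x \<partial>\<nu>"
  let ?c = "?I m ((\<tau> ^^ n) \<omega>)"
  have R0: "0 < R" using R_ge_1[OF \<omega>] by simp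
  have c: "0 < ?c" by (rule integral_U_pos[OF \<omega>' prob_\<nu> sets_\<nu>])
  note harnack = integral_harnack[OF BM_U[OF \<omega>'] U_harnack[OF \<omega>'] prob_\<nu> sets_\<nu>]
  have upper: "U (n + m) \<omega> x \<le> R * ?c * U n \<omega> x" and lower: "?c * U n \<omega> x \<le> R * U (n + m) \<omega> x"
    if x: "x \<in> space S" for x
  proof -
    have "U (n + m) \<omega> x \<le> T n \<omega> (\<lambda>_. R * ?c) x"
      unfolding U_add using harnack(2) by (intro T_mono \<omega> x BM_U \<omega>') auto
    then show "U (n + m) \<omega> x \<le> R * ?c * U n \<omega> x" by (simp add: T_const)
    have "T n \<omega> (\<lambda>_. ?c) x \<le> T n \<omega> (\<lambda>y. R * U m ((\<tau> ^^ n) \<omega>) y) x"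
      using harnack(1) by (intro T_mono \<omega> x BM_U \<omega>' bounded_measurable_cmult) auto
    then show "?c * U n \<omega> x \<le> R * U (n + m) \<omega> x"
      unfolding T_cmult U_add T_const .
  qed
  have 1: "?I (n + m) \<omega> \<le> R * (?I n \<omega> * ?c)"
  proof -
    have "?I (n + m) \<omega> \<le> (\<integral>x. R * ?c * U n \<omega> x \<partial>\<nu>)"
      by (rule integral_mono_bounded_measurable[OF BM_U[OF \<omega>] bounded_measurable_cmult[OF BM_U[OF \<omega>]]
            prob_\<nu> sets_\<nu> upper])
    then show ?thesis by (simp add: mult_ac)
  qed
  have 2: "?I n \<omega> * ?c \<le> R * ?I (n + m) \<omega>"
  proof -
    have "(\<integral>x. ?c * U n \<omega> x \<partial>\<nu>) \<le> (\<integral>x. R * U (n + m) \<omega> x \<partial>\<nu>)"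
      by (rule integral_mono_bounded_measurable[OF bounded_measurable_cmult[OF BM_U[OF \<omega>]]
            bounded_measurable_cmult[OF BM_U[OF \<omega>]] prob_\<nu> sets_\<nu> lower])
    then show ?thesis by (simp add: mult_ac)
  qed
  have pos: "0 < ?I n \<omega>" "0 < ?I (n + m) \<omega>"
    by (rule integral_U_pos[OF \<omega> prob_\<nu> sets_\<nu>])+
  have "\<bar>ln (?I (n + m) \<omega>) - ln (?I n \<omega> * ?c)\<bar> \<le> ln R"
    using pos c R_ge_1[OF \<omega>] 1 2 by (intro abs_ln_diff_le) auto
  then show ?thesis
    using pos c by (simp add: ln_mult diff_diff_eq)
qed

text \<open>The ergodic theorem is applied with initial law \<nu>. By the Harnack inequality another
  initial law changes the logarithm by at most ln \<open>R\<close>, which vanishes after division by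
  n, so the rate is common to all of them.\<close>

theorem growth_rate_exists:
  assumes erg: "ergodic_system P \<tau>" and sets_P: "sets P = sets W"
  obtains c where "\<And>m. prob_space m \<Longrightarrow> sets m = sets S \<Longrightarrow>
    AE \<omega> in P. (\<lambda>n. ln (\<integral>x. U n \<omega> x \<partial>m) / real n) \<longlonglongrightarrow> c"
proof -
  interpret E: ergodic_system P \<tau> by fact
  have space_P: "space P = space W" using sets_P by (rule sets_eq_imp_space_eq)
  define a where "a n \<omega> = ln (\<integral>x. U n \<omega> x \<partial>\<nu>)" for n \<omega>
  have meas: "a n \<in> borel_measurable P" for n
    unfolding a_def measurable_cong_sets[OF sets_P refl]
    by (intro borel_measurable_ln integral_U_measurable prob_\<nu> sets_\<nu>)
  have bound: "\<bar>a n \<omega>\<bar> \<le> real n * (\<bar>ln wl\<bar> + \<bar>ln wu\<bar>)" if "\<omega> \<in> space P" for n \<omega>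
  proof -
    have \<omega>: "\<omega> \<in> space W" using that by (simp add: space_P)
    note b = integral_U_bounds[OF \<omega> prob_\<nu> sets_\<nu>, of n]
    have "ln (wl ^ n) \<le> a n \<omega>"
      unfolding a_def using b(1) integral_U_pos[OF \<omega> prob_\<nu> sets_\<nu>, of n] wl_pos
      by (subst ln_le_cancel_iff) auto
    moreover have "a n \<omega> \<le> ln (wu ^ n)"
      unfolding a_def using b(2) integral_U_pos[OF \<omega> prob_\<nu> sets_\<nu>, of n] wu_pos[OF \<omega>]
      by (subst ln_le_cancel_iff) auto
    ultimately have "real n * ln wl \<le> a n \<omega>" "a n \<omega> \<le> real n * ln wu"
      using wl_pos wu_pos[OF \<omega>] by (simp_all add: ln_realpow)
    moreover have "- ln wl * real n \<le> \<bar>ln wl\<bar> * real n" "ln wu * real n \<le> \<bar>ln wu\<bar> * real n"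
      "0 \<le> \<bar>ln wl\<bar> * real n" "0 \<le> \<bar>ln wu\<bar> * real n"
      by (intro mult_right_mono; simp)+ simp_all
    ultimately show ?thesis
      unfolding abs_le_iff distrib_left mult_minus_left mult.commute[of _ "real n"] by linarith
  qed
  have additive: "\<bar>a (n + m) \<omega> - a n \<omega> - a m ((\<tau> ^^ n) \<omega>)\<bar> \<le> ln R" if "\<omega> \<in> space P" for m n \<omega>
    unfolding a_def using that by (intro ln_integral_U_almost_additive) (simp add: space_P)
  obtain c where c: "AE \<omega> in P. (\<lambda>n. a n \<omega> / real n) \<longlonglongrightarrow> c"
    using E.almost_additive_ergodic[OF meas bound additive] by blast
  show ?thesis
  proof (rule that)
    fix m assume m: "prob_space m" "sets m = sets S"
    show "AE \<omega> in P. (\<lambda>n. ln (\<integral>x. U n \<omega> x \<partial>m) / real n) \<longlonglongrightarrow> c"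
      using c AE_space
    proof eventually_elim
      case (elim \<omega>)
      then have \<omega>: "\<omega> \<in> space W" by (simp add: space_P)
      have diff: "\<bar>ln (\<integral>x. U n \<omega> x \<partial>m) - a n \<omega>\<bar> \<le> ln R" for n
      proof -
        have h: "U n \<omega> x \<le> R * (\<integral>y. U n \<omega> y \<partial>m')"
          if "prob_space m'" "sets m' = sets S" "x \<in> space S" for m' x
          by (rule integral_harnack(2)[OF BM_U[OF \<omega>] _ that]) (rule U_harnack[OF \<omega>])
        have "(\<integral>x. U n \<omega> x \<partial>m) \<le> R * (\<integral>x. U n \<omega> x \<partial>\<nu>)"
          by (rule bounded_measurable_integral_le[OF BM_U[OF \<omega>] m]) (rule h[OF prob_\<nu> sets_\<nu>])
        moreover have "(\<integral>x. U n \<omega> x \<partial>\<nu>) \<le> R * (\<integral>x. U n \<omega> x \<partial>m)"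
          by (rule bounded_measurable_integral_le[OF BM_U[OF \<omega>] prob_\<nu> sets_\<nu>]) (rule h[OF m])
        ultimately show ?thesis
          unfolding a_def by (intro abs_ln_diff_le integral_U_pos \<omega> m prob_\<nu> sets_\<nu> R_ge_1[OF \<omega>])
      qed
      have "(\<lambda>n. (ln (\<integral>x. U n \<omega> x \<partial>m) - a n \<omega>) / real n) \<longlonglongrightarrow> 0"
      proof (rule Lim_null_comparison)
        show "\<forall>\<^sub>F n in sequentially. norm ((ln (\<integral>x. U n \<omega> x \<partial>m) - a n \<omega>) / real n) \<le> ln R * (1 / real n)"
          using diff by (intro always_eventually allI) (auto simp: abs_divide divide_right_mono)
        show "(\<lambda>n. ln R * (1 / real n)) \<longlonglongrightarrow> 0"
          by (intro tendsto_mult_right_zero lim_1_over_n)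
      qed
      from tendsto_add[OF this elim(1)] show ?case
        by (simp add: diff_divide_distrib)
    qed
  qed
qed

end

subsection \<open>Contraction and the eigenfunction\<close>

context weighted_kernel
begin

text \<open>Let r be the ratio of the \<nu>-means of f and g. The functions f - lo g and hi g - f
  are nonnegative, so the lower bound for \<open>L\<close> applies to them; relative to
  \<open>L \<omega> g\<close> they gain (r - lo)/R and (hi - r)/R. The two gains add up to (hi -
  lo)/R whatever r is.\<close>

lemma L_ratio_contraction:
  assumes \<omega>: "\<omega> \<in> space W" and f: "BM f" and g: "BM g"
    and g_pos: "\<And>x. x \<in> space S \<Longrightarrow> 0 < g x"
    and lo: "\<And>x. x \<in> space S \<Longrightarrow> lo * g x \<le> f x"
    and hi: "\<And>x. x \<in> space S \<Longrightarrow> f x \<le> hi * g x"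
  obtains lo' hi' where "lo \<le> lo'" "hi' - lo' = (1 - 1 / R) * (hi - lo)"
    "\<And>x. x \<in> space S \<Longrightarrow> lo' * L \<omega> g x \<le> L \<omega> f x"
    "\<And>x. x \<in> space S \<Longrightarrow> L \<omega> f x \<le> hi' * L \<omega> g x"
proof -
  have R0: "1 \<le> R" using R_ge_1[OF \<omega>] .
  have a: "0 < wl * cl" using wl_pos cl_pos by simp
  have \<nu>_int: "integrable \<nu> f" "integrable \<nu> g"
    by (rule bounded_measurable_integrable[OF f prob_\<nu> sets_\<nu>]
        bounded_measurable_integrable[OF g prob_\<nu> sets_\<nu>])+
  define I where "I f = (\<integral>x. f x \<partial>\<nu>)" for f :: "'s \<Rightarrow> real"
  obtain x0 where x0: "x0 \<in> space S" using S_nonempty by blast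
  have up: "L \<omega> g x \<le> wu * cu * I g" if "x \<in> space S" for x
    unfolding I_def using that g_pos by (intro L_bounds(2) \<omega> g) (auto intro: less_imp_le)
  have "wu * cu * I g = R * (wl * cl * I g)"
    using wl_pos cl_pos by (simp add: R_def)
  then have Lg: "L \<omega> g x \<le> R * (wl * cl * I g)" if "x \<in> space S" for x
    using up[OF that] by (simp only:)
  have Ig: "0 < I g"
  proof -
    have "0 \<le> I g" unfolding I_def
      by (rule bounded_measurable_integral_ge[OF g prob_\<nu> sets_\<nu>]) (simp add: g_pos less_imp_le)
    moreover have "I g \<noteq> 0"
    proof
      assume "I g = 0"
      then have "AE x in \<nu>. g x = 0"
        unfolding I_def using \<nu>_int g_pos
        by (subst (asm) integral_nonneg_eq_0_iff_AE) (auto simp: space_\<nu> intro!: AE_I2 less_imp_le)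
      then have "AE x in \<nu>. False"
        using AE_space by eventually_elim (use g_pos in \<open>force simp: space_\<nu>\<close>)
      then show False using prob_space.AE_False[OF prob_\<nu>] by simp
    qed
    ultimately show ?thesis by simp
  qed
  define r where "r = I f / I g"
  have r: "I f = r * I g" using Ig by (simp add: r_def)
  have I_lo: "I (\<lambda>x. f x - lo * g x) = (r - lo) * I g"
    unfolding I_def using \<nu>_int r by (simp add: I_def left_diff_distrib)
  have I_hi: "I (\<lambda>x. hi * g x - f x) = (hi - r) * I g"
    unfolding I_def using \<nu>_int r by (simp add: I_def left_diff_distrib)
  have BM_lo: "BM (\<lambda>x. f x - lo * g x)" and BM_hi: "BM (\<lambda>x. hi * g x - f x)"
    using f g by (auto intro: bounded_measurable_diff bounded_measurable_cmult)
  have r_lo: "0 \<le> r - lo" and r_hi: "0 \<le> hi - r"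
  proof -
    have "0 \<le> (r - lo) * I g" unfolding I_lo[symmetric] unfolding I_def
      by (rule bounded_measurable_integral_ge[OF BM_lo prob_\<nu> sets_\<nu>]) (use lo in auto)
    then show "0 \<le> r - lo" using Ig by (simp add: zero_le_mult_iff)
    have "0 \<le> (hi - r) * I g" unfolding I_hi[symmetric] unfolding I_def
      by (rule bounded_measurable_integral_ge[OF BM_hi prob_\<nu> sets_\<nu>]) (use hi in auto)
    then show "0 \<le> hi - r" using Ig by (simp add: zero_le_mult_iff)
  qed
  show ?thesis
  proof (rule that[of "lo + (r - lo) / R" "hi - (hi - r) / R"])
    show "lo \<le> lo + (r - lo) / R" using r_lo R0 by simp
    show "hi - (hi - r) / R - (lo + (r - lo) / R) = (1 - 1 / R) * (hi - lo)"
      using R0 by (simp add: field_simps)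
    fix x assume x: "x \<in> space S"
    have step: "d / R * L \<omega> g x \<le> wl * cl * (d * I g)" if "0 \<le> d" for d
    proof -
      have "d / R * L \<omega> g x \<le> d / R * (R * (wl * cl * I g))"
        using Lg[OF x] that R0 by (intro mult_left_mono) auto
      then show ?thesis using R0 by (simp add: mult_ac)
    qed
    have "wl * cl * I (\<lambda>x. f x - lo * g x) \<le> L \<omega> (\<lambda>x. f x - lo * g x) x"
      unfolding I_def by (rule L_bounds(1)[OF \<omega> x BM_lo]) (use lo in auto)
    also have "\<dots> = L \<omega> f x - lo * L \<omega> g x"
      using f g by (simp add: L_diff[OF \<omega> x] bounded_measurable_cmult L_cmult)
    finally show "(lo + (r - lo) / R) * L \<omega> g x \<le> L \<omega> f x"
      using step[OF r_lo] unfolding I_lo by (simp add: distrib_right)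
    have "wl * cl * I (\<lambda>x. hi * g x - f x) \<le> L \<omega> (\<lambda>x. hi * g x - f x) x"
      unfolding I_def by (rule L_bounds(1)[OF \<omega> x BM_hi]) (use hi in auto)
    also have "\<dots> = hi * L \<omega> g x - L \<omega> f x"
      using f g by (simp add: L_diff[OF \<omega> x] bounded_measurable_cmult L_cmult)
    finally show "L \<omega> f x \<le> (hi - (hi - r) / R) * L \<omega> g x"
      using step[OF r_hi] unfolding I_hi by (simp add: left_diff_distrib)
  qed
qed

definition rho :: real where "rho = 1 - 1 / R"

definition qf :: "nat \<Rightarrow> real" where "qf n = 1 + R\<^sup>2 * rho ^ n"

lemma rho_bounds: "\<omega> \<in> space W \<Longrightarrow> 0 \<le> rho" "\<omega> \<in> space W \<Longrightarrow> rho < 1"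
  using R_ge_1 by (fastforce simp: rho_def)+

lemma qf_ge_1: "\<omega> \<in> space W \<Longrightarrow> 1 \<le> qf n"
  using rho_bounds[of \<omega>] by (simp add: qf_def)

lemma qf_tendsto: "\<omega> \<in> space W \<Longrightarrow> qf \<longlonglongrightarrow> 1"
proof -
  assume \<omega>: "\<omega> \<in> space W"
  have "(\<lambda>n. 1 + R\<^sup>2 * rho ^ n) \<longlonglongrightarrow> 1 + R\<^sup>2 * 0"
    using rho_bounds[OF \<omega>] by (intro tendsto_intros LIMSEQ_realpow_zero)
  then show ?thesis by (simp add: qf_def[abs_def])
qed

text \<open>Iterates the one-step contraction against the masses \<open>U\<close>. That the lower
  end never decreases is recorded because it keeps the interval away from 0, which later turns its
  length into a ratio.\<close>

lemma T_ratio_contraction: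
  assumes \<omega>: "\<omega> \<in> space W" and f: "BM f"
    and lo: "\<And>x. x \<in> space S \<Longrightarrow> lo \<le> f x" and hi: "\<And>x. x \<in> space S \<Longrightarrow> f x \<le> hi"
  shows "\<exists>lo' hi'. lo \<le> lo' \<and> hi' - lo' = rho ^ n * (hi - lo) \<and>
    (\<forall>x\<in>space S. lo' * U n \<omega> x \<le> T n \<omega> f x \<and> T n \<omega> f x \<le> hi' * U n \<omega> x)"
  using \<omega>
proof (induction n arbitrary: \<omega>)
  case 0
  then show ?case using lo hi by (intro exI[of _ lo] exI[of _ hi]) simp
next
  case (Suc n)
  have \<tau>\<omega>: "\<tau> \<omega> \<in> space W" using Suc.prems by (rule \<tau>_space)
  obtain lo' hi' where *: "lo \<le> lo'" "hi' - lo' = rho ^ n * (hi - lo)"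
    "\<And>x. x \<in> space S \<Longrightarrow> lo' * U n (\<tau> \<omega>) x \<le> T n (\<tau> \<omega>) f x"
    "\<And>x. x \<in> space S \<Longrightarrow> T n (\<tau> \<omega>) f x \<le> hi' * U n (\<tau> \<omega>) x"
    using Suc.IH[OF \<tau>\<omega>] by blast
  obtain lo2 hi2 where "lo' \<le> lo2" "hi2 - lo2 = (1 - 1 / R) * (hi' - lo')"
    "\<And>x. x \<in> space S \<Longrightarrow> lo2 * U (Suc n) \<omega> x \<le> T (Suc n) \<omega> f x"
    "\<And>x. x \<in> space S \<Longrightarrow> T (Suc n) \<omega> f x \<le> hi2 * U (Suc n) \<omega> x"
    unfolding U_Suc T.simps
    using L_ratio_contraction[OF Suc.prems BM_T[OF \<tau>\<omega> f] BM_U[OF \<tau>\<omega>] U_pos[OF \<tau>\<omega>] *(3,4)] by blast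
  then show ?case
    using *(1,2) by (intro exI[of _ lo2] exI[of _ hi2]) (auto simp: rho_def)
qed

text \<open>The Harnack inequality confines f to the interval from f(x0)/R to R f(x0). After n
  contractions its length carries the factor \<open>rho ^ n\<close>, while the lower end l is still
  at least f(x0)/R; so the length is at most R^2 \<open>rho ^ n\<close> l. This is the origin of
  \<open>qf\<close>.\<close>

lemma T_almost_proportional:
  assumes \<omega>: "\<omega> \<in> space W" and f: "BM f" and f_pos: "\<And>x. x \<in> space S \<Longrightarrow> 0 < f x"
    and harnack: "\<And>x y. x \<in> space S \<Longrightarrow> y \<in> space S \<Longrightarrow> f x \<le> R * f y"
  obtains l where "0 < l"
    "\<And>x. x \<in> space S \<Longrightarrow> l * U n \<omega> x \<le> T n \<omega> f x"
    "\<And>x. x \<in> space S \<Longrightarrow> T n \<omega> f x \<le> qf n * l * U n \<omega> x"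
proof -
  obtain x0 where x0: "x0 \<in> space S" using S_nonempty by blast
  have R1: "1 \<le> R" by (rule R_ge_1[OF \<omega>])
  have lo: "f x0 / R \<le> f x" and hi: "f x \<le> R * f x0" if "x \<in> space S" for x
    using harnack[OF x0 that] harnack[OF that x0] R1 by (auto simp: field_simps)
  obtain l u where l: "f x0 / R \<le> l" "u - l = rho ^ n * (R * f x0 - f x0 / R)"
    and T: "\<And>x. x \<in> space S \<Longrightarrow> l * U n \<omega> x \<le> T n \<omega> f x"
    "\<And>x. x \<in> space S \<Longrightarrow> T n \<omega> f x \<le> u * U n \<omega> x"
    using T_ratio_contraction[OF \<omega> f lo hi] by blast
  have "0 < f x0 / R" using f_pos[OF x0] R1 by simp
  then have l0: "0 < l" using l by simp
  have fl: "f x0 \<le> R * l" using l(1) R1 by (simp add: field_simps)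
  have "R * f x0 - f x0 / R \<le> R * (R * l)"
  proof -
    have "R * f x0 \<le> R * (R * l)" using fl R1 by (intro mult_left_mono) auto
    then show ?thesis using \<open>0 < f x0 / R\<close> by linarith
  qed
  then have "u - l \<le> rho ^ n * (R * (R * l))"
    unfolding l(2) using rho_bounds(1)[OF \<omega>] by (intro mult_left_mono) auto
  then have u: "u \<le> qf n * l"
    by (simp add: qf_def power2_eq_square algebra_simps)
  show ?thesis
  proof (rule that[OF l0 T(1)])
    fix x assume x: "x \<in> space S"
    have "u * U n \<omega> x \<le> qf n * l * U n \<omega> x"
      using u U_pos[OF \<omega> x] by (intro mult_right_mono) (auto intro: less_imp_le)
    then show "T n \<omega> f x \<le> qf n * l * U n \<omega> x" using T(2)[OF x] by simp
  qed
qed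

end

text \<open>The normalisation of \<open>h\<close> starts the dynamics n steps in the past from the
  law \<mu>; the map \<sigma> selects that past environment.\<close>

locale invertible_weighted_kernel = weighted_kernel +
  fixes \<sigma> :: "'a \<Rightarrow> 'a" and \<mu> :: "'b measure"
  assumes \<sigma>_space: "\<And>\<omega>. \<omega> \<in> space W \<Longrightarrow> \<sigma> \<omega> \<in> space W"
    and \<tau>_\<sigma>: "\<And>\<omega>. \<tau> (\<sigma> \<omega>) = \<omega>"
    and prob_\<mu>: "prob_space \<mu>" and sets_\<mu>: "sets \<mu> = sets S"
begin

text \<open>\<open>past n \<omega>\<close> is integration against \<open>Phi n\<close> at \<open>\<sigma>\<^sup>n \<omega>\<close> started from \<open>\<mu>\<close>.\<close>

definition past :: "nat \<Rightarrow> 'a \<Rightarrow> ('b \<Rightarrow> real) \<Rightarrow> real" where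
  "past n \<omega> f = (\<integral>x. T n ((\<sigma> ^^ n) \<omega>) f x \<partial>\<mu>) / (\<integral>x. U n ((\<sigma> ^^ n) \<omega>) x \<partial>\<mu>)"

definition hn :: "nat \<Rightarrow> 'a \<Rightarrow> 'b \<Rightarrow> real" where
  "hn n \<omega> x = U n \<omega> x / past n \<omega> (U n \<omega>)"

definition h :: "'a \<Rightarrow> 'b \<Rightarrow> real" where
  "h \<omega> x = lim (\<lambda>n. hn n \<omega> x)"

lemma funpow_\<sigma>_space: "\<omega> \<in> space W \<Longrightarrow> (\<sigma> ^^ n) \<omega> \<in> space W"
  by (induction n) (auto intro: \<sigma>_space)

lemma funpow_\<tau>_\<sigma>: "(\<tau> ^^ n) ((\<sigma> ^^ n) \<omega>) = \<omega>"
proof (induction n)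
  case (Suc n)
  show ?case
    unfolding funpow_Suc_right[of n \<tau>] funpow.simps(2)[of n \<sigma>] o_apply \<tau>_\<sigma> by (rule Suc.IH)
qed simp

lemma past_denom_pos: "\<omega> \<in> space W \<Longrightarrow> 0 < (\<integral>x. U n ((\<sigma> ^^ n) \<omega>) x \<partial>\<mu>)"
  by (intro integral_U_pos funpow_\<sigma>_space prob_\<mu> sets_\<mu>)

lemma past_mono:
  assumes \<omega>: "\<omega> \<in> space W" and fg: "BM f" "BM g" "\<And>x. x \<in> space S \<Longrightarrow> f x \<le> g x"
  shows "past n \<omega> f \<le> past n \<omega> g"
  unfolding past_def
proof (rule divide_right_mono)
  have \<omega>': "(\<sigma> ^^ n) \<omega> \<in> space W" using \<omega> by (rule funpow_\<sigma>_space)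
  show "(\<integral>x. T n ((\<sigma> ^^ n) \<omega>) f x \<partial>\<mu>) \<le> (\<integral>x. T n ((\<sigma> ^^ n) \<omega>) g x \<partial>\<mu>)"
    by (rule integral_mono_bounded_measurable[OF BM_T[OF \<omega>' fg(1)] BM_T[OF \<omega>' fg(2)] prob_\<mu> sets_\<mu>])
      (rule T_mono[OF \<omega>' _ fg])
qed (use past_denom_pos[OF \<omega>] less_imp_le in blast)

lemma past_cmult: "past n \<omega> (\<lambda>x. c * f x) = c * past n \<omega> f"
  by (simp add: past_def T_cmult)

lemma past_const: "\<omega> \<in> space W \<Longrightarrow> past n \<omega> (\<lambda>_. c) = c"
  using past_denom_pos[of \<omega> n] by (simp add: past_def T_const)

text \<open>\<open>past\<close> is a monotone average that fixes constants, so pointwise comparison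
  of \<open>U\<close> with one of its values passes to it.\<close>

lemma past_U_harnack:
  assumes \<omega>: "\<omega> \<in> space W" and x: "x \<in> space S"
  shows "past m \<omega> (U n \<omega>) \<le> R * U n \<omega> x" "U n \<omega> x \<le> R * past m \<omega> (U n \<omega>)"
proof -
  have "past m \<omega> (U n \<omega>) \<le> past m \<omega> (\<lambda>_. R * U n \<omega> x)"
    by (intro past_mono \<omega> BM_U) (auto intro: U_harnack[OF \<omega> _ x])
  then show "past m \<omega> (U n \<omega>) \<le> R * U n \<omega> x" by (simp add: past_const[OF \<omega>])
  have "past m \<omega> (\<lambda>_. U n \<omega> x) \<le> past m \<omega> (\<lambda>y. R * U n \<omega> y)"
    by (intro past_mono \<omega> BM_U bounded_measurable_cmult) (auto intro: U_harnack[OF \<omega> x])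
  then show "U n \<omega> x \<le> R * past m \<omega> (U n \<omega>)" by (simp add: past_const[OF \<omega>] past_cmult)
qed

lemma past_U_pos: "\<omega> \<in> space W \<Longrightarrow> 0 < past m \<omega> (U n \<omega>)"
  using S_nonempty past_U_harnack(2)[of \<omega> _ n m] U_pos[of \<omega> _ n] R_ge_1[of \<omega>]
  by (metis less_le_trans mult_pos_pos zero_less_one zero_less_mult_pos)

lemma hn_bounds:
  assumes \<omega>: "\<omega> \<in> space W" and x: "x \<in> space S"
  shows "1 / R \<le> hn n \<omega> x" "hn n \<omega> x \<le> R" "0 < hn n \<omega> x"
  using past_U_harnack[OF \<omega> x, where m = n and n = n] past_U_pos[OF \<omega>, of n n] R_ge_1[OF \<omega>] U_pos[OF \<omega> x, of n]
  by (auto simp: hn_def divide_le_eq le_divide_eq mult.commute)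

text \<open>The last n steps before the present make f proportional to \<open>U n\<close> up to the
  factor \<open>qf n\<close>, with a constant l determined by f and the environment n steps back.
  Whatever happened earlier only averages this relation, and the normalisation cancels the
  masses.\<close>

lemma past_forgets:
  assumes \<omega>: "\<omega> \<in> space W" and f: "BM f" and f_pos: "\<And>x. x \<in> space S \<Longrightarrow> 0 < f x"
    and harnack: "\<And>x y. x \<in> space S \<Longrightarrow> y \<in> space S \<Longrightarrow> f x \<le> R * f y"
    and "n \<le> m"
  shows "past m \<omega> f \<le> qf n * past n \<omega> f" "past n \<omega> f \<le> qf n * past m \<omega> f"
proof -
  have \<omega>n: "(\<sigma> ^^ n) \<omega> \<in> space W" using \<omega> by (rule funpow_\<sigma>_space)
  obtain l where l: "0 < l"
    "\<And>x. x \<in> space S \<Longrightarrow> l * U n ((\<sigma> ^^ n) \<omega>) x \<le> T n ((\<sigma> ^^ n) \<omega>) f x"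
    "\<And>x. x \<in> space S \<Longrightarrow> T n ((\<sigma> ^^ n) \<omega>) f x \<le> qf n * l * U n ((\<sigma> ^^ n) \<omega>) x"
    using T_almost_proportional[OF \<omega>n f f_pos harnack] by blast
  \<comment> \<open>The constant l does not depend on k, so the pasts of length n (k = 0) and of
    length m lie in the same interval.\<close>
  have bounds: "l \<le> past (n + k) \<omega> f \<and> past (n + k) \<omega> f \<le> qf n * l" for k
  proof -
    let ?\<omega>' = "(\<sigma> ^^ (n + k)) \<omega>"
    have \<omega>': "?\<omega>' \<in> space W" using \<omega> by (rule funpow_\<sigma>_space)
    have shift: "(\<tau> ^^ k) ?\<omega>' = (\<sigma> ^^ n) \<omega>"
      by (simp add: add.commute[of n] funpow_add funpow_\<tau>_\<sigma>)
    have T: "T (n + k) ?\<omega>' g = T k ?\<omega>' (T n ((\<sigma> ^^ n) \<omega>) g)" for g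
    proof -
      have "T (n + k) ?\<omega>' g = T (k + n) ?\<omega>' g" by (simp only: add.commute)
      then show ?thesis by (simp only: T_add shift)
    qed
    have U: "U (n + k) ?\<omega>' = T k ?\<omega>' (U n ((\<sigma> ^^ n) \<omega>))"
      using T[of "\<lambda>_. 1"] by (simp add: U_def)
    have d: "0 < (\<integral>x. U (n + k) ?\<omega>' x \<partial>\<mu>)" by (rule past_denom_pos[OF \<omega>])
    have 1: "c * U (n + k) ?\<omega>' x = T k ?\<omega>' (\<lambda>x. c * U n ((\<sigma> ^^ n) \<omega>) x) x" for c x
      by (simp add: U T_cmult)
    have "(\<integral>x. l * U (n + k) ?\<omega>' x \<partial>\<mu>) \<le> (\<integral>x. T (n + k) ?\<omega>' f x \<partial>\<mu>)"
    proof (rule integral_mono_bounded_measurable[OF _ BM_T[OF \<omega>' f] prob_\<mu> sets_\<mu>])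
      show "BM (\<lambda>x. l * U (n + k) ?\<omega>' x)" by (intro bounded_measurable_cmult BM_U \<omega>')
      show "l * U (n + k) ?\<omega>' x \<le> T (n + k) ?\<omega>' f x" if "x \<in> space S" for x
        unfolding 1 T by (intro T_mono \<omega>' that l bounded_measurable_cmult BM_U BM_T \<omega>n f)
    qed
    moreover have "(\<integral>x. T (n + k) ?\<omega>' f x \<partial>\<mu>) \<le> (\<integral>x. qf n * l * U (n + k) ?\<omega>' x \<partial>\<mu>)"
    proof (rule integral_mono_bounded_measurable[OF BM_T[OF \<omega>' f] _ prob_\<mu> sets_\<mu>])
      show "BM (\<lambda>x. qf n * l * U (n + k) ?\<omega>' x)" by (intro bounded_measurable_cmult BM_U \<omega>')
      show "T (n + k) ?\<omega>' f x \<le> qf n * l * U (n + k) ?\<omega>' x" if "x \<in> space S" for x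
        unfolding 1 T by (intro T_mono \<omega>' that l bounded_measurable_cmult BM_U BM_T \<omega>n f)
    qed
    ultimately show ?thesis
      using d by (simp add: past_def divide_le_eq le_divide_eq mult.commute)
  qed
  obtain k where k: "m = n + k" using \<open>n \<le> m\<close> le_Suc_ex by blast
  have q: "1 \<le> qf n" by (rule qf_ge_1[OF \<omega>])
  have "qf n * l \<le> qf n * past i \<omega> f" if "i = n \<or> i = n + k" for i
    using that bounds[of k] bounds[of 0] q by (intro mult_left_mono) auto
  then show "past m \<omega> f \<le> qf n * past n \<omega> f" "past n \<omega> f \<le> qf n * past m \<omega> f"
    using bounds[of k] bounds[of 0] unfolding k by (metis add_0_right order_trans)+
qed

text \<open>Two errors of size \<open>qf n\<close> occur: one from replacing \<open>U m\<close> by a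
  multiple of \<open>U n\<close>, one from replacing the past of length m by the past of length n.
  The unknown multiple l appears in numerator and denominator and cancels.\<close>

lemma hn_almost_constant:
  assumes \<omega>: "\<omega> \<in> space W" and x: "x \<in> space S" and "n \<le> m"
  shows "hn m \<omega> x \<le> (qf n)\<^sup>2 * hn n \<omega> x" "hn n \<omega> x \<le> (qf n)\<^sup>2 * hn m \<omega> x"
proof -
  obtain k where k: "m = n + k" using \<open>n \<le> m\<close> le_Suc_ex by blast
  have \<omega>': "(\<tau> ^^ n) \<omega> \<in> space W" using \<omega> by (rule funpow_\<tau>_space)
  obtain l where l: "0 < l"
    "\<And>x. x \<in> space S \<Longrightarrow> l * U n \<omega> x \<le> U m \<omega> x"
    "\<And>x. x \<in> space S \<Longrightarrow> U m \<omega> x \<le> qf n * l * U n \<omega> x"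
    unfolding k U_add
    using T_almost_proportional[OF \<omega> BM_U[OF \<omega>'] U_pos[OF \<omega>'] U_harnack[OF \<omega>']] by blast
  have q: "1 \<le> qf n" by (rule qf_ge_1[OF \<omega>])
  define A where "A = past n \<omega> (U n \<omega>)"
  define B where "B = past m \<omega> (U m \<omega>)"
  \<comment> \<open>The intermediate quantity: the long past applied to the short future. It differs
    from A by forgetting, and from B by proportionality.\<close>
  define C where "C = past m \<omega> (U n \<omega>)"
  have pos: "0 < A" "0 < B" "0 < C" by (simp_all add: A_def B_def C_def past_U_pos[OF \<omega>])
  have CA: "C \<le> qf n * A" "A \<le> qf n * C"
    unfolding A_def C_def
    by (rule past_forgets[OF \<omega> BM_U[OF \<omega>] U_pos[OF \<omega>] _ \<open>n \<le> m\<close>]; (assumption | rule U_harnack[OF \<omega>]; assumption))+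
  have B1: "l * C \<le> B"
    unfolding B_def C_def past_cmult[symmetric]
    by (intro past_mono \<omega> bounded_measurable_cmult BM_U l)
  have B2: "B \<le> qf n * l * C"
    unfolding B_def C_def past_cmult[symmetric]
    by (intro past_mono \<omega> bounded_measurable_cmult BM_U l)
  let ?u = "U n \<omega> x" and ?v = "U m \<omega> x"
  have uv: "0 < ?u" "0 < ?v" by (intro U_pos \<omega> x)+
  have "?v * A \<le> (qf n * l * ?u) * (qf n * C)"
    using l(3)[OF x] CA pos uv q l(1) by (intro mult_mono) auto
  also have "\<dots> = (qf n)\<^sup>2 * ?u * (l * C)" by (simp add: power2_eq_square)
  also have "\<dots> \<le> (qf n)\<^sup>2 * ?u * B" using B1 uv by (intro mult_left_mono) auto
  finally show "hn m \<omega> x \<le> (qf n)\<^sup>2 * hn n \<omega> x"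
    unfolding hn_def A_def[symmetric] B_def[symmetric] using pos by (simp add: divide_simps mult_ac)
  have "?u * B \<le> ?u * (qf n * l * C)" using B2 uv by (intro mult_left_mono) auto
  also have "\<dots> = (l * ?u) * (qf n * C)" by simp
  also have "\<dots> \<le> ?v * (qf n * (qf n * A))"
    using l(2)[OF x] CA pos uv q l(1) by (intro mult_mono mult_left_mono) auto
  finally show "hn n \<omega> x \<le> (qf n)\<^sup>2 * hn m \<omega> x"
    unfolding hn_def A_def[symmetric] B_def[symmetric] using pos
    by (simp add: divide_simps mult_ac power2_eq_square)
qed

text \<open>The multiplicative errors tend to 1, and the uniform bound by \<open>R\<close> turns
  them into additive ones, which makes the sequence Cauchy.\<close>

lemma hn_tendsto:
  assumes \<omega>: "\<omega> \<in> space W" and x: "x \<in> space S"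
  shows "(\<lambda>n. hn n \<omega> x) \<longlonglongrightarrow> h \<omega> x"
proof -
  have q: "1 \<le> qf n" for n by (rule qf_ge_1[OF \<omega>])
  have diff: "\<bar>hn m \<omega> x - hn n \<omega> x\<bar> \<le> ((qf n)\<^sup>2 - 1) * R" if "n \<le> m" for n m
  proof -
    have q2: "0 \<le> (qf n)\<^sup>2 - 1" using q[of n] by simp
    have "((qf n)\<^sup>2 - 1) * hn k \<omega> x \<le> ((qf n)\<^sup>2 - 1) * R" for k
      using hn_bounds(2)[OF \<omega> x] q2 by (rule mult_left_mono)
    from this[of n] this[of m] hn_almost_constant[OF \<omega> x that] show ?thesis
      by (simp add: left_diff_distrib abs_le_iff)
  qed
  have "(\<lambda>n. ((qf n)\<^sup>2 - 1) * R) \<longlonglongrightarrow> (1\<^sup>2 - 1) * R"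
    by (intro tendsto_intros qf_tendsto[OF \<omega>])
  then have lim: "(\<lambda>n. ((qf n)\<^sup>2 - 1) * R) \<longlonglongrightarrow> 0" by simp
  have "Cauchy (\<lambda>n. hn n \<omega> x)"
  proof (rule CauchyI')
    fix e :: real assume "0 < e"
    then obtain M where "\<And>n. M \<le> n \<Longrightarrow> ((qf n)\<^sup>2 - 1) * R < e"
      using order_tendstoD(2)[OF lim] by (auto simp: eventually_sequentially)
    then have "dist (hn m \<omega> x) (hn n \<omega> x) < e" if "M \<le> m" "m < n" for m n
      using diff[of m n] that by (force simp: dist_real_def abs_minus_commute)
    then show "\<exists>M. \<forall>m\<ge>M. \<forall>n>m. dist (hn m \<omega> x) (hn n \<omega> x) < e" by blast
  qed
  then have "convergent (\<lambda>n. hn n \<omega> x)" by (rule Cauchy_convergent)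
  then show ?thesis unfolding h_def by (simp add: convergent_LIMSEQ_iff)
qed

lemma h_bounds:
  assumes \<omega>: "\<omega> \<in> space W" and x: "x \<in> space S"
  shows "1 / R \<le> h \<omega> x" "h \<omega> x \<le> R" "0 < h \<omega> x"
proof -
  show "1 / R \<le> h \<omega> x" "h \<omega> x \<le> R"
    using hn_tendsto[OF \<omega> x] hn_bounds[OF \<omega> x] by (blast intro: LIMSEQ_le_const LIMSEQ_le_const2)+
  then show "0 < h \<omega> x" using R_ge_1[OF \<omega>] by (smt (verit) divide_pos_pos)
qed

lemma hn_measurable: "\<omega> \<in> space W \<Longrightarrow> hn n \<omega> \<in> borel_measurable S"
  unfolding hn_def[abs_def] using bounded_measurableD[OF BM_U[of \<omega> n]] by simp

lemma BM_h: "\<omega> \<in> space W \<Longrightarrow> BM (h \<omega>)"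
proof (rule bounded_measurableI[where B = R])
  assume \<omega>: "\<omega> \<in> space W"
  show "h \<omega> \<in> borel_measurable S"
    by (rule borel_measurable_LIMSEQ_real[OF hn_tendsto[OF \<omega>] hn_measurable[OF \<omega>]])
  show "\<bar>h \<omega> x\<bar> \<le> R" if "x \<in> space S" for x
    using h_bounds[OF \<omega> that] by simp
qed

text \<open>The ratio of the normalising constants of consecutive approximants of \<open>h\<close>:
  \<open>L\<close> maps the n-th approximant at \<open>\<tau> \<omega>\<close> to this ratio times
  the next approximant at \<omega>.\<close>

definition eig :: "'a \<Rightarrow> real" where
  "eig \<omega> = lim (\<lambda>n. past (Suc n) \<omega> (U (Suc n) \<omega>) / past n (\<tau> \<omega>) (U n (\<tau> \<omega>)))"

lemma
  assumes \<omega>: "\<omega> \<in> space W"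
  shows L_h: "x \<in> space S \<Longrightarrow> L \<omega> (h (\<tau> \<omega>)) x = eig \<omega> * h \<omega> x" and eig_pos: "0 < eig \<omega>"
proof -
  have \<tau>\<omega>: "\<tau> \<omega> \<in> space W" using \<omega> by (rule \<tau>_space)
  have R1: "1 \<le> R" by (rule R_ge_1[OF \<omega>])
  \<comment> \<open>The sequence is free of x, whereas its limit is computed at an arbitrary x.
    Hence the quotient of \<open>L \<omega> (h (\<tau> \<omega>))\<close> and
    \<open>h \<omega>\<close> is constant in x.\<close>
  define s where "s n = past (Suc n) \<omega> (U (Suc n) \<omega>) / past n (\<tau> \<omega>) (U n (\<tau> \<omega>))" for n
  have s_lim: "s \<longlonglongrightarrow> L \<omega> (h (\<tau> \<omega>)) x / h \<omega> x" if x: "x \<in> space S" for x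
  proof -
    have s: "s n = L \<omega> (hn n (\<tau> \<omega>)) x / hn (Suc n) \<omega> x" for n
    proof -
      have "L \<omega> (hn n (\<tau> \<omega>)) x = L \<omega> (\<lambda>y. inverse (past n (\<tau> \<omega>) (U n (\<tau> \<omega>))) * U n (\<tau> \<omega>) y) x"
        by (simp add: hn_def[abs_def] divide_inverse mult.commute)
      also have "\<dots> = U (Suc n) \<omega> x / past n (\<tau> \<omega>) (U n (\<tau> \<omega>))"
        unfolding L_cmult U_Suc by (simp add: divide_inverse mult.commute)
      finally show ?thesis
        using past_U_pos[OF \<omega>, of "Suc n" "Suc n"] U_pos[OF \<omega> x, of "Suc n"]
        by (simp add: s_def hn_def)
    qed
    have "(\<lambda>n. L \<omega> (hn n (\<tau> \<omega>)) x) \<longlonglongrightarrow> L \<omega> (h (\<tau> \<omega>)) x"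
      unfolding L_def
    proof (rule integral_dominated_convergence[where w = "\<lambda>_. wu * R"])
      interpret prob_space "\<kappa> \<omega> x" by (rule prob_\<kappa>[OF \<omega> x])
      note cong = measurable_cong_sets[OF sets_\<kappa>[OF \<omega> x] refl]
      show "(\<lambda>y. w \<omega> x y * h (\<tau> \<omega>) y) \<in> borel_measurable (\<kappa> \<omega> x)"
        unfolding cong using w_section[OF \<omega> x] BM_h[OF \<tau>\<omega>] by (intro borel_measurable_times) auto
      show "(\<lambda>y. w \<omega> x y * hn n (\<tau> \<omega>) y) \<in> borel_measurable (\<kappa> \<omega> x)" for n
        unfolding cong using w_section[OF \<omega> x] hn_measurable[OF \<tau>\<omega>] by (intro borel_measurable_times) auto
      show "integrable (\<kappa> \<omega> x) (\<lambda>_. wu * R)" by simp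
      show "AE y in \<kappa> \<omega> x. (\<lambda>n. w \<omega> x y * hn n (\<tau> \<omega>) y) \<longlonglongrightarrow> w \<omega> x y * h (\<tau> \<omega>) y"
        by (intro AE_I2 tendsto_mult tendsto_const hn_tendsto \<tau>\<omega>) (simp add: space_\<kappa>[OF \<omega> x])
      show "AE y in \<kappa> \<omega> x. norm (w \<omega> x y * hn n (\<tau> \<omega>) y) \<le> wu * R" for n
      proof (rule AE_I2)
        fix y assume "y \<in> space (\<kappa> \<omega> x)"
        then have y: "y \<in> space S" by (simp add: space_\<kappa>[OF \<omega> x])
        have "\<bar>w \<omega> x y\<bar> * \<bar>hn n (\<tau> \<omega>) y\<bar> \<le> wu * R"
          using w_ge[OF \<omega> x y] w_le[OF \<omega> x y] wl_pos hn_bounds[OF \<tau>\<omega> y, of n]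
          by (intro mult_mono) auto
        then show "norm (w \<omega> x y * hn n (\<tau> \<omega>) y) \<le> wu * R" by (simp add: abs_mult)
      qed
    qed
    moreover have "(\<lambda>n. hn (Suc n) \<omega> x) \<longlonglongrightarrow> h \<omega> x"
      by (rule LIMSEQ_Suc[OF hn_tendsto[OF \<omega> x]])
    ultimately show ?thesis
      unfolding s using h_bounds(3)[OF \<omega> x] by (intro tendsto_divide) auto
  qed
  have eig: "eig \<omega> = L \<omega> (h (\<tau> \<omega>)) x / h \<omega> x" if "x \<in> space S" for x
    using limI[OF s_lim[OF that]] by (simp add: eig_def s_def[abs_def])
  then show "L \<omega> (h (\<tau> \<omega>)) x = eig \<omega> * h \<omega> x" if "x \<in> space S"
    using h_bounds(3)[OF \<omega> that] that by simp
  obtain x0 where x0: "x0 \<in> space S" using S_nonempty by blast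
  have "wl * (1 / R) \<le> L \<omega> (\<lambda>_. 1 / R) x0"
    using L_cmult[of \<omega> "1 / R" "\<lambda>_. 1" x0] L_1_bounds(1)[OF \<omega> x0] R1 by (simp add: divide_right_mono)
  also have "\<dots> \<le> L \<omega> (h (\<tau> \<omega>)) x0"
    using h_bounds(1)[OF \<tau>\<omega>] by (intro L_mono \<omega> x0 BM_h \<tau>\<omega>) auto
  finally have "0 < L \<omega> (h (\<tau> \<omega>)) x0"
    using wl_pos R1 by (smt (verit) divide_pos_pos mult_pos_pos)
  then show "0 < eig \<omega>"
    using h_bounds(3)[OF \<omega> x0] eig[OF x0] by simp
qed

lemma T_h:
  assumes "\<omega> \<in> space W" "x \<in> space S"
  shows "T n \<omega> (h ((\<tau> ^^ n) \<omega>)) x = (\<Prod>p<n. eig ((\<tau> ^^ p) \<omega>)) * h \<omega> x"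
  using assms
proof (induction n arbitrary: \<omega> x)
  case (Suc n)
  have \<tau>\<omega>: "\<tau> \<omega> \<in> space W" using Suc.prems \<tau>_space by blast
  have "T (Suc n) \<omega> (h ((\<tau> ^^ Suc n) \<omega>)) x = L \<omega> (T n (\<tau> \<omega>) (h ((\<tau> ^^ n) (\<tau> \<omega>)))) x"
    by (simp add: funpow_swap1)
  also have "\<dots> = L \<omega> (\<lambda>y. (\<Prod>p<n. eig ((\<tau> ^^ p) (\<tau> \<omega>))) * h (\<tau> \<omega>) y) x"
    using Suc.IH[OF \<tau>\<omega>] by (intro L_cong Suc.prems) auto
  also have "\<dots> = (\<Prod>p<n. eig ((\<tau> ^^ Suc p) \<omega>)) * (eig \<omega> * h \<omega> x)"
    using Suc.prems by (simp add: L_cmult L_h funpow_swap1)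
  also have "\<dots> = (\<Prod>p<Suc n. eig ((\<tau> ^^ p) \<omega>)) * h \<omega> x"
    by (subst prod.lessThan_Suc_shift) simp
  finally show ?case .
qed simp

end

subsection \<open>Products of identical measures\<close>

text \<open>One coordinate is integrated at a time, each costing a factor c. The claim is about
  integrands and not sets because the induction hypothesis is applied to a partial integral of
  f.\<close>

lemma nn_integral_PiM_kernel_bound:
  assumes m: "prob_space m" and \<nu>: "prob_space \<nu>" and sets: "sets m = sets \<nu>"
    and bound: "\<And>A. A \<in> sets \<nu> \<Longrightarrow> emeasure m A \<le> c * emeasure \<nu> A"
    and I: "finite I" and f: "f \<in> borel_measurable (PiM I (\<lambda>_. \<nu>))"
  shows "(\<integral>\<^sup>+x. f x \<partial>PiM I (\<lambda>_. m)) \<le> c ^ card I * (\<integral>\<^sup>+x. f x \<partial>PiM I (\<lambda>_. \<nu>))"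
proof -
  interpret m: prob_space m by fact
  interpret \<nu>: prob_space \<nu> by fact
  interpret pm: product_sigma_finite "\<lambda>_. m" by standard
  interpret pn: product_sigma_finite "\<lambda>_. \<nu>" by standard
  have sets_P: "sets (PiM J (\<lambda>_. m)) = sets (PiM J (\<lambda>_. \<nu>))" for J
    by (rule sets_PiM_cong) (simp_all add: sets)
  show ?thesis
    using I f
  proof (induction arbitrary: f)
    case empty
    show ?case by (simp add: PiM_empty)
  next
    case (insert i J)
    have f_m: "f \<in> borel_measurable (PiM (insert i J) (\<lambda>_. m))"
      using insert.prems by (simp only: measurable_cong_sets[OF sets_P refl])
    have "(\<lambda>(x, y). f (x(i := y))) \<in> borel_measurable (PiM J (\<lambda>_. \<nu>) \<Otimes>\<^sub>M \<nu>)"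
      using measurable_compose[OF measurable_add_dim insert.prems] by (simp add: split_beta' fun_upd_def)
    then have meas: "(\<lambda>x. \<integral>\<^sup>+y. f (x(i := y)) \<partial>\<nu>) \<in> borel_measurable (PiM J (\<lambda>_. \<nu>))"
      by (rule \<nu>.borel_measurable_nn_integral)
    have inner: "(\<integral>\<^sup>+y. f (x(i := y)) \<partial>m) \<le> c * (\<integral>\<^sup>+y. f (x(i := y)) \<partial>\<nu>)"
      if x: "x \<in> space (PiM J (\<lambda>_. m))" for x
    proof (rule nn_integral_mono_kernel_bound[OF sets bound])
      have "x \<in> space (PiM J (\<lambda>_. \<nu>))" using x sets_eq_imp_space_eq[OF sets_P] by blast
      from measurable_compose[OF measurable_Pair1'[OF this] measurable_compose[OF measurable_add_dim insert.prems]]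
      show "(\<lambda>y. f (x(i := y))) \<in> borel_measurable \<nu>" by (simp add: fun_upd_def)
    qed
    have "(\<integral>\<^sup>+x. f x \<partial>PiM (insert i J) (\<lambda>_. m)) = (\<integral>\<^sup>+x. \<integral>\<^sup>+y. f (x(i := y)) \<partial>m \<partial>PiM J (\<lambda>_. m))"
      using insert.hyps f_m by (rule pm.product_nn_integral_insert)
    also have "\<dots> \<le> (\<integral>\<^sup>+x. c * (\<integral>\<^sup>+y. f (x(i := y)) \<partial>\<nu>) \<partial>PiM J (\<lambda>_. m))"
      by (rule nn_integral_mono[OF inner])
    also have "\<dots> \<le> c ^ card J * (\<integral>\<^sup>+x. c * (\<integral>\<^sup>+y. f (x(i := y)) \<partial>\<nu>) \<partial>PiM J (\<lambda>_. \<nu>))"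
      by (intro insert.IH borel_measurable_times_ennreal borel_measurable_const meas)
    also have "\<dots> = c ^ card (insert i J) * (\<integral>\<^sup>+x. \<integral>\<^sup>+y. f (x(i := y)) \<partial>\<nu> \<partial>PiM J (\<lambda>_. \<nu>))"
      using insert.hyps by (simp add: nn_integral_cmult[OF meas] mult_ac)
    also have "\<dots> = c ^ card (insert i J) * (\<integral>\<^sup>+x. f x \<partial>PiM (insert i J) (\<lambda>_. \<nu>))"
      by (simp only: pn.product_nn_integral_insert[OF insert.hyps insert.prems])
    finally show ?case .
  qed
qed

lemma emeasure_PiM_kernel_bound:
  assumes "prob_space m" "prob_space \<nu>" "sets m = sets \<nu>"
    "\<And>A. A \<in> sets \<nu> \<Longrightarrow> emeasure m A \<le> c * emeasure \<nu> A"
    "finite I" and A: "A \<in> sets (PiM I (\<lambda>_. \<nu>))"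
  shows "emeasure (PiM I (\<lambda>_. m)) A \<le> c ^ card I * emeasure (PiM I (\<lambda>_. \<nu>)) A"
proof -
  have "sets (PiM I (\<lambda>_. m)) = sets (PiM I (\<lambda>_. \<nu>))"
    by (rule sets_PiM_cong) (simp_all add: assms)
  then show ?thesis
    using nn_integral_PiM_kernel_bound[OF assms(1-5), of "indicator A"] A by simp
qed

text \<open>Rectangles form an intersection-stable generator, and on a rectangle the product measure
  is a finite product of measurable functions of the parameter.\<close>

lemma measurable_PiM_prob_algebra:
  assumes I: "finite I" and K: "K \<in> measurable M (prob_algebra X)"
  shows "(\<lambda>a. PiM I (\<lambda>_. K a)) \<in> measurable M (prob_algebra (PiM I (\<lambda>_. X)))"
proof (rule measurable_prob_algebra_generated[OF sets_PiM Int_stable_prod_algebra prod_algebra_sets_into_space])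
  fix a assume a: "a \<in> space M"
  have Ka: "prob_space (K a)" "sets (K a) = sets X"
    using measurable_space[OF K a] by (simp_all add: space_prob_algebra)
  show "prob_space (PiM I (\<lambda>_. K a))" using Ka by (intro prob_space_PiM)
  show "sets (PiM I (\<lambda>_. K a)) = sets (PiM I (\<lambda>_. X))"
    by (rule sets_PiM_cong) (simp_all add: Ka)
next
  fix A assume "A \<in> prod_algebra I (\<lambda>_. X)"
  then obtain B where B: "A = Pi\<^sub>E I B" "\<And>i. i \<in> I \<Longrightarrow> B i \<in> sets X"
    unfolding prod_algebra_eq_finite[OF I] by auto
  have "emeasure (PiM I (\<lambda>_. K a)) A = (\<Prod>i\<in>I. emeasure (K a) (B i))" if a: "a \<in> space M" for a
  proof -
    have Ka: "prob_space (K a)" "sets (K a) = sets X"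
      using measurable_space[OF K a] by (simp_all add: space_prob_algebra)
    interpret prob_space "K a" by fact
    interpret product_sigma_finite "\<lambda>_. K a" by standard
    show ?thesis unfolding B by (rule emeasure_PiM[OF I]) (simp add: B Ka)
  qed
  moreover have "(\<lambda>a. \<Prod>i\<in>I. emeasure (K a) (B i)) \<in> borel_measurable M"
    by (intro borel_measurable_prod_ennreal measurable_emeasure_kernel[OF measurable_prob_algebraD[OF K] B(2)])
  ultimately show "(\<lambda>a. emeasure (PiM I (\<lambda>_. K a)) A) \<in> borel_measurable M"
    by (simp cong: measurable_cong)
qed

text \<open>A function of one or two coordinates is a product over all coordinates whose other
  factors are 1, so the integral of a product splits.\<close>

lemma
  fixes f g :: "'x \<Rightarrow> real"
  assumes m: "prob_space m" and I: "finite I" and i: "i \<in> I"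
    and f: "integrable m f"
  shows integral_PiM_component: "(\<integral>z. f (z i) \<partial>PiM I (\<lambda>_. m)) = (\<integral>x. f x \<partial>m)"
    and integral_PiM_component2: "j \<in> I \<Longrightarrow> i \<noteq> j \<Longrightarrow> integrable m g \<Longrightarrow>
      (\<integral>z. f (z i) * g (z j) \<partial>PiM I (\<lambda>_. m)) = (\<integral>x. f x \<partial>m) * (\<integral>x. g x \<partial>m)"
proof -
  interpret prob_space m by fact
  interpret product_sigma_finite "\<lambda>_. m" by standard
  have one: "(\<integral>x. 1 \<partial>m) = (1::real)" by (simp add: prob_space)
  have "(\<integral>z. (\<Prod>k\<in>I. (if k = i then f (z k) else 1)) \<partial>PiM I (\<lambda>_. m)) =
      (\<Prod>k\<in>I. \<integral>x. (if k = i then f x else 1) \<partial>m)"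
  proof (rule product_integral_prod[OF I])
    show "integrable m (\<lambda>x. if k = i then f x else 1)" for k
      using f by (cases "k = i") auto
  qed
  moreover have "(\<Prod>k\<in>I. (if k = i then f (z k) else 1)) = f (z i)" for z
    using I i by (subst prod.delta) auto
  moreover have "(\<Prod>k\<in>I. \<integral>x. (if k = i then f x else 1) \<partial>m) = (\<integral>x. f x \<partial>m)"
    using I i by (simp add: if_distrib[of "integral\<^sup>L m"] prod.remove[OF I i] one prob_space)
  ultimately show "(\<integral>z. f (z i) \<partial>PiM I (\<lambda>_. m)) = (\<integral>x. f x \<partial>m)" by simp
  assume j: "j \<in> I" "i \<noteq> j" and g: "integrable m g"
  define F where "F k x = (if k = i then f x else if k = j then g x else 1)" for k x
  have F: "F i = f" "F j = g" "k \<noteq> i \<Longrightarrow> k \<noteq> j \<Longrightarrow> F k = (\<lambda>_. 1)" for k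
    using j by (auto simp: F_def fun_eq_iff)
  have F_int: "integrable m (F k)" for k
    using f g F by (cases "k = i"; cases "k = j") auto
  have "(\<integral>z. (\<Prod>k\<in>I. F k (z k)) \<partial>PiM I (\<lambda>_. m)) = (\<Prod>k\<in>I. \<integral>x. F k x \<partial>m)"
    by (rule product_integral_prod[OF I F_int])
  moreover have ji: "j \<in> I - {i}" "finite (I - {i})" using I j by auto
  have "(\<Prod>k\<in>I. F k (z k)) = f (z i) * g (z j)" for z
    using F by (simp add: prod.remove[OF I i] prod.remove[OF ji(2,1)])
  moreover have "(\<Prod>k\<in>I. \<integral>x. F k x \<partial>m) = (\<integral>x. f x \<partial>m) * (\<integral>x. g x \<partial>m)"
    using F by (simp add: prod.remove[OF I i] prod.remove[OF ji(2,1)] prob_space)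
  ultimately show "(\<integral>z. f (z i) * g (z j) \<partial>PiM I (\<lambda>_. m)) = (\<integral>x. f x \<partial>m) * (\<integral>x. g x \<partial>m)"
    by simp
qed

lemma bounded_measurable_component:
  assumes "bounded_measurable X f" "i \<in> I"
  shows "bounded_measurable (PiM I (\<lambda>_. X)) (\<lambda>z. f (z i))"
proof -
  have "(\<lambda>z. f (z i)) \<in> borel_measurable (PiM I (\<lambda>_. X))"
    using measurable_compose[OF measurable_component_singleton[OF assms(2), of "\<lambda>_. X"]] assms(1) by auto
  then show ?thesis
    using assms by (auto simp: bounded_measurable_def space_PiM PiE_iff)
qed

lemma bounded_measurable_add:
  "bounded_measurable S f \<Longrightarrow> bounded_measurable S g \<Longrightarrow> bounded_measurable S (\<lambda>x. f x + g x)"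
  using bounded_measurable_diff[of S f "\<lambda>x. - 1 * g x"] bounded_measurable_cmult[of S g "- 1"] by simp

lemma bounded_measurable_sum:
  "(\<And>i. i \<in> J \<Longrightarrow> bounded_measurable S (f i)) \<Longrightarrow> bounded_measurable S (\<lambda>x. \<Sum>i\<in>J. f i x)"
  by (induction J rule: infinite_finite_induct) (auto intro: bounded_measurable_add)

lemma bounded_measurable_divide:
  assumes f: "bounded_measurable S f" and g: "bounded_measurable S g"
    and "0 < b" "\<And>x. x \<in> space S \<Longrightarrow> b \<le> g x"
  shows "bounded_measurable S (\<lambda>x. f x / g x)"
proof -
  have "bounded_measurable S (\<lambda>x. inverse (g x))"
  proof (rule bounded_measurableI)
    show "(\<lambda>x. inverse (g x)) \<in> borel_measurable S"
      using bounded_measurableD[OF g] by simp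
    show "\<bar>inverse (g x)\<bar> \<le> inverse b" if "x \<in> space S" for x
      using assms(3) assms(4)[OF that] by (simp add: le_imp_inverse_le)
  qed
  from bounded_measurable_mult[OF f this] show ?thesis by (simp add: divide_inverse)
qed

text \<open>Off the diagonal the integral of the product factors into two means, both zero.\<close>

lemma second_moment_iid_sum:
  fixes k :: "'x \<Rightarrow> real"
  assumes m: "prob_space m" and k: "bounded_measurable m k" and I: "finite I" and centred: "(\<integral>x. k x \<partial>m) = 0"
  shows "(\<integral>z. (\<Sum>i\<in>I. k (z i))\<^sup>2 \<partial>PiM I (\<lambda>_. m)) = real (card I) * (\<integral>x. (k x)\<^sup>2 \<partial>m)"
proof -
  interpret prob_space m by fact
  have PI: "prob_space (PiM I (\<lambda>_. m))" using m by (intro prob_space_PiM)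
  note comp = bounded_measurable_component[OF k, of _ I]
  have k_int: "integrable m k" "integrable m (\<lambda>x. k x * k x)"
    using k m by (auto intro!: bounded_measurable_integrable[where S = m] bounded_measurable_mult)
  have int: "integrable (PiM I (\<lambda>_. m)) (\<lambda>z. k (z i) * k (z j))" if "i \<in> I" "j \<in> I" for i j
    using that by (intro bounded_measurable_integrable[OF _ PI refl] bounded_measurable_mult comp)
  have "(\<integral>z. (\<Sum>i\<in>I. k (z i))\<^sup>2 \<partial>PiM I (\<lambda>_. m)) =
      (\<Sum>i\<in>I. \<Sum>j\<in>I. \<integral>z. k (z i) * k (z j) \<partial>PiM I (\<lambda>_. m))"
    unfolding power2_eq_square sum_product
    using int by (simp add: Bochner_Integration.integral_sum Bochner_Integration.integrable_sum)
  also have "\<dots> = (\<Sum>i\<in>I. \<Sum>j\<in>I. if j = i then (\<integral>x. (k x)\<^sup>2 \<partial>m) else 0)"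
  proof (intro sum.cong refl)
    fix i j assume ij: "i \<in> I" "j \<in> I"
    show "(\<integral>z. k (z i) * k (z j) \<partial>PiM I (\<lambda>_. m)) = (if j = i then (\<integral>x. (k x)\<^sup>2 \<partial>m) else 0)"
    proof (cases "j = i")
      case True
      then show ?thesis
        using integral_PiM_component[OF m I ij(1) k_int(2)] by (simp add: power2_eq_square)
    next
      case False
      then show ?thesis
        using integral_PiM_component2[OF m I ij(1) k_int(1) ij(2) _ k_int(1)] centred by auto
    qed
  qed
  also have "\<dots> = real (card I) * (\<integral>x. (k x)\<^sup>2 \<partial>m)" using I by simp
  finally show ?thesis .
qed

text \<open>Writing \<open>c\<close> for the ratio of the means of \<open>h\<close> and \<open>\<psi>\<close>, and \<open>H\<close>, \<open>S\<close>, \<open>K\<close> for the sums of \<open>h\<close>, \<open>\<psi>\<close>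
  and \<open>k = h - c \<psi>\<close>, one has \<open>H\<^sup>2 / S = c\<^sup>2 S + 2 c K + K\<^sup>2 / S\<close>, where \<open>K\<close> is a sum of centred
  independent terms.\<close>

lemma second_moment_ratio:
  fixes m :: "'x measure" and \<psi> h :: "'x \<Rightarrow> real" and osc :: real and N :: nat
  assumes m: "prob_space m" and psi: "bounded_measurable m \<psi>" and h: "bounded_measurable m h"
    and b: "0 < b" "\<And>x. x \<in> space m \<Longrightarrow> b \<le> \<psi> x" "\<And>x. x \<in> space m \<Longrightarrow> \<psi> x \<le> \<rho> * b"
    and a: "0 < a" "\<And>x. x \<in> space m \<Longrightarrow> a * \<psi> x \<le> h x"
    and osc: "\<And>x y. x \<in> space m \<Longrightarrow> y \<in> space m \<Longrightarrow> h x / \<psi> x - h y / \<psi> y \<le> osc"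
    and N: "0 < N"
  shows "(\<integral>x. \<psi> x \<partial>m) * (\<integral>z. (\<Sum>i<N. h (z i))\<^sup>2 / (\<Sum>i<N. \<psi> (z i)) \<partial>PiM {..<N} (\<lambda>_. m)) / real N
    \<le> (1 + \<rho> / real N * (osc / a)) * (\<integral>x. h x \<partial>m)\<^sup>2"
proof -
  interpret prob_space m by fact
  let ?P = "PiM {..<N} (\<lambda>_. m)"
  have PP: "prob_space ?P" using m by (intro prob_space_PiM)
  obtain x0 where x0: "x0 \<in> space m" using not_empty by blast
  have osc0: "0 \<le> osc" using osc[OF x0 x0] by simp
  have psi_pos: "0 < \<psi> x" if "x \<in> space m" for x using b(1) b(2)[OF that] by linarith
  have \<rho>0: "0 \<le> \<rho>"
    using psi_pos[OF x0] b(3)[OF x0] b(1) by (smt (verit) mult_nonneg_nonneg mult_neg_pos)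
  note int = bounded_measurable_integrable[OF _ m refl]
  define e where "e = (\<integral>x. \<psi> x \<partial>m)"
  define \<eta> where "\<eta> = (\<integral>x. h x \<partial>m)"
  define c where "c = \<eta> / e"
  have e: "0 < e" unfolding e_def
    using bounded_measurable_integral_ge[OF psi m refl b(2)] b(1) by linarith
  have ae: "a * e \<le> \<eta>"
    using integral_mono_bounded_measurable[OF bounded_measurable_cmult[OF psi, of a] h m refl a(2)]
    by (simp add: e_def \<eta>_def)
  have ce: "c * e = \<eta>" using e by (simp add: c_def)
  have ac: "a \<le> c" using ae e by (simp add: c_def le_divide_eq)
  define k where "k x = h x - c * \<psi> x" for x
  have BM_k: "bounded_measurable m k"
    unfolding k_def[abs_def] by (intro bounded_measurable_diff bounded_measurable_cmult psi h)
  have Ek: "(\<integral>x. k x \<partial>m) = 0"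
    unfolding k_def using int[OF h] int[OF psi] by (simp add: ce flip: e_def \<eta>_def)
  \<comment> \<open>c is the average of h/\<psi> with weight \<psi>, so no value of h/\<psi> exceeds
    it by more than the oscillation.\<close>
  have w_c: "h x / \<psi> x - c \<le> osc" if x: "x \<in> space m" for x
  proof -
    have "(\<integral>y. h x / \<psi> x * \<psi> y - h y \<partial>m) \<le> (\<integral>y. osc * \<psi> y \<partial>m)"
    proof (rule integral_mono_bounded_measurable[OF _ bounded_measurable_cmult[OF psi] m refl])
      show "bounded_measurable m (\<lambda>y. h x / \<psi> x * \<psi> y - h y)"
        by (intro bounded_measurable_diff bounded_measurable_cmult psi h)
      fix y assume y: "y \<in> space m"
      have "(h x / \<psi> x - h y / \<psi> y) * \<psi> y \<le> osc * \<psi> y"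
        using osc[OF x y] psi_pos[OF y] by (intro mult_right_mono) auto
      then show "h x / \<psi> x * \<psi> y - h y \<le> osc * \<psi> y"
        using psi_pos[OF y] by (simp add: left_diff_distrib)
    qed
    then have "h x / \<psi> x * e - \<eta> \<le> osc * e"
      using int[OF psi] int[OF h] by (simp add: e_def \<eta>_def)
    then have "(h x / \<psi> x - c) * e \<le> osc * e" by (simp add: left_diff_distrib ce)
    then show ?thesis using e by simp
  qed
  \<comment> \<open>The bound is to be linear in \<open>osc\<close>, with a factor 1/a later on.
    With w = h/\<psi>, one factor w - c of the square is replaced by w - a, which is nonnegative,
    and the other is bounded by \<open>osc\<close>. The price (c - a) k is kept exactly, since k has
    mean zero.\<close>
  have k2: "(k x)\<^sup>2 \<le> \<rho> * b * (osc * (h x - a * \<psi> x) - (c - a) * k x)" if x: "x \<in> space m" for x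
  proof -
    define w where "w = h x / \<psi> x"
    have h_w: "h x = w * \<psi> x" using psi_pos[OF x] by (simp add: w_def)
    have aw: "a \<le> w" using a(2)[OF x] psi_pos[OF x] by (simp add: w_def le_divide_eq)
    have "(k x)\<^sup>2 = \<psi> x * (\<psi> x * (w - c)\<^sup>2)"
      by (simp add: k_def h_w power2_eq_square algebra_simps)
    also have "\<dots> \<le> \<rho> * b * (\<psi> x * (w - c)\<^sup>2)"
      using b(3)[OF x] psi_pos[OF x] by (intro mult_right_mono) auto
    also have "\<psi> x * (w - c)\<^sup>2 = \<psi> x * ((w - c) * (w - a)) - (c - a) * k x"
      by (simp add: k_def h_w power2_eq_square algebra_simps)
    also have "\<rho> * b * (\<psi> x * ((w - c) * (w - a)) - (c - a) * k x) \<le> \<rho> * b * (osc * (h x - a * \<psi> x) - (c - a) * k x)"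
    proof (intro mult_left_mono diff_right_mono)
      have "\<psi> x * ((w - c) * (w - a)) \<le> \<psi> x * (osc * (w - a))"
        using w_c[OF x] aw psi_pos[OF x] unfolding w_def[symmetric]
        by (intro mult_left_mono mult_right_mono) auto
      then show "\<psi> x * ((w - c) * (w - a)) \<le> osc * (h x - a * \<psi> x)"
        by (simp add: h_w algebra_simps)
    qed (use \<rho>0 b(1) in auto)
    finally show ?thesis .
  qed
  have Ek2: "(\<integral>x. (k x)\<^sup>2 \<partial>m) \<le> \<rho> * b * (osc * (\<eta> - a * e))"
  proof -
    have "(\<integral>x. (k x)\<^sup>2 \<partial>m) \<le> (\<integral>x. \<rho> * b * (osc * (h x - a * \<psi> x) - (c - a) * k x) \<partial>m)"
      unfolding power2_eq_square
      by (rule integral_mono_bounded_measurable[OF bounded_measurable_mult[OF BM_k BM_k] _ m refl])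
        (use k2 in \<open>auto simp: power2_eq_square intro!: bounded_measurable_diff bounded_measurable_cmult psi h BM_k\<close>)
    also have "\<dots> = \<rho> * b * (osc * (\<eta> - a * e))"
      using int[OF h] int[OF psi] int[OF BM_k] by (simp add: Ek flip: e_def \<eta>_def)
    finally show ?thesis .
  qed
  define H where "H z = (\<Sum>i<N. h (z i))" for z :: "nat \<Rightarrow> 'x"
  define S where "S z = (\<Sum>i<N. \<psi> (z i))" for z :: "nat \<Rightarrow> 'x"
  define K where "K z = (\<Sum>i<N. k (z i))" for z :: "nat \<Rightarrow> 'x"
  have BM_HSK: "bounded_measurable ?P H" "bounded_measurable ?P S" "bounded_measurable ?P K"
    unfolding H_def[abs_def] S_def[abs_def] K_def[abs_def]
    by (intro bounded_measurable_sum bounded_measurable_component psi h BM_k; simp)+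
  have S_ge: "real N * b \<le> S z" if "z \<in> space ?P" for z
    using sum_bounded_below[of "{..<N}" b "\<lambda>i. \<psi> (z i)"] that b(2)
    by (auto simp: S_def space_PiM PiE_iff)
  have Nb: "0 < real N * b" using N b(1) by simp
  have int_sum: "(\<integral>z. (\<Sum>i<N. f (z i)) \<partial>?P) = real N * (\<integral>x. f x \<partial>m)" if f: "bounded_measurable m f" for f
    using integral_PiM_component[OF m _ _ int[OF f], of "{..<N}"]
    by (subst Bochner_Integration.integral_sum)
      (auto intro!: bounded_measurable_integrable[OF bounded_measurable_component[OF f, of _ "{..<N}"] PP])
  have ES: "(\<integral>z. S z \<partial>?P) = real N * e"
    unfolding S_def e_def by (rule int_sum[OF psi])
  have EK: "(\<integral>z. K z \<partial>?P) = 0"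
    unfolding K_def using int_sum[OF BM_k] Ek by simp
  have EK2: "(\<integral>z. (K z)\<^sup>2 \<partial>?P) = real N * (\<integral>x. (k x)\<^sup>2 \<partial>m)"
    unfolding K_def using second_moment_iid_sum[OF m BM_k _ Ek, of "{..<N}"] by simp
  \<comment> \<open>Only the quadratic term needs a lower bound on S in place of S; the other two
    have known means. The b introduced here cancels against the b in the variance bound, leaving
    \<rho>.\<close>
  have pointwise: "(H z)\<^sup>2 / S z \<le> c\<^sup>2 * S z + 2 * c * K z + (K z)\<^sup>2 / (real N * b)"
    if z: "z \<in> space ?P" for z
  proof -
    have S0: "0 < S z" using S_ge[OF z] Nb by linarith
    have H: "H z = c * S z + K z"
      by (simp add: H_def S_def K_def k_def sum_subtractf sum_distrib_left)
    have "(H z)\<^sup>2 / S z = c\<^sup>2 * S z + 2 * c * K z + (K z)\<^sup>2 / S z"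
      using S0 unfolding H by (simp add: field_simps power2_eq_square)
    also have "(K z)\<^sup>2 / S z \<le> (K z)\<^sup>2 / (real N * b)"
      using S_ge[OF z] Nb by (intro divide_left_mono) auto
    finally show ?thesis by simp
  qed
  have intP: "integrable ?P S" "integrable ?P K" "integrable ?P (\<lambda>z. (K z)\<^sup>2)"
    using BM_HSK by (auto intro!: bounded_measurable_integrable[OF _ PP refl] bounded_measurable_mult simp: power2_eq_square)
  have "(\<integral>z. (H z)\<^sup>2 / S z \<partial>?P) \<le> (\<integral>z. c\<^sup>2 * S z + 2 * c * K z + (K z)\<^sup>2 / (real N * b) \<partial>?P)"
  proof (rule integral_mono)
    show "integrable ?P (\<lambda>z. (H z)\<^sup>2 / S z)"
      unfolding power2_eq_square
      by (rule bounded_measurable_integrable[OF bounded_measurable_divide[OF bounded_measurable_mult[OF BM_HSK(1,1)] BM_HSK(2) Nb S_ge] PP refl])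
    show "integrable ?P (\<lambda>z. c\<^sup>2 * S z + 2 * c * K z + (K z)\<^sup>2 / (real N * b))"
      using intP by simp
  qed (rule pointwise)
  also have "\<dots> = c\<^sup>2 * (real N * e) + (\<integral>x. (k x)\<^sup>2 \<partial>m) / b"
    using intP N by (simp add: ES EK EK2)
  also have "\<dots> \<le> c\<^sup>2 * (real N * e) + \<rho> * (osc * (\<eta> - a * e))"
    using Ek2 b(1) by (simp add: divide_le_eq mult_ac)
  finally have "e * (\<integral>z. (H z)\<^sup>2 / S z \<partial>?P) / real N
      \<le> e * (c\<^sup>2 * (real N * e) + \<rho> * (osc * (\<eta> - a * e))) / real N"
    using e by (intro divide_right_mono mult_left_mono) auto
  also have "\<dots> = \<eta>\<^sup>2 + \<rho> / real N * osc * (e * (\<eta> - a * e))"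
  proof -
    have "e * (c\<^sup>2 * (real N * e) + x) / real N = (c * e)\<^sup>2 + e * x / real N" for x
      using N by (simp add: field_simps power2_eq_square)
    then show ?thesis unfolding ce by (simp add: mult_ac)
  qed
  \<comment> \<open>Since a e \<le> \<eta>, the factor e (\<eta> - a e) is at most \<eta>^2 / a;
    this makes the excess proportional to the main term \<eta>^2.\<close>
  also have "\<dots> \<le> \<eta>\<^sup>2 + \<rho> / real N * osc * (\<eta>\<^sup>2 / a)"
  proof (intro add_left_mono mult_left_mono)
    have "a * e * \<eta> \<le> \<eta> * \<eta>"
      using ae a(1) e by (intro mult_right_mono) (auto intro: order_trans[OF _ ae])
    moreover have "0 \<le> a * e * (a * e)" using a(1) e by simp
    moreover have "e * (\<eta> - a * e) * a = a * e * \<eta> - a * e * (a * e)"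
      by (simp add: algebra_simps)
    ultimately have "e * (\<eta> - a * e) * a \<le> \<eta>\<^sup>2"
      unfolding power2_eq_square by linarith
    then show "e * (\<eta> - a * e) \<le> \<eta>\<^sup>2 / a"
      using a(1) by (simp add: le_divide_eq)
  qed (use \<rho>0 osc0 in auto)
  also have "\<dots> = (1 + \<rho> / real N * (osc / a)) * \<eta>\<^sup>2"
    using a(1) by (simp add: algebra_simps)
  finally show ?thesis
    unfolding e_def \<eta>_def H_def S_def .
qed

subsection \<open>The particle system\<close>

context weighted_kernel
begin

lemma kernel_iter_cong:
  assumes K: "\<And>n x. x \<in> space S \<Longrightarrow> space (K n x) = space S"
    and "\<And>x. x \<in> space S \<Longrightarrow> g x = g' x" "x \<in> space S"
  shows "kernel_iter v K n g x = kernel_iter v K n g' x"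
  using assms(2,3)
proof (induction n arbitrary: g g')
  case (Suc n)
  show ?case
    unfolding kernel_iter.simps
  proof (rule Suc.IH[OF _ Suc.prems(2)])
    show "(\<integral>\<^sup>+y. v n x y * g y \<partial>K n x) = (\<integral>\<^sup>+y. v n x y * g' y \<partial>K n x)" if "x \<in> space S" for x
      using Suc.prems(1) that by (intro nn_integral_cong) (simp add: K)
  qed
qed simp

lemma L_nonneg: "\<omega> \<in> space W \<Longrightarrow> x \<in> space S \<Longrightarrow> BM f \<Longrightarrow> (\<And>y. y \<in> space S \<Longrightarrow> 0 \<le> f y) \<Longrightarrow> 0 \<le> L \<omega> f x"
  using L_mono[of \<omega> x "\<lambda>_. 0" f] by (simp add: L_def)

lemma T_nonneg:
  assumes "\<omega> \<in> space W" "x \<in> space S" "BM f" "\<And>y. y \<in> space S \<Longrightarrow> 0 \<le> f y"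
  shows "0 \<le> T n \<omega> f x"
  using T_mono[OF assms(1,2) _ assms(3), of "\<lambda>_. 0" n] assms(4) by (simp add: T_const)

lemma nn_integral_weighted:
  assumes \<omega>: "\<omega> \<in> space W" and x: "x \<in> space S" and f: "BM f" and nonneg: "\<And>y. y \<in> space S \<Longrightarrow> 0 \<le> f y"
  shows "(\<integral>\<^sup>+y. ennreal (w \<omega> x y) * ennreal (f y) \<partial>\<kappa> \<omega> x) = ennreal (L \<omega> f x)"
proof -
  have w0: "0 \<le> w \<omega> x y" if "y \<in> space S" for y
    using w_ge[OF \<omega> x that] wl_pos by simp
  have "(\<integral>\<^sup>+y. ennreal (w \<omega> x y) * ennreal (f y) \<partial>\<kappa> \<omega> x) = (\<integral>\<^sup>+y. ennreal (w \<omega> x y * f y) \<partial>\<kappa> \<omega> x)"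
    by (intro nn_integral_cong) (simp add: ennreal_mult space_\<kappa>[OF \<omega> x] w0 nonneg)
  also have "\<dots> = ennreal (L \<omega> f x)"
    unfolding L_def
    by (rule nn_integral_bounded_measurable[OF bounded_measurable_mult[OF w_section[OF \<omega> x] f] prob_\<kappa>[OF \<omega> x] sets_\<kappa>[OF \<omega> x]])
      (simp add: w0 nonneg)
  finally show ?thesis .
qed

text \<open>The two recursions peel off opposite ends of the product; splitting
  \<open>T (Suc n)\<close> as n steps followed by one reconciles them.\<close>

lemma kernel_iter_eq_T:
  assumes \<omega>: "\<omega> \<in> space W" and x: "x \<in> space S" and f: "BM f" and nonneg: "\<And>y. y \<in> space S \<Longrightarrow> 0 \<le> f y"
  shows "kernel_iter (\<lambda>p x y. ennreal (w ((\<tau> ^^ p) \<omega>) x y)) (\<lambda>p. \<kappa> ((\<tau> ^^ p) \<omega>)) n (\<lambda>y. ennreal (f y)) x =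
    ennreal (T n \<omega> f x)"
  using f nonneg
proof (induction n arbitrary: f)
  case (Suc n)
  have \<omega>n: "(\<tau> ^^ n) \<omega> \<in> space W" using \<omega> by (rule funpow_\<tau>_space)
  let ?k = "kernel_iter (\<lambda>p x y. ennreal (w ((\<tau> ^^ p) \<omega>) x y)) (\<lambda>p. \<kappa> ((\<tau> ^^ p) \<omega>))"
  have "?k (Suc n) (\<lambda>y. ennreal (f y)) x = ?k n (\<lambda>x. ennreal (L ((\<tau> ^^ n) \<omega>) f x)) x"
    unfolding kernel_iter.simps
  proof (rule kernel_iter_cong[OF _ _ x])
    show "space (\<kappa> ((\<tau> ^^ p) \<omega>) y) = space S" if "y \<in> space S" for p y
      using that by (intro space_\<kappa> funpow_\<tau>_space \<omega>)
  qed (rule nn_integral_weighted[OF \<omega>n _ Suc.prems])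
  also have "\<dots> = ennreal (T n \<omega> (L ((\<tau> ^^ n) \<omega>) f) x)"
    by (rule Suc.IH[OF BM_L[OF \<omega>n Suc.prems(1)]]) (rule L_nonneg[OF \<omega>n _ Suc.prems])
  also have "T n \<omega> (L ((\<tau> ^^ n) \<omega>) f) = T (Suc n) \<omega> f"
    using T_add[of n 1 \<omega> f] by simp
  finally show ?case .
qed simp

lemma integral_chain_law:
  assumes \<omega>: "\<omega> \<in> space W" and m: "prob_space m" "sets m = sets S"
  shows "(\<integral>\<zeta>. (\<Prod>p<n. w ((\<tau> ^^ p) \<omega>) (\<zeta> p) (\<zeta> (Suc p))) \<partial>chain_law S m (\<lambda>p. \<kappa> ((\<tau> ^^ p) \<omega>))) =
    (\<integral>x. U n \<omega> x \<partial>m)"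
proof -
  have \<omega>p: "(\<tau> ^^ p) \<omega> \<in> space W" for p using \<omega> by (rule funpow_\<tau>_space)
  have K: "\<kappa> ((\<tau> ^^ p) \<omega>) \<in> measurable S (prob_algebra S)" for p
    using measurable_compose[OF measurable_Pair1'[OF \<omega>p] \<kappa>_measurable] by simp
  have w_pair: "(\<lambda>(x, y). w ((\<tau> ^^ p) \<omega>) x y) \<in> borel_measurable (S \<Otimes>\<^sub>M S)" for p
  proof -
    have "(\<lambda>q. (((\<tau> ^^ p) \<omega>, fst q), snd q)) \<in> measurable (S \<Otimes>\<^sub>M S) ((W \<Otimes>\<^sub>M S) \<Otimes>\<^sub>M S)"
      using \<omega>p by measurable
    from measurable_compose[OF this w_measurable] show ?thesis by (simp add: split_beta')
  qed
  have w_pair': "(\<lambda>(x, y). ennreal (w ((\<tau> ^^ p) \<omega>) x y)) \<in> borel_measurable (S \<Otimes>\<^sub>M S)" for p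
    using measurable_compose[OF w_pair measurable_ennreal] by (simp add: split_beta')
  let ?C = "chain_law S m (\<lambda>p. \<kappa> ((\<tau> ^^ p) \<omega>))"
  have sets_C: "sets ?C = sets (PiM UNIV (\<lambda>_. S))"
    by (rule sets_chain_law[OF m K w_pair' borel_measurable_const])
  have space_C: "\<zeta> p \<in> space S" if "\<zeta> \<in> space ?C" for \<zeta> p
    using that sets_eq_imp_space_eq[OF sets_C] by (auto simp: space_PiM)
  have w0: "0 \<le> w ((\<tau> ^^ p) \<omega>) (\<zeta> p) (\<zeta> (Suc p))" if "\<zeta> \<in> space ?C" for \<zeta> p
    using w_ge[OF \<omega>p space_C[OF that] space_C[OF that]] wl_pos by (meson less_imp_le order_trans)
  have meas: "(\<lambda>\<zeta>. \<Prod>p<n. w ((\<tau> ^^ p) \<omega>) (\<zeta> p) (\<zeta> (Suc p))) \<in> borel_measurable ?C"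
    unfolding measurable_cong_sets[OF sets_C refl]
  proof (intro borel_measurable_prod)
    fix p
    have "(\<lambda>\<zeta>. (\<zeta> p, \<zeta> (Suc p))) \<in> measurable (PiM UNIV (\<lambda>_. S)) (S \<Otimes>\<^sub>M S)"
      by measurable
    from measurable_compose[OF this w_pair[of p]]
    show "(\<lambda>\<zeta>. w ((\<tau> ^^ p) \<omega>) (\<zeta> p) (\<zeta> (Suc p))) \<in> borel_measurable (PiM UNIV (\<lambda>_. S))" by simp
  qed
  have "(\<integral>\<^sup>+\<zeta>. ennreal (\<Prod>p<n. w ((\<tau> ^^ p) \<omega>) (\<zeta> p) (\<zeta> (Suc p))) \<partial>?C) =
      (\<integral>\<^sup>+\<zeta>. (\<Prod>p<n. ennreal (w ((\<tau> ^^ p) \<omega>) (\<zeta> p) (\<zeta> (Suc p)))) * ennreal 1 \<partial>?C)"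
    by (intro nn_integral_cong) (simp add: prod_ennreal w0)
  also have "\<dots> = (\<integral>\<^sup>+x. kernel_iter (\<lambda>p x y. ennreal (w ((\<tau> ^^ p) \<omega>) x y)) (\<lambda>p. \<kappa> ((\<tau> ^^ p) \<omega>)) n (\<lambda>_. ennreal 1) x \<partial>m)"
    by (rule nn_integral_chain_law(1)[OF m K w_pair']) simp
  also have "\<dots> = (\<integral>\<^sup>+x. ennreal (U n \<omega> x) \<partial>m)"
    unfolding U_def using sets_eq_imp_space_eq[OF m(2)]
    by (intro nn_integral_cong kernel_iter_eq_T[OF \<omega>]) simp_all
  also have "\<dots> = ennreal (\<integral>x. U n \<omega> x \<partial>m)"
    by (rule nn_integral_bounded_measurable[OF BM_U[OF \<omega>] m]) (rule less_imp_le[OF U_pos[OF \<omega>]])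
  finally have nn: "(\<integral>\<^sup>+\<zeta>. ennreal (\<Prod>p<n. w ((\<tau> ^^ p) \<omega>) (\<zeta> p) (\<zeta> (Suc p))) \<partial>?C) = ennreal (\<integral>x. U n \<omega> x \<partial>m)" .
  show ?thesis
    using w0 less_imp_le[OF integral_U_pos[OF \<omega> m, of n]]
    by (subst integral_eq_nn_integral[OF meas]) (auto simp: nn intro!: AE_I2 prod_nonneg)
qed

end

section \<open>The particle kernel, its twist, and their comparison with a product measure\<close>

lemma measurable_particle_mean:
  assumes f: "(\<lambda>(\<omega>, x). f \<omega> x) \<in> borel_measurable (W \<Otimes>\<^sub>M X)"
  shows "(\<lambda>(\<omega>, x). particle_mean N f \<omega> x) \<in> borel_measurable (W \<Otimes>\<^sub>M pow_space N X)"
proof -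
  have "(\<lambda>p. f (fst p) (snd p i)) \<in> borel_measurable (W \<Otimes>\<^sub>M pow_space N X)" if "i < N" for i
  proof -
    have "(\<lambda>p. (fst p, snd p i)) \<in> measurable (W \<Otimes>\<^sub>M pow_space N X) (W \<Otimes>\<^sub>M X)"
      using measurable_compose[OF measurable_snd measurable_component_singleton[of i "{..<N}" "\<lambda>_. X"]] that
      by (intro measurable_Pair measurable_fst) simp
    from measurable_compose[OF this f] show ?thesis by simp
  qed
  then show ?thesis
    unfolding particle_mean_def split_beta' by (intro borel_measurable_divide borel_measurable_sum) auto
qed

lemma particle_mean_bounds:
  assumes "0 < N" "x \<in> space (pow_space N X)" "\<And>y. y \<in> space X \<Longrightarrow> lo \<le> f \<omega> y" "\<And>y. y \<in> space X \<Longrightarrow> f \<omega> y \<le> hi"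
  shows "lo \<le> particle_mean N f \<omega> x" "particle_mean N f \<omega> x \<le> hi"
proof -
  have x: "x i \<in> space X" if "i < N" for i using assms(2) that by (auto simp: space_PiM)
  show "lo \<le> particle_mean N f \<omega> x" "particle_mean N f \<omega> x \<le> hi"
    using sum_bounded_below[of "{..<N}" lo "\<lambda>i. f \<omega> (x i)"] sum_bounded_above[of "{..<N}" "\<lambda>i. f \<omega> (x i)" hi]
      assms(1,3,4) x
    by (auto simp: particle_mean_def le_divide_eq divide_le_eq mult.commute)
qed

lemma env_shift_measurable [measurable]: "env_shift k \<in> measurable (env_space Y) (env_space Y)"
  unfolding env_shift_def env_space_def
  by (rule measurable_PiM_single') (auto simp: space_PiM PiE_iff intro!: measurable_component_singleton)

lemma env_shift_funpow_backward: "env_shift (- 1) ^^ n = env_shift (- int n)"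
  by (induction n) (auto simp: env_shift_def fun_eq_iff algebra_simps)

text \<open>The ratio bounds on \<open>G\<close> and \<psi> enter as absolute bounds gl, gu, pl, pu,
  which is what the abstract kernels consume; they are derived from the ratios and boundedness in
  the final theorem.\<close>

locale particle_model =
  fixes X :: "'x measure" and Y :: "'y measure"
    and M :: "(int \<Rightarrow> 'y) \<Rightarrow> 'x \<Rightarrow> 'x measure" and G \<psi> :: "(int \<Rightarrow> 'y) \<Rightarrow> 'x \<Rightarrow> real"
    and \<nu> :: "'x measure" and \<epsilon>m \<epsilon>p gl gu pl pu :: real and N :: nat
  assumes M: "(\<lambda>(\<omega>, x). M \<omega> x) \<in> measurable (env_space Y \<Otimes>\<^sub>M X) (prob_algebra X)"
    and G_measurable: "(\<lambda>(\<omega>, x). G \<omega> x) \<in> borel_measurable (env_space Y \<Otimes>\<^sub>M X)"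
    and psi_measurable: "(\<lambda>(\<omega>, x). \<psi> \<omega> x) \<in> borel_measurable (env_space Y \<Otimes>\<^sub>M X)"
    and eps: "0 < \<epsilon>m" "0 < \<epsilon>p"
    and nu: "prob_space \<nu>" "sets \<nu> = sets X"
    and M_ge: "\<And>\<omega> x A. \<omega> \<in> space (env_space Y) \<Longrightarrow> x \<in> space X \<Longrightarrow> A \<in> sets X \<Longrightarrow>
      ennreal \<epsilon>m * emeasure \<nu> A \<le> emeasure (M \<omega> x) A"
    and M_le: "\<And>\<omega> x A. \<omega> \<in> space (env_space Y) \<Longrightarrow> x \<in> space X \<Longrightarrow> A \<in> sets X \<Longrightarrow>
      emeasure (M \<omega> x) A \<le> ennreal \<epsilon>p * emeasure \<nu> A"
    and gl_pos: "0 < gl" and pl_pos: "0 < pl"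
    and G_ge: "\<And>\<omega> x. \<omega> \<in> space (env_space Y) \<Longrightarrow> x \<in> space X \<Longrightarrow> gl \<le> G \<omega> x"
    and G_le: "\<And>\<omega> x. \<omega> \<in> space (env_space Y) \<Longrightarrow> x \<in> space X \<Longrightarrow> G \<omega> x \<le> gu"
    and psi_ge: "\<And>\<omega> x. \<omega> \<in> space (env_space Y) \<Longrightarrow> x \<in> space X \<Longrightarrow> pl \<le> \<psi> \<omega> x"
    and psi_le: "\<And>\<omega> x. \<omega> \<in> space (env_space Y) \<Longrightarrow> x \<in> space X \<Longrightarrow> \<psi> \<omega> x \<le> pu"
    and N_pos: "0 < N"
    and env_nonempty: "space (env_space Y) \<noteq> {}"
begin

abbreviation "E \<equiv> env_space Y"
abbreviation "XN \<equiv> pow_space N X"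
abbreviation "mix \<equiv> mixture X G M N"
abbreviation "pk \<equiv> particle_kernel X G M N"
abbreviation "tk \<equiv> twisted_kernel X G M \<psi> N"
abbreviation "tn \<equiv> twist_norm X G M \<psi> N"
abbreviation "wt \<equiv> \<lambda>\<omega> x y. (particle_mean N G \<omega> x)\<^sup>2 * (phi X G M \<psi> N \<omega> x y)\<^sup>2"

lemma env_shift_space: "\<omega> \<in> space E \<Longrightarrow> env_shift k \<omega> \<in> space E"
  by (rule measurable_space[OF env_shift_measurable])

lemma space_nu: "space \<nu> = space X"
  using nu(2) by (rule sets_eq_imp_space_eq)

lemma X_nonempty: "\<exists>x. x \<in> space X"
  using prob_space.not_empty[OF nu(1)] space_nu by auto

lemma XN_component: "x \<in> space XN \<Longrightarrow> i < N \<Longrightarrow> x i \<in> space X"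
  by (auto simp: space_PiM)

lemma pu_pos: "0 < pu"
proof -
  obtain \<omega> x where "\<omega> \<in> space E" "x \<in> space X" using env_nonempty X_nonempty by blast
  from psi_ge[OF this] psi_le[OF this] pl_pos show "0 < pu" by linarith
qed

lemma psi_BM: "\<omega> \<in> space E \<Longrightarrow> bounded_measurable X (\<psi> \<omega>)"
proof (rule bounded_measurableI[where B = pu])
  assume \<omega>: "\<omega> \<in> space E"
  show "\<psi> \<omega> \<in> borel_measurable X"
    using measurable_compose[OF measurable_Pair1'[OF \<omega>] psi_measurable] by simp
  show "\<bar>\<psi> \<omega> x\<bar> \<le> pu" if "x \<in> space X" for x
    using psi_ge[OF \<omega> that] psi_le[OF \<omega> that] pl_pos by simp
qed

lemma prob_M: "\<omega> \<in> space E \<Longrightarrow> x \<in> space X \<Longrightarrow> prob_space (M \<omega> x)"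
  and sets_M: "\<omega> \<in> space E \<Longrightarrow> x \<in> space X \<Longrightarrow> sets (M \<omega> x) = sets X"
proof -
  assume "\<omega> \<in> space E" "x \<in> space X"
  then have "M \<omega> x \<in> space (prob_algebra X)"
    using measurable_space[OF M, of "(\<omega>, x)"] by (auto simp: space_pair_measure)
  then show "prob_space (M \<omega> x)" "sets (M \<omega> x) = sets X"
    by (simp_all add: space_prob_algebra)
qed

text \<open>The law of the index of a parent particle. With it the mixture becomes a kernel
  composition, and the general integration formula applies.\<close>

definition weights :: "(int \<Rightarrow> 'y) \<Rightarrow> (nat \<Rightarrow> 'x) \<Rightarrow> nat measure" where
  "weights \<omega> x = point_measure {..<N} (\<lambda>j. ennreal (G \<omega> (x j) / (\<Sum>j<N. G \<omega> (x j))))"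

context
  fixes \<omega> x
  assumes \<omega>: "\<omega> \<in> space E" and x: "x \<in> space XN"
begin

lemma G_component_pos: "j < N \<Longrightarrow> 0 < G \<omega> (x j)"
  using G_ge[OF \<omega> XN_component[OF x]] gl_pos by (meson less_le_trans)

lemma G_sum_pos: "0 < (\<Sum>j<N. G \<omega> (x j))"
  using N_pos by (intro sum_pos) (auto intro: G_component_pos)

lemma nn_integral_weights:
  "(\<integral>\<^sup>+j. f j \<partial>weights \<omega> x) = (\<Sum>j<N. ennreal (G \<omega> (x j)) * f j) / ennreal (\<Sum>j<N. G \<omega> (x j))"
proof -
  have "(\<integral>\<^sup>+j. f j \<partial>weights \<omega> x) = (\<Sum>j<N. ennreal (G \<omega> (x j) / (\<Sum>j<N. G \<omega> (x j))) * f j)"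
    unfolding weights_def by (subst nn_integral_point_measure_finite) (auto simp: mult.commute)
  also have "\<dots> = (\<Sum>j<N. ennreal (G \<omega> (x j)) * f j / ennreal (\<Sum>j<N. G \<omega> (x j)))"
  proof (rule sum.cong[OF refl])
    fix j assume "j \<in> {..<N}"
    then have "ennreal (G \<omega> (x j) / (\<Sum>j<N. G \<omega> (x j))) = ennreal (G \<omega> (x j)) / ennreal (\<Sum>j<N. G \<omega> (x j))"
      using G_sum_pos G_component_pos[of j] by (intro divide_ennreal[symmetric]) auto
    then show "ennreal (G \<omega> (x j) / (\<Sum>j<N. G \<omega> (x j))) * f j = ennreal (G \<omega> (x j)) * f j / ennreal (\<Sum>j<N. G \<omega> (x j))"
      by (simp add: ennreal_times_divide[symmetric] divide_ennreal_def mult_ac)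
  qed
  finally show ?thesis
    by (simp add: divide_ennreal_def sum_distrib_right)
qed

lemma weights_prob: "emeasure (weights \<omega> x) (space (weights \<omega> x)) = 1"
proof -
  have "emeasure (weights \<omega> x) (space (weights \<omega> x)) = (\<integral>\<^sup>+j. 1 \<partial>weights \<omega> x)" by simp
  also have "\<dots> = ennreal (\<Sum>j<N. G \<omega> (x j)) / ennreal (\<Sum>j<N. G \<omega> (x j))"
    unfolding nn_integral_weights mult_1_right using less_imp_le[OF G_component_pos] by (subst sum_ennreal) simp_all
  also have "\<dots> = 1"
    using G_sum_pos by (intro ennreal_divide_self) auto
  finally show ?thesis .
qed

lemma mixture_eq: "mix \<omega> x = kernel_comp X (weights \<omega> x) (\<lambda>j. M \<omega> (x j))"
  unfolding mixture_def kernel_comp_def nn_integral_weights ..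

lemma weights_kernel:
  "j \<in> space (weights \<omega> x) \<Longrightarrow> sets (M \<omega> (x j)) = sets X"
  "A \<in> sets X \<Longrightarrow> (\<lambda>j. emeasure (M \<omega> (x j)) A) \<in> borel_measurable (weights \<omega> x)"
  using sets_M[OF \<omega> XN_component[OF x]] by (auto simp: weights_def space_point_measure)

lemma sets_mixture: "sets (mix \<omega> x) = sets X" and space_mixture: "space (mix \<omega> x) = space X"
  and emeasure_mixture: "A \<in> sets X \<Longrightarrow> emeasure (mix \<omega> x) A = (\<integral>\<^sup>+j. emeasure (M \<omega> (x j)) A \<partial>weights \<omega> x)"
  unfolding mixture_eq
  by (rule sets_kernel_comp[OF weights_kernel] space_kernel_comp[OF weights_kernel]
      emeasure_kernel_comp[OF weights_kernel]; assumption)+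

lemma nn_integral_mixture:
  "f \<in> borel_measurable X \<Longrightarrow> (\<integral>\<^sup>+y. f y \<partial>mix \<omega> x) = (\<integral>\<^sup>+j. \<integral>\<^sup>+y. f y \<partial>M \<omega> (x j) \<partial>weights \<omega> x)"
  unfolding mixture_eq by (rule nn_integral_kernel_comp[OF weights_kernel]; assumption)

lemma mixture_ge: "A \<in> sets X \<Longrightarrow> ennreal \<epsilon>m * emeasure \<nu> A \<le> emeasure (mix \<omega> x) A"
  and mixture_le: "A \<in> sets X \<Longrightarrow> emeasure (mix \<omega> x) A \<le> ennreal \<epsilon>p * emeasure \<nu> A"
proof -
  assume A: "A \<in> sets X"
  have c: "(\<integral>\<^sup>+j. c \<partial>weights \<omega> x) = c" for c by (simp add: weights_prob)
  have "(\<integral>\<^sup>+j. ennreal \<epsilon>m * emeasure \<nu> A \<partial>weights \<omega> x) \<le> emeasure (mix \<omega> x) A"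
    unfolding emeasure_mixture[OF A]
    by (intro nn_integral_mono M_ge[OF \<omega> XN_component[OF x] A]) (simp add: weights_def space_point_measure)
  then show "ennreal \<epsilon>m * emeasure \<nu> A \<le> emeasure (mix \<omega> x) A" by (simp only: c)
  have "emeasure (mix \<omega> x) A \<le> (\<integral>\<^sup>+j. ennreal \<epsilon>p * emeasure \<nu> A \<partial>weights \<omega> x)"
    unfolding emeasure_mixture[OF A]
    by (intro nn_integral_mono M_le[OF \<omega> XN_component[OF x] A]) (simp add: weights_def space_point_measure)
  then show "emeasure (mix \<omega> x) A \<le> ennreal \<epsilon>p * emeasure \<nu> A" by (simp only: c)
qed

lemma prob_mixture: "prob_space (mix \<omega> x)"
proof
  have "emeasure (mix \<omega> x) (space (mix \<omega> x)) = (\<integral>\<^sup>+j. emeasure (M \<omega> (x j)) (space X) \<partial>weights \<omega> x)"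
    unfolding space_mixture by (rule emeasure_mixture) simp
  also have "\<dots> = (\<integral>\<^sup>+j. 1 \<partial>weights \<omega> x)"
  proof (rule nn_integral_cong)
    fix j assume "j \<in> space (weights \<omega> x)"
    then have "x j \<in> space X" using XN_component[OF x] by (simp add: weights_def space_point_measure)
    then show "emeasure (M \<omega> (x j)) (space X) = 1"
      using prob_space.emeasure_space_1[OF prob_M[OF \<omega>]] sets_eq_imp_space_eq[OF sets_M[OF \<omega>]] by metis
  qed
  finally show "emeasure (mix \<omega> x) (space (mix \<omega> x)) = 1" by (simp add: weights_prob)
qed

lemma integral_mixture:
  assumes f: "bounded_measurable X f" and nonneg: "\<And>y. y \<in> space X \<Longrightarrow> 0 \<le> f y"
  shows "(\<integral>y. f y \<partial>mix \<omega> x) = (\<Sum>j<N. G \<omega> (x j) * (\<integral>y. f y \<partial>M \<omega> (x j))) / (\<Sum>j<N. G \<omega> (x j))"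
proof -
  have f': "(\<lambda>y. ennreal (f y)) \<in> borel_measurable X"
    using measurable_compose[OF bounded_measurableD[OF f] measurable_ennreal] .
  have I0: "0 \<le> (\<integral>y. f y \<partial>M \<omega> (x j))" if "j < N" for j
    using XN_component[OF x that]
    by (intro bounded_measurable_integral_ge[OF f prob_M[OF \<omega>] sets_M[OF \<omega>] nonneg])
  have "ennreal (\<integral>y. f y \<partial>mix \<omega> x) = (\<integral>\<^sup>+y. ennreal (f y) \<partial>mix \<omega> x)"
    by (rule nn_integral_bounded_measurable[OF f prob_mixture sets_mixture nonneg, symmetric])
  also have "\<dots> = (\<Sum>j<N. ennreal (G \<omega> (x j)) * (\<integral>\<^sup>+y. ennreal (f y) \<partial>M \<omega> (x j))) / ennreal (\<Sum>j<N. G \<omega> (x j))"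
    unfolding nn_integral_mixture[OF f'] nn_integral_weights ..
  also have "(\<Sum>j<N. ennreal (G \<omega> (x j)) * (\<integral>\<^sup>+y. ennreal (f y) \<partial>M \<omega> (x j))) =
      (\<Sum>j<N. ennreal (G \<omega> (x j) * (\<integral>y. f y \<partial>M \<omega> (x j))))"
  proof (rule sum.cong[OF refl])
    fix j assume "j \<in> {..<N}"
    then have j: "j < N" by simp
    show "ennreal (G \<omega> (x j)) * (\<integral>\<^sup>+y. ennreal (f y) \<partial>M \<omega> (x j)) = ennreal (G \<omega> (x j) * (\<integral>y. f y \<partial>M \<omega> (x j)))"
      using XN_component[OF x j] less_imp_le[OF G_component_pos[OF j]] I0[OF j]
      by (simp add: nn_integral_bounded_measurable[OF f prob_M[OF \<omega>] sets_M[OF \<omega>] nonneg] ennreal_mult)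
  qed
  also have "\<dots> = ennreal (\<Sum>j<N. G \<omega> (x j) * (\<integral>y. f y \<partial>M \<omega> (x j)))"
    using I0 less_imp_le[OF G_component_pos] by (intro sum_ennreal) simp
  also have "\<dots> / ennreal (\<Sum>j<N. G \<omega> (x j)) =
      ennreal ((\<Sum>j<N. G \<omega> (x j) * (\<integral>y. f y \<partial>M \<omega> (x j))) / (\<Sum>j<N. G \<omega> (x j)))"
    using I0 less_imp_le[OF G_component_pos] G_sum_pos by (intro divide_ennreal sum_nonneg) simp_all
  finally show ?thesis
  proof (rule ennreal_inj[THEN iffD1, rotated 2])
    show "0 \<le> (\<integral>y. f y \<partial>mix \<omega> x)"
      by (rule bounded_measurable_integral_ge[OF f prob_mixture sets_mixture nonneg])
    show "0 \<le> (\<Sum>j<N. G \<omega> (x j) * (\<integral>y. f y \<partial>M \<omega> (x j))) / (\<Sum>j<N. G \<omega> (x j))"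
      using I0 less_imp_le[OF G_component_pos] G_sum_pos by (intro divide_nonneg_pos sum_nonneg) simp_all
  qed
qed

lemma prob_pk: "prob_space (pk \<omega> x)"
  unfolding particle_kernel_def by (intro prob_space_PiM prob_mixture)

lemma sets_pk: "sets (pk \<omega> x) = sets XN"
  unfolding particle_kernel_def by (rule sets_PiM_cong) (simp_all add: sets_mixture)

lemma space_pk: "space (pk \<omega> x) = space XN"
  using sets_pk by (rule sets_eq_imp_space_eq)

lemma pk_le: "A \<in> sets XN \<Longrightarrow> emeasure (pk \<omega> x) A \<le> ennreal (\<epsilon>p ^ N) * emeasure (PiM {..<N} (\<lambda>_. \<nu>)) A"
  and pk_ge: "A \<in> sets XN \<Longrightarrow> ennreal (\<epsilon>m ^ N) * emeasure (PiM {..<N} (\<lambda>_. \<nu>)) A \<le> emeasure (pk \<omega> x) A"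
proof -
  assume A: "A \<in> sets XN"
  have sets_nuN: "sets (PiM {..<N} (\<lambda>_. \<nu>)) = sets XN"
    by (rule sets_PiM_cong) (simp_all add: nu)
  have "emeasure (pk \<omega> x) A \<le> ennreal \<epsilon>p ^ card {..<N} * emeasure (PiM {..<N} (\<lambda>_. \<nu>)) A"
    unfolding particle_kernel_def
    by (rule emeasure_PiM_kernel_bound[OF prob_mixture nu(1)]) (use A sets_nuN in \<open>simp_all add: sets_mixture nu mixture_le\<close>)
  then show "emeasure (pk \<omega> x) A \<le> ennreal (\<epsilon>p ^ N) * emeasure (PiM {..<N} (\<lambda>_. \<nu>)) A"
    using eps by (simp add: ennreal_power)
  \<comment> \<open>As for a single factor, the lower bound comes from the upper bound for products
    with the measures exchanged and the constant 1 / \<epsilon>m.\<close>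
  have "emeasure (PiM {..<N} (\<lambda>_. \<nu>)) A \<le> ennreal (1 / \<epsilon>m) ^ card {..<N} * emeasure (pk \<omega> x) A"
    unfolding particle_kernel_def
  proof (rule emeasure_PiM_kernel_bound[OF nu(1) prob_mixture])
    show "A \<in> sets (PiM {..<N} (\<lambda>_. mix \<omega> x))" using A sets_pk by (simp add: particle_kernel_def)
    fix B assume "B \<in> sets (mix \<omega> x)"
    then have "ennreal (1 / \<epsilon>m) * (ennreal \<epsilon>m * emeasure \<nu> B) \<le> ennreal (1 / \<epsilon>m) * emeasure (mix \<omega> x) B"
      by (intro mult_left_mono mixture_ge) (simp_all add: sets_mixture)
    then show "emeasure \<nu> B \<le> ennreal (1 / \<epsilon>m) * emeasure (mix \<omega> x) B"
      using eps by (simp add: mult.assoc[symmetric] ennreal_mult[symmetric])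
  qed (simp_all add: nu sets_mixture)
  then have "ennreal (\<epsilon>m ^ N) * emeasure (PiM {..<N} (\<lambda>_. \<nu>)) A
      \<le> ennreal (\<epsilon>m ^ N) * (ennreal ((1 / \<epsilon>m) ^ N) * emeasure (pk \<omega> x) A)"
    using eps by (intro mult_left_mono) (simp_all add: ennreal_power)
  also have "\<dots> = emeasure (pk \<omega> x) A"
    using eps by (simp add: mult.assoc[symmetric] ennreal_mult[symmetric] power_mult_distrib[symmetric])
  finally show "ennreal (\<epsilon>m ^ N) * emeasure (PiM {..<N} (\<lambda>_. \<nu>)) A \<le> emeasure (pk \<omega> x) A" .
qed

end

lemma psi_mean_bounds:
  assumes "\<omega> \<in> space E" "z \<in> space XN"
  shows "pl \<le> particle_mean N \<psi> \<omega> z" "particle_mean N \<psi> \<omega> z \<le> pu"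
  by (rule particle_mean_bounds[where N = N and X = X and f = \<psi> and \<omega> = \<omega>, OF N_pos assms(2) psi_ge[OF assms(1)] psi_le[OF assms(1)]]; assumption)+

lemma G_mean_bounds:
  assumes "\<omega> \<in> space E" "z \<in> space XN"
  shows "gl \<le> particle_mean N G \<omega> z" "particle_mean N G \<omega> z \<le> gu"
  by (rule particle_mean_bounds[where N = N and X = X and f = G and \<omega> = \<omega>, OF N_pos assms(2) G_ge[OF assms(1)] G_le[OF assms(1)]]; assumption)+

lemma particle_mean_BM: "bounded_measurable X (f \<omega>) \<Longrightarrow> bounded_measurable XN (particle_mean N f \<omega>)"
  unfolding particle_mean_def[abs_def] divide_inverse
  by (rule bounded_measurable_mult, rule bounded_measurable_sum, rule bounded_measurable_component) auto

lemma mixture_measurable: "(\<lambda>(\<omega>, x). mix \<omega> x) \<in> measurable (E \<Otimes>\<^sub>M XN) (prob_algebra X)"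
proof (intro measurable_prob_algebraI measurable_subprob_algebra)
  fix p assume "p \<in> space (E \<Otimes>\<^sub>M XN)"
  then obtain \<omega> x where p: "p = (\<omega>, x)" "\<omega> \<in> space E" "x \<in> space XN"
    by (auto simp: space_pair_measure)
  show prob: "prob_space (case p of (\<omega>, x) \<Rightarrow> mix \<omega> x)"
    unfolding p(1) prod.case by (rule prob_mixture[OF p(2,3)])
  then show "subprob_space (case p of (\<omega>, x) \<Rightarrow> mix \<omega> x)" by (rule prob_space_imp_subprob_space)
  show "sets (case p of (\<omega>, x) \<Rightarrow> mix \<omega> x) = sets X"
    unfolding p(1) prod.case by (rule sets_mixture[OF p(2,3)])
next
  fix A assume A: "A \<in> sets X"
  have pair: "(\<lambda>p. (fst p, snd p j)) \<in> measurable (E \<Otimes>\<^sub>M XN) (E \<Otimes>\<^sub>M X)" if "j < N" for j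
    using measurable_compose[OF measurable_snd measurable_component_singleton[of j "{..<N}" "\<lambda>_. X"]] that
    by (intro measurable_Pair measurable_fst) simp
  have Gm: "(\<lambda>p. G (fst p) (snd p j)) \<in> borel_measurable (E \<Otimes>\<^sub>M XN)" if "j < N" for j
    using measurable_compose[OF pair[OF that] G_measurable] by simp
  have M_A: "(\<lambda>q. emeasure (case q of (\<omega>, x) \<Rightarrow> M \<omega> x) A) \<in> borel_measurable (E \<Otimes>\<^sub>M X)"
    by (rule measurable_emeasure_kernel[OF measurable_prob_algebraD[OF M] A])
  have Mm: "(\<lambda>p. emeasure (M (fst p) (snd p j)) A) \<in> borel_measurable (E \<Otimes>\<^sub>M XN)" if "j < N" for j
    using measurable_compose[OF pair[OF that] M_A] by (simp add: split_beta')
  have "(\<lambda>p. (\<Sum>j<N. ennreal (G (fst p) (snd p j)) * emeasure (M (fst p) (snd p j)) A) / ennreal (\<Sum>j<N. G (fst p) (snd p j)))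
      \<in> borel_measurable (E \<Otimes>\<^sub>M XN)"
    using Gm Mm
    by (intro borel_measurable_divide_ennreal borel_measurable_sum borel_measurable_times_ennreal
        measurable_compose[OF _ measurable_ennreal]) auto
  moreover have "emeasure (case p of (\<omega>, x) \<Rightarrow> mix \<omega> x) A =
      (\<Sum>j<N. ennreal (G (fst p) (snd p j)) * emeasure (M (fst p) (snd p j)) A) / ennreal (\<Sum>j<N. G (fst p) (snd p j))"
    if "p \<in> space (E \<Otimes>\<^sub>M XN)" for p
    using that A by (auto simp: space_pair_measure emeasure_mixture nn_integral_weights)
  ultimately show "(\<lambda>p. emeasure (case p of (\<omega>, x) \<Rightarrow> mix \<omega> x) A) \<in> borel_measurable (E \<Otimes>\<^sub>M XN)"
    by (rule measurable_cong[THEN iffD2, rotated])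
qed

lemma pk_measurable: "(\<lambda>(\<omega>, x). pk \<omega> x) \<in> measurable (E \<Otimes>\<^sub>M XN) (prob_algebra XN)"
  using measurable_PiM_prob_algebra[OF _ mixture_measurable, of "{..<N}"]
  by (simp add: particle_kernel_def split_beta')

lemma psi_shift_measurable: "(\<lambda>(\<omega>, z). particle_mean N \<psi> (env_shift 1 \<omega>) z) \<in> borel_measurable (E \<Otimes>\<^sub>M XN)"
proof -
  have "(\<lambda>p. (env_shift 1 (fst p), snd p)) \<in> measurable (E \<Otimes>\<^sub>M XN) (E \<Otimes>\<^sub>M XN)"
    by measurable
  from measurable_compose[OF this measurable_particle_mean[OF psi_measurable]] show ?thesis
    by (simp add: split_beta')
qed

lemma psi_shift_measurable2:
  "(\<lambda>(p, z). particle_mean N \<psi> (env_shift 1 (fst p)) z) \<in> borel_measurable ((E \<Otimes>\<^sub>M XN) \<Otimes>\<^sub>M XN)"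
proof -
  have "(\<lambda>q. (fst (fst q), snd q)) \<in> measurable ((E \<Otimes>\<^sub>M XN) \<Otimes>\<^sub>M XN) (E \<Otimes>\<^sub>M XN)"
    by measurable
  from measurable_compose[OF this psi_shift_measurable] show ?thesis
    by (simp add: split_beta')
qed

lemma tn_measurable: "(\<lambda>(\<omega>, x). tn \<omega> x) \<in> borel_measurable (E \<Otimes>\<^sub>M XN)"
proof -
  have "(\<lambda>p. pk (fst p) (snd p)) \<in> measurable (E \<Otimes>\<^sub>M XN) (subprob_algebra XN)"
    using measurable_prob_algebraD[OF pk_measurable] by (simp add: split_beta')
  from measurable_lebesgue_integral_kernel[OF psi_shift_measurable2 this] show ?thesis
    by (simp add: twist_norm_def split_beta')
qed

lemma psi_mean_BM: "\<omega> \<in> space E \<Longrightarrow> bounded_measurable XN (particle_mean N \<psi> \<omega>)"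
  by (intro particle_mean_BM psi_BM)

lemma tn_bounds:
  assumes \<omega>: "\<omega> \<in> space E" and x: "x \<in> space XN"
  shows "pl \<le> tn \<omega> x" "tn \<omega> x \<le> pu" "0 < tn \<omega> x"
proof -
  have \<omega>': "env_shift 1 \<omega> \<in> space E" using \<omega> by (rule env_shift_space)
  show "pl \<le> tn \<omega> x" "tn \<omega> x \<le> pu" unfolding twist_norm_def
    by (rule bounded_measurable_integral_ge[OF psi_mean_BM[OF \<omega>'] prob_pk[OF \<omega> x] sets_pk[OF \<omega> x] psi_mean_bounds(1)[OF \<omega>']]
        bounded_measurable_integral_le[OF psi_mean_BM[OF \<omega>'] prob_pk[OF \<omega> x] sets_pk[OF \<omega> x] psi_mean_bounds(2)[OF \<omega>']]; assumption)+
  then show "0 < tn \<omega> x" using pl_pos by simp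
qed

text \<open>All particles have the law \<open>mix \<omega> x\<close>, so the mean of the average is
  the mean for one particle; it plays the part of the \<psi>-integral in
  \<open>second_moment_ratio\<close>.\<close>

lemma tn_eq_mixture:
  assumes \<omega>: "\<omega> \<in> space E" and x: "x \<in> space XN"
  shows "tn \<omega> x = (\<integral>y. \<psi> (env_shift 1 \<omega>) y \<partial>mix \<omega> x)"
proof -
  have \<omega>': "env_shift 1 \<omega> \<in> space E" using \<omega> by (rule env_shift_space)
  note mix = prob_mixture[OF \<omega> x] sets_mixture[OF \<omega> x]
  have int: "integrable (mix \<omega> x) (\<psi> (env_shift 1 \<omega>))"
    by (rule bounded_measurable_integrable[OF psi_BM[OF \<omega>'] mix])
  have intP: "integrable (pk \<omega> x) (\<lambda>z. \<psi> (env_shift 1 \<omega>) (z i))" if "i < N" for i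
    using bounded_measurable_integrable[OF bounded_measurable_component[OF psi_BM[OF \<omega>'], of i "{..<N}"]
        prob_pk[OF \<omega> x] sets_pk[OF \<omega> x]] that by simp
  have "tn \<omega> x = (\<Sum>i<N. \<integral>z. \<psi> (env_shift 1 \<omega>) (z i) \<partial>pk \<omega> x) / real N"
    unfolding twist_norm_def particle_mean_def using intP
    by (simp add: Bochner_Integration.integral_sum)
  also have "\<dots> = (\<integral>y. \<psi> (env_shift 1 \<omega>) y \<partial>mix \<omega> x)"
    using integral_PiM_component[OF mix(1) _ _ int, of "{..<N}"] N_pos
    by (simp add: particle_kernel_def)
  finally show ?thesis .
qed

text \<open>The twist density and \<open>phi\<close> are reciprocal, and both numerator and
  denominator lie between pl and pu; the bounds are therefore the same for both.\<close>

lemma twist_ratio_bounds: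
  assumes \<omega>: "\<omega> \<in> space E" and x: "x \<in> space XN" and z: "z \<in> space XN"
  shows "pl / pu \<le> particle_mean N \<psi> (env_shift 1 \<omega>) z / tn \<omega> x"
    "particle_mean N \<psi> (env_shift 1 \<omega>) z / tn \<omega> x \<le> pu / pl"
    "pl / pu \<le> phi X G M \<psi> N \<omega> x z" "phi X G M \<psi> N \<omega> x z \<le> pu / pl"
  using tn_bounds[OF \<omega> x] psi_mean_bounds[OF env_shift_space[OF \<omega>, of 1] z] pl_pos pu_pos
  unfolding phi_def by (auto intro!: frac_le)

lemma twist_density_measurable:
  "(\<lambda>(p, z). ennreal (particle_mean N \<psi> (env_shift 1 (fst p)) z / tn (fst p) (snd p)))
    \<in> borel_measurable ((E \<Otimes>\<^sub>M XN) \<Otimes>\<^sub>M XN)"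
proof -
  have "(\<lambda>q. tn (fst (fst q)) (snd (fst q))) \<in> borel_measurable ((E \<Otimes>\<^sub>M XN) \<Otimes>\<^sub>M XN)"
    using measurable_compose[OF measurable_fst tn_measurable] by (simp add: split_beta')
  then show ?thesis
    using psi_shift_measurable2 unfolding split_beta'
    by (intro measurable_compose[OF _ measurable_ennreal] borel_measurable_divide)
qed

lemma twist_density_section:
  assumes \<omega>: "\<omega> \<in> space E"
  shows "(\<lambda>z. particle_mean N \<psi> (env_shift 1 \<omega>) z / tn \<omega> x) \<in> borel_measurable XN"
  using bounded_measurableD[OF psi_mean_BM[OF env_shift_space[OF \<omega>, of 1]]] by simp

lemma
  assumes \<omega>: "\<omega> \<in> space E" and x: "x \<in> space XN"
  shows sets_tk: "sets (tk \<omega> x) = sets XN"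
    and emeasure_tk: "A \<in> sets XN \<Longrightarrow> emeasure (tk \<omega> x) A =
      (\<integral>\<^sup>+z. ennreal (particle_mean N \<psi> (env_shift 1 \<omega>) z / tn \<omega> x) * indicator A z \<partial>pk \<omega> x)"
    and prob_tk: "prob_space (tk \<omega> x)"
    and integral_tk: "f \<in> borel_measurable XN \<Longrightarrow>
      (\<integral>z. f z \<partial>tk \<omega> x) = (\<integral>z. particle_mean N \<psi> (env_shift 1 \<omega>) z / tn \<omega> x * f z \<partial>pk \<omega> x)"
proof -
  have \<omega>': "env_shift 1 \<omega> \<in> space E" using \<omega> by (rule env_shift_space)
  note cong = measurable_cong_sets[OF sets_pk[OF \<omega> x] refl]
  have dens: "(\<lambda>z. particle_mean N \<psi> (env_shift 1 \<omega>) z / tn \<omega> x) \<in> borel_measurable (pk \<omega> x)"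
    unfolding cong by (rule twist_density_section[OF \<omega>])
  have dens': "(\<lambda>z. ennreal (particle_mean N \<psi> (env_shift 1 \<omega>) z / tn \<omega> x)) \<in> borel_measurable (pk \<omega> x)"
    by (rule measurable_compose[OF dens measurable_ennreal])
  have dens0: "0 \<le> particle_mean N \<psi> (env_shift 1 \<omega>) z / tn \<omega> x" if "z \<in> space XN" for z
    using twist_ratio_bounds(1)[OF \<omega> x that] pl_pos pu_pos by (meson divide_pos_pos less_imp_le less_le_trans)
  show "sets (tk \<omega> x) = sets XN" by (simp add: twisted_kernel_def sets_pk[OF \<omega> x])
  show em: "emeasure (tk \<omega> x) A =
      (\<integral>\<^sup>+z. ennreal (particle_mean N \<psi> (env_shift 1 \<omega>) z / tn \<omega> x) * indicator A z \<partial>pk \<omega> x)" if "A \<in> sets XN" for A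
    unfolding twisted_kernel_def using dens' that by (intro emeasure_density) (simp_all add: sets_pk[OF \<omega> x])
  show "(\<integral>z. f z \<partial>tk \<omega> x) = (\<integral>z. particle_mean N \<psi> (env_shift 1 \<omega>) z / tn \<omega> x * f z \<partial>pk \<omega> x)"
    if "f \<in> borel_measurable XN" for f :: "_ \<Rightarrow> real"
    unfolding twisted_kernel_def using dens dens0 that
    by (intro integral_real_density) (auto simp: cong space_pk[OF \<omega> x] intro!: AE_I2)
  show "prob_space (tk \<omega> x)"
  proof
    have sp: "space (tk \<omega> x) = space XN" by (simp add: twisted_kernel_def space_pk[OF \<omega> x])
    have BM: "bounded_measurable XN (\<lambda>z. particle_mean N \<psi> (env_shift 1 \<omega>) z / tn \<omega> x)"
      unfolding divide_inverse by (intro bounded_measurable_mult psi_mean_BM[OF \<omega>']) simp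
    have "emeasure (tk \<omega> x) (space XN) = (\<integral>\<^sup>+z. ennreal (particle_mean N \<psi> (env_shift 1 \<omega>) z / tn \<omega> x) \<partial>pk \<omega> x)"
      unfolding em[OF sets.top] by (intro nn_integral_cong) (simp add: space_pk[OF \<omega> x])
    also have "\<dots> = ennreal (\<integral>z. particle_mean N \<psi> (env_shift 1 \<omega>) z / tn \<omega> x \<partial>pk \<omega> x)"
      by (rule nn_integral_bounded_measurable[OF BM prob_pk[OF \<omega> x] sets_pk[OF \<omega> x] dens0])
    also have "\<dots> = 1"
      using tn_bounds(3)[OF \<omega> x] by (simp flip: twist_norm_def)
    finally show "emeasure (tk \<omega> x) (space (tk \<omega> x)) = 1" by (simp add: sp)
  qed
qed

lemma tk_measurable: "(\<lambda>(\<omega>, x). tk \<omega> x) \<in> measurable (E \<Otimes>\<^sub>M XN) (prob_algebra XN)"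
proof (intro measurable_prob_algebraI measurable_subprob_algebra)
  fix p assume "p \<in> space (E \<Otimes>\<^sub>M XN)"
  then obtain \<omega> x where p: "p = (\<omega>, x)" "\<omega> \<in> space E" "x \<in> space XN"
    by (auto simp: space_pair_measure)
  show prob: "prob_space (case p of (\<omega>, x) \<Rightarrow> tk \<omega> x)"
    unfolding p(1) prod.case by (rule prob_tk[OF p(2,3)])
  then show "subprob_space (case p of (\<omega>, x) \<Rightarrow> tk \<omega> x)" by (rule prob_space_imp_subprob_space)
  show "sets (case p of (\<omega>, x) \<Rightarrow> tk \<omega> x) = sets XN"
    unfolding p(1) prod.case by (rule sets_tk[OF p(2,3)])
next
  fix A assume A [measurable]: "A \<in> sets XN"
  have K: "(\<lambda>p. pk (fst p) (snd p)) \<in> measurable (E \<Otimes>\<^sub>M XN) (subprob_algebra XN)"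
    using measurable_prob_algebraD[OF pk_measurable] by (simp add: split_beta')
  have ind: "(\<lambda>q. indicator A (snd q) :: ennreal) \<in> borel_measurable ((E \<Otimes>\<^sub>M XN) \<Otimes>\<^sub>M XN)"
    by measurable
  have "(\<lambda>(p, z). ennreal (particle_mean N \<psi> (env_shift 1 (fst p)) z / tn (fst p) (snd p)) * indicator A z)
      \<in> borel_measurable ((E \<Otimes>\<^sub>M XN) \<Otimes>\<^sub>M XN)"
    using twist_density_measurable ind unfolding split_beta' by (intro borel_measurable_times_ennreal)
  from nn_integral_measurable_subprob_algebra2[OF this K]
  have "(\<lambda>p. \<integral>\<^sup>+z. ennreal (particle_mean N \<psi> (env_shift 1 (fst p)) z / tn (fst p) (snd p)) * indicator A z \<partial>pk (fst p) (snd p))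
      \<in> borel_measurable (E \<Otimes>\<^sub>M XN)" .
  moreover have "emeasure (case p of (\<omega>, x) \<Rightarrow> tk \<omega> x) A =
      (\<integral>\<^sup>+z. ennreal (particle_mean N \<psi> (env_shift 1 (fst p)) z / tn (fst p) (snd p)) * indicator A z \<partial>pk (fst p) (snd p))"
    if "p \<in> space (E \<Otimes>\<^sub>M XN)" for p
    using that by (auto simp: space_pair_measure emeasure_tk[OF _ _ A])
  ultimately show "(\<lambda>p. emeasure (case p of (\<omega>, x) \<Rightarrow> tk \<omega> x) A) \<in> borel_measurable (E \<Otimes>\<^sub>M XN)"
    by (rule measurable_cong[THEN iffD2, rotated])
qed

lemma tk_bounds:
  assumes \<omega>: "\<omega> \<in> space E" and x: "x \<in> space XN" and A: "A \<in> sets XN"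
  shows "ennreal (pl / pu * \<epsilon>m ^ N) * emeasure (PiM {..<N} (\<lambda>_. \<nu>)) A \<le> emeasure (tk \<omega> x) A"
    "emeasure (tk \<omega> x) A \<le> ennreal (pu / pl * \<epsilon>p ^ N) * emeasure (PiM {..<N} (\<lambda>_. \<nu>)) A"
proof -
  have A': "A \<in> sets (pk \<omega> x)" using A by (simp add: sets_pk[OF \<omega> x])
  have c: "(\<integral>\<^sup>+z. ennreal c * indicator A z \<partial>pk \<omega> x) = ennreal c * emeasure (pk \<omega> x) A" for c
    by (rule nn_integral_cmult_indicator[OF A'])
  have "ennreal (pl / pu * \<epsilon>m ^ N) * emeasure (PiM {..<N} (\<lambda>_. \<nu>)) A \<le> ennreal (pl / pu) * emeasure (pk \<omega> x) A"
  proof -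
    have "ennreal (pl / pu * \<epsilon>m ^ N) = ennreal (pl / pu) * ennreal (\<epsilon>m ^ N)"
      using pl_pos pu_pos eps by (intro ennreal_mult) auto
    then show ?thesis
      using mult_left_mono[OF pk_ge[OF \<omega> x A], of "ennreal (pl / pu)"] by (simp only: mult.assoc zero_le)
  qed
  also have "\<dots> \<le> emeasure (tk \<omega> x) A"
    unfolding c[symmetric] emeasure_tk[OF \<omega> x A]
    by (intro nn_integral_mono mult_right_mono ennreal_leI twist_ratio_bounds[OF \<omega> x]) (simp_all add: space_pk[OF \<omega> x])
  finally show "ennreal (pl / pu * \<epsilon>m ^ N) * emeasure (PiM {..<N} (\<lambda>_. \<nu>)) A \<le> emeasure (tk \<omega> x) A" .
  have "emeasure (tk \<omega> x) A \<le> ennreal (pu / pl) * emeasure (pk \<omega> x) A"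
    unfolding c[symmetric] emeasure_tk[OF \<omega> x A]
    by (intro nn_integral_mono mult_right_mono ennreal_leI twist_ratio_bounds[OF \<omega> x]) (simp_all add: space_pk[OF \<omega> x])
  also have "\<dots> \<le> ennreal (pu / pl * \<epsilon>p ^ N) * emeasure (PiM {..<N} (\<lambda>_. \<nu>)) A"
  proof -
    have "ennreal (pu / pl * \<epsilon>p ^ N) = ennreal (pu / pl) * ennreal (\<epsilon>p ^ N)"
      using pl_pos pu_pos eps by (intro ennreal_mult) auto
    then show ?thesis
      using mult_left_mono[OF pk_le[OF \<omega> x A], of "ennreal (pu / pl)"] by (simp only: mult.assoc zero_le)
  qed
  finally show "emeasure (tk \<omega> x) A \<le> ennreal (pu / pl * \<epsilon>p ^ N) * emeasure (PiM {..<N} (\<lambda>_. \<nu>)) A" .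
qed

text \<open>The second-moment kernel. In the constants, gl and gu bound the mean of
  \<open>G\<close>, the powers of \<epsilon>m and \<epsilon>p come from N independent mixtures, and
  pl/pu and its inverse bound both \<open>phi\<close> in the weight and the twist density in the
  kernel.\<close>

sublocale R: weighted_kernel E "env_shift 1" XN tk wt "PiM {..<N} (\<lambda>_. \<nu>)"
  "gl\<^sup>2 * (pl / pu)\<^sup>2" "gu\<^sup>2 * (pu / pl)\<^sup>2" "pl / pu * \<epsilon>m ^ N" "pu / pl * \<epsilon>p ^ N"
proof (rule weighted_kernel.intro)
  show "env_shift 1 \<in> measurable E E" by measurable
  show "(\<lambda>(\<omega>, x). tk \<omega> x) \<in> measurable (E \<Otimes>\<^sub>M XN) (prob_algebra XN)" by (rule tk_measurable)
  show "(\<lambda>((\<omega>, x), y). wt \<omega> x y) \<in> borel_measurable ((E \<Otimes>\<^sub>M XN) \<Otimes>\<^sub>M XN)"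
  proof -
    have "(\<lambda>q. tn (fst (fst q)) (snd (fst q))) \<in> borel_measurable ((E \<Otimes>\<^sub>M XN) \<Otimes>\<^sub>M XN)"
      "(\<lambda>q. particle_mean N G (fst (fst q)) (snd (fst q))) \<in> borel_measurable ((E \<Otimes>\<^sub>M XN) \<Otimes>\<^sub>M XN)"
      using measurable_compose[OF measurable_fst tn_measurable]
        measurable_compose[OF measurable_fst measurable_particle_mean[OF G_measurable]]
      by (simp_all add: split_beta')
    then show ?thesis
      using psi_shift_measurable2 unfolding phi_def split_beta'
      by (intro borel_measurable_times borel_measurable_power borel_measurable_divide)
  qed
  show "prob_space (PiM {..<N} (\<lambda>_. \<nu>))" by (intro prob_space_PiM nu)
  show "sets (PiM {..<N} (\<lambda>_. \<nu>)) = sets XN" by (rule sets_PiM_cong) (simp_all add: nu)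
  show "0 < gl\<^sup>2 * (pl / pu)\<^sup>2" "0 < pl / pu * \<epsilon>m ^ N" "0 < pu / pl * \<epsilon>p ^ N"
    using gl_pos pl_pos pu_pos eps by simp_all
  fix \<omega> x assume \<omega>: "\<omega> \<in> space E" and x: "x \<in> space XN"
  show "gl\<^sup>2 * (pl / pu)\<^sup>2 \<le> wt \<omega> x y" "wt \<omega> x y \<le> gu\<^sup>2 * (pu / pl)\<^sup>2" if y: "y \<in> space XN" for y
  proof -
    note b = G_mean_bounds[OF \<omega> x] twist_ratio_bounds(3,4)[OF \<omega> x y]
    have "0 \<le> pl / pu" using pl_pos pu_pos by simp
    then have nn: "0 \<le> particle_mean N G \<omega> x" "0 \<le> phi X G M \<psi> N \<omega> x y"
      using b gl_pos by linarith+
    show "gl\<^sup>2 * (pl / pu)\<^sup>2 \<le> wt \<omega> x y"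
      using b gl_pos \<open>0 \<le> pl / pu\<close> by (intro mult_mono power_mono) auto
    show "wt \<omega> x y \<le> gu\<^sup>2 * (pu / pl)\<^sup>2"
      using b nn by (intro mult_mono power_mono) auto
  qed
  show "ennreal (pl / pu * \<epsilon>m ^ N) * emeasure (PiM {..<N} (\<lambda>_. \<nu>)) A \<le> emeasure (tk \<omega> x) A"
    "emeasure (tk \<omega> x) A \<le> ennreal (pu / pl * \<epsilon>p ^ N) * emeasure (PiM {..<N} (\<lambda>_. \<nu>)) A"
    if "A \<in> sets XN" for A
    by (rule tk_bounds[OF \<omega> x that])+
qed

end

subsection \<open>The bound on the growth rate\<close>

lemma bounded_measurable_cong_sets: "sets m = sets S \<Longrightarrow> bounded_measurable m f \<longleftrightarrow> bounded_measurable S f"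
  using sets_eq_imp_space_eq[of m S] by (simp add: bounded_measurable_def measurable_cong_sets[of m S borel borel])

text \<open>The function need not be measurable, so the argument stays with almost-everywhere
  statements: the infimum is approached by countably many admissible bounds, whose exceptional sets
  are null together.\<close>

lemma ess_sup_AE:
  assumes P: "prob_space P" and nonneg: "AE \<omega> in P. 0 \<le> f \<omega>" and bound: "AE \<omega> in P. f \<omega> \<le> B"
  shows "AE \<omega> in P. f \<omega> \<le> ess_sup P f" and "0 \<le> ess_sup P f"
proof -
  define A where "A = {c. AE \<omega> in P. f \<omega> \<le> c}"
  have A_ne: "B \<in> A" using bound by (simp add: A_def)
  have A_nonneg: "0 \<le> c" if "c \<in> A" for c
  proof (rule ccontr)
    assume "\<not> 0 \<le> c"
    have "AE \<omega> in P. f \<omega> \<le> c" using that by (simp add: A_def)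
    with nonneg have "AE \<omega> in P. False"
      by eventually_elim (use \<open>\<not> 0 \<le> c\<close> in simp)
    then show False using prob_space.AE_False[OF P] by simp
  qed
  then have bdd: "bdd_below A" by (rule bdd_belowI)
  show "0 \<le> ess_sup P f"
    unfolding ess_sup_def A_def[symmetric] using A_ne A_nonneg by (intro cInf_greatest) auto
  have "AE \<omega> in P. f \<omega> \<le> Inf A + 1 / real (Suc n)" for n
  proof -
    have "Inf A < Inf A + 1 / real (Suc n)" by simp
    then obtain c where c: "c \<in> A" "c < Inf A + 1 / real (Suc n)"
      using A_ne bdd by (subst (asm) cInf_less_iff) auto
    from c(1) have "AE \<omega> in P. f \<omega> \<le> c" by (simp add: A_def)
    then show ?thesis by eventually_elim (use c(2) in simp)
  qed
  then have "AE \<omega> in P. \<forall>n. f \<omega> \<le> Inf A + 1 / real (Suc n)"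
    by (simp add: AE_all_countable)
  then show "AE \<omega> in P. f \<omega> \<le> ess_sup P f"
    unfolding ess_sup_def A_def[symmetric]
  proof eventually_elim
    case (elim \<omega>)
    have "(\<lambda>n. Inf A + 1 / real (Suc n)) \<longlonglongrightarrow> Inf A + 0"
      by (intro tendsto_intros LIMSEQ_Suc[OF lim_1_over_n])
    then show ?case using elim by (intro LIMSEQ_le_const[of _ "Inf A"]) auto
  qed
qed

lemma SUP_bounds:
  fixes f :: "'c \<Rightarrow> real"
  assumes "A \<noteq> {}" and f: "\<forall>x\<in>A. lo \<le> f x \<and> f x \<le> hi"
  shows "x \<in> A \<Longrightarrow> f x \<le> (SUP x\<in>A. f x)" "lo \<le> (SUP x\<in>A. f x)" "(SUP x\<in>A. f x) \<le> hi"
proof -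
  have bdd: "bdd_above (f ` A)" using f by (intro bdd_aboveI2) blast
  show "x \<in> A \<Longrightarrow> f x \<le> (SUP x\<in>A. f x)" by (rule cSUP_upper[OF _ bdd])
  show "(SUP x\<in>A. f x) \<le> hi" using assms by (intro cSUP_least) auto
  obtain y where "y \<in> A" using assms(1) by blast
  then show "lo \<le> (SUP x\<in>A. f x)" using bdd f by (intro cSUP_upper2) auto
qed

section \<open>The concrete \<open>h_fun\<close> agrees with the abstract eigenfunction\<close>

lemma sets_act: "sets (act X m K) = sets X"
  by (simp add: act_def)

lemma space_act: "space (act X m K) = space X"
  by (simp add: act_def)

lemma sets_Qn: "sets (Qn X G M n \<omega> x) = sets X"
  by (cases n) (simp_all add: act_def)

lemma space_Qn: "space (Qn X G M n \<omega> x) = space X"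
  using sets_Qn by (rule sets_eq_imp_space_eq)

text \<open>\<mu> is the law from which the past in \<open>h_fun\<close> is started; it is unrelated
  to the initial law of the particles.\<close>

locale particle_model_past = particle_model +
  fixes \<mu> :: "'a measure"
  assumes mu: "prob_space \<mu>" "sets \<mu> = sets X"
begin

sublocale Q: invertible_weighted_kernel E "env_shift 1" X M "\<lambda>\<omega> x y. G \<omega> x" \<nu> gl gu \<epsilon>m \<epsilon>p
  "env_shift (- 1)" \<mu>
proof (intro invertible_weighted_kernel.intro invertible_weighted_kernel_axioms.intro weighted_kernel.intro)
  show "(\<lambda>((\<omega>, x), y). G \<omega> x) \<in> borel_measurable ((E \<Otimes>\<^sub>M X) \<Otimes>\<^sub>M X)"
    using measurable_compose[OF measurable_fst G_measurable] by (simp add: split_beta')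
  show "env_shift 1 (env_shift (- 1) \<omega>) = \<omega>" for \<omega>
    by (simp add: env_shift_env_shift env_shift_0)
qed (use M nu mu eps gl_pos G_ge G_le M_ge M_le env_shift_space in \<open>simp_all add: split_beta'\<close>)

lemma funpow_shift: "env_shift 1 ^^ n = env_shift (int n)"
  by (rule env_shift_funpow[symmetric])

lemma sets_prod_init: "sets m = sets X \<Longrightarrow> sets (PiM {..<N} (\<lambda>_. m)) = sets XN"
  by (rule sets_PiM_cong) simp_all

lemma V_tilde_eq:
  assumes \<omega>: "\<omega> \<in> space E" and m: "prob_space m" "sets m = sets X"
  shows "V_tilde X G M \<psi> N m n \<omega> =
    (\<integral>x. R.U n \<omega> x \<partial>PiM {..<N} (\<lambda>_. m)) / (\<integral>x. Q.U n \<omega> x \<partial>m)\<^sup>2"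
  using R.integral_chain_law[OF \<omega> prob_space_PiM[OF m(1)] sets_prod_init[OF m(2)], of n]
    Q.integral_chain_law[OF \<omega> m, of n]
  by (simp add: V_tilde_def funpow_shift)

lemma Q_kernel_props:
  assumes \<omega>: "\<omega> \<in> space E"
  shows "x \<in> space X \<Longrightarrow> sets (Q_kernel G M \<omega> x) = sets X"
    and "A \<in> sets X \<Longrightarrow> (\<lambda>x. emeasure (Q_kernel G M \<omega> x) A) \<in> borel_measurable X"
proof -
  show "x \<in> space X \<Longrightarrow> sets (Q_kernel G M \<omega> x) = sets X"
    by (simp add: Q_kernel_def sets_M[OF \<omega>])
  assume A: "A \<in> sets X"
  have "M \<omega> \<in> measurable X (prob_algebra X)"
    using measurable_compose[OF measurable_Pair1'[OF \<omega>] M] by simp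
  from measurable_emeasure_kernel[OF measurable_prob_algebraD[OF this] A]
  have "(\<lambda>x. emeasure (M \<omega> x) A) \<in> borel_measurable X" .
  moreover have "(\<lambda>x. ennreal (G \<omega> x)) \<in> borel_measurable X"
    using measurable_compose[OF measurable_compose[OF measurable_Pair1'[OF \<omega>] G_measurable] measurable_ennreal] by simp
  ultimately show "(\<lambda>x. emeasure (Q_kernel G M \<omega> x) A) \<in> borel_measurable X"
    unfolding Q_kernel_def emeasure_scale_measure by (intro borel_measurable_times_ennreal)
qed

lemma nn_integral_Q_kernel:
  assumes \<omega>: "\<omega> \<in> space E" and x: "x \<in> space X" and f: "bounded_measurable X f" "\<And>y. y \<in> space X \<Longrightarrow> 0 \<le> f y"
  shows "(\<integral>\<^sup>+y. ennreal (f y) \<partial>Q_kernel G M \<omega> x) = ennreal (Q.L \<omega> f x)"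
proof -
  have f': "(\<lambda>y. ennreal (f y)) \<in> borel_measurable (M \<omega> x)"
    unfolding measurable_cong_sets[OF sets_M[OF \<omega> x] refl]
    using measurable_compose[OF bounded_measurableD[OF f(1)] measurable_ennreal] .
  have "(\<integral>\<^sup>+y. ennreal (f y) \<partial>Q_kernel G M \<omega> x) = ennreal (G \<omega> x) * (\<integral>\<^sup>+y. ennreal (f y) \<partial>M \<omega> x)"
    unfolding Q_kernel_def by (rule nn_integral_scale_measure[OF f'])
  also have "\<dots> = (\<integral>\<^sup>+y. ennreal (G \<omega> x) * ennreal (f y) \<partial>M \<omega> x)"
    by (rule nn_integral_cmult[OF f', symmetric])
  also have "\<dots> = ennreal (Q.L \<omega> f x)"
    by (rule Q.nn_integral_weighted[OF \<omega> x f])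
  finally show ?thesis .
qed

text \<open>\<open>Qn\<close> appends each new step at the end of the orbit while \<open>T\<close>
  prepends it; f is general in the induction so that the last step can be moved into it.\<close>

lemma nn_integral_Qn:
  assumes \<omega>: "\<omega> \<in> space E" and x: "x \<in> space X" and f: "bounded_measurable X f" "\<And>y. y \<in> space X \<Longrightarrow> 0 \<le> f y"
  shows "(\<integral>\<^sup>+y. ennreal (f y) \<partial>Qn X G M n \<omega> x) = ennreal (Q.T n \<omega> f x)"
  using f
proof (induction n arbitrary: f)
  case 0
  have "(\<lambda>y. ennreal (f y)) \<in> borel_measurable X"
    using measurable_compose[OF bounded_measurableD[OF 0(1)] measurable_ennreal] .
  then show ?case using x by (simp add: nn_integral_return)
next
  case (Suc n)
  have \<omega>n: "env_shift (int n) \<omega> \<in> space E" using \<omega> by (rule env_shift_space)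
  have f': "(\<lambda>y. ennreal (f y)) \<in> borel_measurable X"
    using measurable_compose[OF bounded_measurableD[OF Suc.prems(1)] measurable_ennreal] .
  have "(\<integral>\<^sup>+y. ennreal (f y) \<partial>Qn X G M (Suc n) \<omega> x) =
      (\<integral>\<^sup>+z. \<integral>\<^sup>+y. ennreal (f y) \<partial>Q_kernel G M (env_shift (int n) \<omega>) z \<partial>Qn X G M n \<omega> x)"
    unfolding Qn.simps act_eq_kernel_comp
  proof (rule nn_integral_kernel_comp[OF _ _ f'])
    show "sets (Q_kernel G M (env_shift (int n) \<omega>) z) = sets X" if "z \<in> space (Qn X G M n \<omega> x)" for z
      using that by (intro Q_kernel_props[OF \<omega>n]) (simp add: space_Qn)
    show "(\<lambda>z. emeasure (Q_kernel G M (env_shift (int n) \<omega>) z) A) \<in> borel_measurable (Qn X G M n \<omega> x)"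
      if "A \<in> sets X" for A
      unfolding measurable_cong_sets[OF sets_Qn refl] by (rule Q_kernel_props(2)[OF \<omega>n that])
  qed
  also have "\<dots> = (\<integral>\<^sup>+z. ennreal (Q.L (env_shift (int n) \<omega>) f z) \<partial>Qn X G M n \<omega> x)"
    by (intro nn_integral_cong nn_integral_Q_kernel[OF \<omega>n _ Suc.prems]) (simp_all add: space_Qn)
  also have "\<dots> = ennreal (Q.T n \<omega> (Q.L (env_shift (int n) \<omega>) f) x)"
    by (rule Suc.IH[OF Q.BM_L[OF \<omega>n Suc.prems(1)]]) (rule Q.L_nonneg[OF \<omega>n _ Suc.prems])
  also have "Q.T n \<omega> (Q.L (env_shift (int n) \<omega>) f) = Q.T (Suc n) \<omega> f"
    using Q.T_add[of n 1 \<omega> f] by (simp add: funpow_shift)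
  finally show ?case .
qed

lemma emeasure_Qn:
  assumes "\<omega> \<in> space E" "x \<in> space X" "A \<in> sets X"
  shows "emeasure (Qn X G M n \<omega> x) A = ennreal (Q.T n \<omega> (indicator A) x)"
proof -
  have "bounded_measurable X (indicat_real A)"
    using assms(3) by (intro bounded_measurableI[where B = 1]) (auto simp: indicator_def)
  from nn_integral_Qn[OF assms(1,2) this, of n] assms(3) show ?thesis
    by (simp add: ennreal_indicator sets_Qn)
qed

lemma Qn_measurable:
  assumes "\<omega> \<in> space E" "A \<in> sets X"
  shows "(\<lambda>x. emeasure (Qn X G M n \<omega> x) A) \<in> borel_measurable X"
proof -
  have "bounded_measurable X (indicat_real A)"
    using assms(2) by (intro bounded_measurableI[where B = 1]) (auto simp: indicator_def)
  from measurable_compose[OF bounded_measurableD[OF Q.BM_T[OF assms(1) this]] measurable_ennreal]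
  show ?thesis
    using emeasure_Qn[OF assms(1) _ assms(2)] by (simp cong: measurable_cong)
qed

lemma nn_integral_act_Qn:
  assumes \<omega>: "\<omega> \<in> space E" and m: "sets m = sets X"
    and f: "bounded_measurable X f" "\<And>y. y \<in> space X \<Longrightarrow> 0 \<le> f y"
  shows "(\<integral>\<^sup>+y. ennreal (f y) \<partial>act X m (Qn X G M n \<omega>)) = (\<integral>\<^sup>+x. ennreal (Q.T n \<omega> f x) \<partial>m)"
proof -
  have space_m: "space m = space X" using m by (rule sets_eq_imp_space_eq)
  have "(\<integral>\<^sup>+y. ennreal (f y) \<partial>act X m (Qn X G M n \<omega>)) = (\<integral>\<^sup>+x. \<integral>\<^sup>+y. ennreal (f y) \<partial>Qn X G M n \<omega> x \<partial>m)"
    unfolding act_eq_kernel_comp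
  proof (rule nn_integral_kernel_comp[OF sets_Qn])
    show "(\<lambda>x. emeasure (Qn X G M n \<omega> x) A) \<in> borel_measurable m" if "A \<in> sets X" for A
      unfolding measurable_cong_sets[OF m refl] by (rule Qn_measurable[OF \<omega> that])
    show "(\<lambda>y. ennreal (f y)) \<in> borel_measurable X"
      using measurable_compose[OF bounded_measurableD[OF f(1)] measurable_ennreal] .
  qed
  also have "\<dots> = (\<integral>\<^sup>+x. ennreal (Q.T n \<omega> f x) \<partial>m)"
    by (intro nn_integral_cong nn_integral_Qn[OF \<omega> _ f]) (simp_all add: space_m)
  finally show ?thesis .
qed

lemma emeasure_act_Qn:
  assumes \<omega>: "\<omega> \<in> space E" and m: "sets m = sets X"
  shows "emeasure (act X m (Qn X G M n \<omega>)) (space X) = (\<integral>\<^sup>+x. ennreal (Q.U n \<omega> x) \<partial>m)"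
proof -
  have "emeasure (act X m (Qn X G M n \<omega>)) (space X) = (\<integral>\<^sup>+x. ennreal 1 \<partial>act X m (Qn X G M n \<omega>))"
    by (simp add: space_act)
  also have "\<dots> = (\<integral>\<^sup>+x. ennreal (Q.U n \<omega> x) \<partial>m)"
    unfolding Q.U_def by (rule nn_integral_act_Qn[OF \<omega> m]) simp_all
  finally show ?thesis .
qed

text \<open>The mass by which \<open>Phi\<close> is normalised is the denominator of
  \<open>past\<close>, so the two agree once kernels and function iterates are exchanged.\<close>

lemma measure_act_Phi:
  assumes \<omega>: "\<omega> \<in> space E"
  shows "measure (act X (Phi X G M n (env_shift (- int n) \<omega>) \<mu>) (Qn X G M n \<omega>)) (space X) =
    Q.past n \<omega> (Q.U n \<omega>)"
proof -
  let ?\<omega>' = "env_shift (- int n) \<omega>"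
  have \<omega>': "?\<omega>' \<in> space E" using \<omega> by (rule env_shift_space)
  let ?e = "\<integral>x. Q.U n ?\<omega>' x \<partial>\<mu>"
  have e: "0 < ?e" by (rule Q.integral_U_pos[OF \<omega>' mu])
  have "emeasure (act X \<mu> (Qn X G M n ?\<omega>')) (space X) = ennreal ?e"
    unfolding emeasure_act_Qn[OF \<omega>' mu(2)]
    by (rule nn_integral_bounded_measurable[OF Q.BM_U[OF \<omega>'] mu]) (rule less_imp_le[OF Q.U_pos[OF \<omega>']])
  then have Phi: "Phi X G M n ?\<omega>' \<mu> = scale_measure (inverse (ennreal ?e)) (act X \<mu> (Qn X G M n ?\<omega>'))"
    by (simp add: Phi_def)
  have U0: "0 \<le> Q.U n \<omega> y" if "y \<in> space X" for y
    using Q.U_pos[OF \<omega> that, of n] by simp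
  have "emeasure (act X (Phi X G M n ?\<omega>' \<mu>) (Qn X G M n \<omega>)) (space X) =
      (\<integral>\<^sup>+x. ennreal (Q.U n \<omega> x) \<partial>Phi X G M n ?\<omega>' \<mu>)"
    by (rule emeasure_act_Qn[OF \<omega>]) (simp add: Phi sets_act)
  also have "\<dots> = inverse (ennreal ?e) * (\<integral>\<^sup>+x. ennreal (Q.U n \<omega> x) \<partial>act X \<mu> (Qn X G M n ?\<omega>'))"
    unfolding Phi
  proof (rule nn_integral_scale_measure)
    show "(\<lambda>x. ennreal (Q.U n \<omega> x)) \<in> borel_measurable (act X \<mu> (Qn X G M n ?\<omega>'))"
      unfolding measurable_cong_sets[OF sets_act refl]
      using measurable_compose[OF bounded_measurableD[OF Q.BM_U[OF \<omega>]] measurable_ennreal] .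
  qed
  also have "(\<integral>\<^sup>+x. ennreal (Q.U n \<omega> x) \<partial>act X \<mu> (Qn X G M n ?\<omega>')) = (\<integral>\<^sup>+x. ennreal (Q.T n ?\<omega>' (Q.U n \<omega>) x) \<partial>\<mu>)"
    by (rule nn_integral_act_Qn[OF \<omega>' mu(2) Q.BM_U[OF \<omega>] U0])
  also have "\<dots> = ennreal (\<integral>x. Q.T n ?\<omega>' (Q.U n \<omega>) x \<partial>\<mu>)"
    by (rule nn_integral_bounded_measurable[OF Q.BM_T[OF \<omega>' Q.BM_U[OF \<omega>]] mu])
      (rule Q.T_nonneg[OF \<omega>' _ Q.BM_U[OF \<omega>] U0])
  also have "inverse (ennreal ?e) * ennreal (\<integral>x. Q.T n ?\<omega>' (Q.U n \<omega>) x \<partial>\<mu>) = ennreal (Q.past n \<omega> (Q.U n \<omega>))"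
    using e Q.past_U_pos[OF \<omega>, of n n]
    by (simp add: Q.past_def env_shift_funpow_backward inverse_ennreal ennreal_mult'[symmetric] divide_inverse mult.commute)
  finally show ?thesis
    using Q.past_U_pos[OF \<omega>, of n n] by (simp add: measure_def)
qed

lemma h_fun_eq:
  assumes \<omega>: "\<omega> \<in> space E" and x: "x \<in> space X"
  shows "h_fun X G M \<mu> \<omega> x = Q.h \<omega> x"
proof -
  have "measure (Qn X G M n \<omega> x) (space X) = Q.U n \<omega> x" for n
  proof -
    have "emeasure (Qn X G M n \<omega> x) (space X) = (\<integral>\<^sup>+y. ennreal 1 \<partial>Qn X G M n \<omega> x)"
      by (simp add: space_Qn)
    also have "\<dots> = ennreal (Q.U n \<omega> x)"
      unfolding Q.U_def by (rule nn_integral_Qn[OF \<omega> x]) simp_all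
    finally show ?thesis using Q.U_pos[OF \<omega> x, of n] by (simp add: measure_def)
  qed
  then show ?thesis
    by (simp add: h_fun_def Q.h_def Q.hn_def measure_act_Phi[OF \<omega>])
qed

section \<open>The constituents of the constant in the bound\<close>

definition ratio_sup :: "(int \<Rightarrow> 'b) \<Rightarrow> real" where
  "ratio_sup \<omega> = (SUP (z, z')\<in>space X \<times> space X. \<psi> \<omega> z / \<psi> \<omega> z')"

text \<open>Its reciprocal is the infimum of h/\<psi>, the best a with a \<psi> \<le> h; hence the
  name.\<close>

definition inv_inf :: "(int \<Rightarrow> 'b) \<Rightarrow> real" where
  "inv_inf \<omega> = (SUP z\<in>space X. \<psi> \<omega> z / Q.h \<omega> z)"

definition osc :: "(int \<Rightarrow> 'b) \<Rightarrow> real" where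
  "osc \<omega> = (SUP (z, z')\<in>space X \<times> space X. \<bar>Q.h \<omega> z / \<psi> \<omega> z - Q.h \<omega> z' / \<psi> \<omega> z'\<bar>)"

definition D :: "(int \<Rightarrow> 'b) \<Rightarrow> real" where
  "D \<omega> = (2 * ratio_sup \<omega> - 1) * inv_inf \<omega> * osc \<omega>"

lemma psi_pos: "\<omega> \<in> space E \<Longrightarrow> z \<in> space X \<Longrightarrow> 0 < \<psi> \<omega> z"
  using psi_ge[of \<omega> z] pl_pos by simp

context
  fixes \<omega>
  assumes \<omega>: "\<omega> \<in> space E"
begin

lemma X_ne: "space X \<noteq> {}" "space X \<times> space X \<noteq> {}"
  using X_nonempty by auto

lemma R1: "1 \<le> Q.R" by (rule Q.R_ge_1[OF \<omega>])

lemma ratio_sup_props: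
  shows "z \<in> space X \<Longrightarrow> z' \<in> space X \<Longrightarrow> \<psi> \<omega> z / \<psi> \<omega> z' \<le> ratio_sup \<omega>"
    and "1 \<le> ratio_sup \<omega>" and "ratio_sup \<omega> \<le> pu / pl"
proof -
  have q: "0 \<le> \<psi> \<omega> z / \<psi> \<omega> z' \<and> \<psi> \<omega> z / \<psi> \<omega> z' \<le> pu / pl" if "z \<in> space X" "z' \<in> space X" for z z'
    using psi_ge[OF \<omega> that(2)] psi_le[OF \<omega> that(1)] psi_pos[OF \<omega> that(1)] pl_pos
    by (intro conjI frac_le divide_nonneg_nonneg) auto
  then have b: "\<forall>p\<in>space X \<times> space X. 0 \<le> (case p of (z, z') \<Rightarrow> \<psi> \<omega> z / \<psi> \<omega> z') \<and>
      (case p of (z, z') \<Rightarrow> \<psi> \<omega> z / \<psi> \<omega> z') \<le> pu / pl"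
    by auto
  note S = SUP_bounds[OF X_ne(2) b]
  show le: "\<psi> \<omega> z / \<psi> \<omega> z' \<le> ratio_sup \<omega>" if "z \<in> space X" "z' \<in> space X" for z z'
    using S(1)[where x = "(z, z')"] that by (simp add: ratio_sup_def)
  obtain z where "z \<in> space X" using X_nonempty by blast
  from le[OF this this] psi_pos[OF \<omega> this] show "1 \<le> ratio_sup \<omega>" by simp
  show "ratio_sup \<omega> \<le> pu / pl" using S(3) by (simp add: ratio_sup_def)
qed

lemma inv_inf_props:
  shows "z \<in> space X \<Longrightarrow> \<psi> \<omega> z / Q.h \<omega> z \<le> inv_inf \<omega>" and "0 < inv_inf \<omega>" and "inv_inf \<omega> \<le> pu * Q.R"
proof -
  have b: "0 \<le> \<psi> \<omega> z / Q.h \<omega> z" "\<psi> \<omega> z / Q.h \<omega> z \<le> pu * Q.R" if z: "z \<in> space X" for z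
  proof -
    show "0 \<le> \<psi> \<omega> z / Q.h \<omega> z"
      using psi_pos[OF \<omega> z] Q.h_bounds[OF \<omega> z] by (intro divide_nonneg_nonneg) auto
    have "\<psi> \<omega> z / Q.h \<omega> z \<le> pu / (1 / Q.R)"
      using psi_le[OF \<omega> z] Q.h_bounds(1)[OF \<omega> z] R1 pu_pos by (intro frac_le) auto
    then show "\<psi> \<omega> z / Q.h \<omega> z \<le> pu * Q.R" by simp
  qed
  then have "\<forall>z\<in>space X. 0 \<le> \<psi> \<omega> z / Q.h \<omega> z \<and> \<psi> \<omega> z / Q.h \<omega> z \<le> pu * Q.R" by blast
  note S = SUP_bounds[OF X_ne(1) this]
  show le: "\<psi> \<omega> z / Q.h \<omega> z \<le> inv_inf \<omega>" if "z \<in> space X" for z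
    using S(1)[OF that] by (simp add: inv_inf_def)
  obtain z where z: "z \<in> space X" using X_nonempty by blast
  have "0 < \<psi> \<omega> z / Q.h \<omega> z" using psi_pos[OF \<omega> z] Q.h_bounds[OF \<omega> z] by simp
  with le[OF z] show "0 < inv_inf \<omega>" by simp
  show "inv_inf \<omega> \<le> pu * Q.R" using S(3) by (simp add: inv_inf_def)
qed

lemma osc_props:
  shows "z \<in> space X \<Longrightarrow> z' \<in> space X \<Longrightarrow> Q.h \<omega> z / \<psi> \<omega> z - Q.h \<omega> z' / \<psi> \<omega> z' \<le> osc \<omega>"
    and "0 \<le> osc \<omega>" and "osc \<omega> \<le> Q.R / pl"
proof -
  have q: "0 \<le> Q.h \<omega> z / \<psi> \<omega> z" "Q.h \<omega> z / \<psi> \<omega> z \<le> Q.R / pl" if z: "z \<in> space X" for z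
    using psi_pos[OF \<omega> z] psi_ge[OF \<omega> z] Q.h_bounds[OF \<omega> z] pl_pos R1
    by (auto intro!: frac_le divide_nonneg_nonneg)
  have "0 \<le> \<bar>Q.h \<omega> z / \<psi> \<omega> z - Q.h \<omega> z' / \<psi> \<omega> z'\<bar> \<and> \<bar>Q.h \<omega> z / \<psi> \<omega> z - Q.h \<omega> z' / \<psi> \<omega> z'\<bar> \<le> Q.R / pl"
    if "z \<in> space X" "z' \<in> space X" for z z'
    using q[OF that(1)] q[OF that(2)] by linarith
  then have b: "\<forall>p\<in>space X \<times> space X. 0 \<le> (case p of (z, z') \<Rightarrow> \<bar>Q.h \<omega> z / \<psi> \<omega> z - Q.h \<omega> z' / \<psi> \<omega> z'\<bar>) \<and>
      (case p of (z, z') \<Rightarrow> \<bar>Q.h \<omega> z / \<psi> \<omega> z - Q.h \<omega> z' / \<psi> \<omega> z'\<bar>) \<le> Q.R / pl"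
    by auto
  note S = SUP_bounds[OF X_ne(2) b]
  show "Q.h \<omega> z / \<psi> \<omega> z - Q.h \<omega> z' / \<psi> \<omega> z' \<le> osc \<omega>" if "z \<in> space X" "z' \<in> space X" for z z'
    using S(1)[where x = "(z, z')"] that
    by (simp add: osc_def)
  show "0 \<le> osc \<omega>" "osc \<omega> \<le> Q.R / pl" using S(2,3) by (simp_all add: osc_def)
qed

lemma D_bounds: "0 \<le> D \<omega>" "D \<omega> \<le> (2 * (pu / pl)) * (pu * Q.R) * (Q.R / pl)"
proof -
  note p = ratio_sup_props(2,3) inv_inf_props(2,3) osc_props(2,3)
  show "0 \<le> D \<omega>" unfolding D_def using p by (intro mult_nonneg_nonneg) auto
  show "D \<omega> \<le> (2 * (pu / pl)) * (pu * Q.R) * (Q.R / pl)"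
    unfolding D_def using p pu_pos pl_pos R1 by (intro mult_mono) auto
qed

text \<open>\<open>h_fun\<close> and \<open>Q.h\<close> are known to agree only on the space of
  \<open>X\<close>, and the suprema look at nothing else.\<close>

lemma D_eq: "C_const X \<psi> (h_fun X G M \<mu>) \<omega> *
     (SUP (z, z')\<in>space X \<times> space X. \<bar>h_fun X G M \<mu> \<omega> z / \<psi> \<omega> z - h_fun X G M \<mu> \<omega> z' / \<psi> \<omega> z'\<bar>) = D \<omega>"
proof -
  have "(SUP z\<in>space X. \<psi> \<omega> z / h_fun X G M \<mu> \<omega> z) = inv_inf \<omega>"
    unfolding inv_inf_def by (intro SUP_cong refl) (simp add: h_fun_eq[OF \<omega>])
  moreover have "(SUP (z, z')\<in>space X \<times> space X. \<bar>h_fun X G M \<mu> \<omega> z / \<psi> \<omega> z - h_fun X G M \<mu> \<omega> z' / \<psi> \<omega> z'\<bar>) = osc \<omega>"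
    unfolding osc_def by (intro SUP_cong refl) (auto simp: h_fun_eq[OF \<omega>])
  ultimately show ?thesis
    by (simp add: C_const_def D_def ratio_sup_def)
qed

lemma h_mean_bounds:
  assumes "z \<in> space XN"
  shows "1 / Q.R \<le> particle_mean N Q.h \<omega> z" "particle_mean N Q.h \<omega> z \<le> Q.R"
  by (rule particle_mean_bounds[where N = N and X = X and f = Q.h and \<omega> = \<omega>,
        OF N_pos assms Q.h_bounds(1)[OF \<omega>] Q.h_bounds(2)[OF \<omega>]]; assumption)+

lemma h_mean_BM: "bounded_measurable XN (particle_mean N Q.h \<omega>)"
  by (rule particle_mean_BM[where f = Q.h and \<omega> = \<omega>, OF Q.BM_h[OF \<omega>]])

end

text \<open>The function \<open>F \<omega>\<close> would be an exact eigenfunction of the second-moment kernel if \<open>\<psi>\<close> were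
  proportional to \<open>h\<close>.\<close>

definition F :: "(int \<Rightarrow> 'b) \<Rightarrow> (nat \<Rightarrow> 'a) \<Rightarrow> real" where
  "F \<omega> z = (particle_mean N Q.h \<omega> z)\<^sup>2"

lemma F_BM: "\<omega> \<in> space E \<Longrightarrow> bounded_measurable XN (F \<omega>)"
  unfolding F_def[abs_def] power2_eq_square by (intro bounded_measurable_mult h_mean_BM)

lemma F_bounds:
  assumes \<omega>: "\<omega> \<in> space E" and z: "z \<in> space XN"
  shows "1 / Q.R\<^sup>2 \<le> F \<omega> z" "F \<omega> z \<le> Q.R\<^sup>2" "0 \<le> F \<omega> z"
proof -
  note b = h_mean_bounds[OF \<omega> z] R1[OF \<omega>]
  have "(1 / Q.R)\<^sup>2 \<le> F \<omega> z" unfolding F_def using b by (intro power_mono) auto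
  then show "1 / Q.R\<^sup>2 \<le> F \<omega> z" by (simp add: power_divide)
  have "0 \<le> 1 / Q.R" using b by simp
  then show "F \<omega> z \<le> Q.R\<^sup>2" unfolding F_def using b by (intro power_mono) linarith+
  show "0 \<le> F \<omega> z" by (simp add: F_def)
qed

text \<open>The mean of \<open>G\<close> cancels the normalisation of the mixture; what is left is
  the particle average of \<open>Q.L\<close> applied to \<open>h\<close>, where the eigenvalue
  relation applies term by term.\<close>

lemma mean_G_mixture:
  assumes \<omega>: "\<omega> \<in> space E" and x: "x \<in> space XN"
  shows "particle_mean N G \<omega> x * (\<integral>y. Q.h (env_shift 1 \<omega>) y \<partial>mix \<omega> x) = Q.eig \<omega> * particle_mean N Q.h \<omega> x"
proof -
  have \<omega>': "env_shift 1 \<omega> \<in> space E" using \<omega> by (rule env_shift_space)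
  have "(\<integral>y. Q.h (env_shift 1 \<omega>) y \<partial>mix \<omega> x) =
      (\<Sum>j<N. G \<omega> (x j) * (\<integral>y. Q.h (env_shift 1 \<omega>) y \<partial>M \<omega> (x j))) / (\<Sum>j<N. G \<omega> (x j))"
    by (rule integral_mixture[OF \<omega> x Q.BM_h[OF \<omega>']]) (rule less_imp_le[OF Q.h_bounds(3)[OF \<omega>']])
  then have "particle_mean N G \<omega> x * (\<integral>y. Q.h (env_shift 1 \<omega>) y \<partial>mix \<omega> x) =
      (\<Sum>j<N. G \<omega> (x j) * (\<integral>y. Q.h (env_shift 1 \<omega>) y \<partial>M \<omega> (x j))) / real N"
    using G_sum_pos[OF \<omega> x] by (simp add: particle_mean_def)
  also have "(\<Sum>j<N. G \<omega> (x j) * (\<integral>y. Q.h (env_shift 1 \<omega>) y \<partial>M \<omega> (x j))) = (\<Sum>j<N. Q.eig \<omega> * Q.h \<omega> (x j))"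
  proof (rule sum.cong[OF refl])
    fix j assume "j \<in> {..<N}"
    then have "x j \<in> space X" using XN_component[OF x] by simp
    from Q.L_h[OF \<omega> this]
    show "G \<omega> (x j) * (\<integral>y. Q.h (env_shift 1 \<omega>) y \<partial>M \<omega> (x j)) = Q.eig \<omega> * Q.h \<omega> (x j)"
      by (simp add: Q.L_def)
  qed
  also have "\<dots> / real N = Q.eig \<omega> * particle_mean N Q.h \<omega> x"
    by (simp add: particle_mean_def sum_distrib_left)
  finally show ?thesis .
qed

text \<open>The weight contains \<open>phi\<close> squared and the twist density is 1 /
  \<open>phi\<close>, so a single \<open>phi\<close> survives against the product kernel. The
  integrand becomes the ratio of sums treated in \<open>second_moment_ratio\<close>, and the mean of
  \<open>h\<close> under the mixture turns back into the eigenvalue.\<close>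

lemma one_step_bound:
  assumes \<omega>: "\<omega> \<in> space E" and x: "x \<in> space XN" and N2: "2 \<le> N"
  shows "R.L \<omega> (F (env_shift 1 \<omega>)) x \<le>
    (1 + 1 / (real N - 1) * D (env_shift 1 \<omega>)) * (Q.eig \<omega>)\<^sup>2 * F \<omega> x"
proof -
  let ?\<omega> = "env_shift 1 \<omega>"
  have \<omega>': "?\<omega> \<in> space E" using \<omega> by (rule env_shift_space)
  let ?\<psi> = "\<psi> ?\<omega>" and ?h = "Q.h ?\<omega>"
  define g where "g = particle_mean N G \<omega> x"
  define t where "t = tn \<omega> x"
  have t: "0 < t" unfolding t_def by (rule tn_bounds(3)[OF \<omega> x])
  note mix = prob_mixture[OF \<omega> x] sets_mixture[OF \<omega> x] space_mixture[OF \<omega> x]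
  have "R.L \<omega> (F ?\<omega>) x = (\<integral>z. particle_mean N \<psi> ?\<omega> z / t * (wt \<omega> x z * F ?\<omega> z) \<partial>pk \<omega> x)"
    unfolding R.L_def t_def
    using bounded_measurableD[OF bounded_measurable_mult[OF R.w_section[OF \<omega> x] F_BM[OF \<omega>']]]
    by (intro integral_tk[OF \<omega> x]) simp
  also have "\<dots> = (\<integral>z. g\<^sup>2 * t / real N * ((\<Sum>i<N. ?h (z i))\<^sup>2 / (\<Sum>i<N. ?\<psi> (z i))) \<partial>pk \<omega> x)"
  proof (rule Bochner_Integration.integral_cong[OF refl])
    fix z assume "z \<in> space (pk \<omega> x)"
    then have "0 < particle_mean N \<psi> ?\<omega> z"
      using psi_mean_bounds(1)[OF \<omega>', of z] pl_pos by (simp add: space_pk[OF \<omega> x])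
    then have S: "0 < (\<Sum>i<N. ?\<psi> (z i))"
      using N_pos by (simp add: particle_mean_def zero_less_divide_iff)
    show "particle_mean N \<psi> ?\<omega> z / t * (wt \<omega> x z * F ?\<omega> z) =
        g\<^sup>2 * t / real N * ((\<Sum>i<N. ?h (z i))\<^sup>2 / (\<Sum>i<N. ?\<psi> (z i)))"
      unfolding F_def phi_def g_def[symmetric] t_def[symmetric] particle_mean_def[of N \<psi>] particle_mean_def[of N Q.h]
      using S t N_pos by (simp add: power_divide power_mult_distrib power2_eq_square field_simps)
  qed
  also have "\<dots> = g\<^sup>2 * (t * (\<integral>z. (\<Sum>i<N. ?h (z i))\<^sup>2 / (\<Sum>i<N. ?\<psi> (z i)) \<partial>pk \<omega> x) / real N)"
    by (subst integral_mult_right_zero) simp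
  also have "\<dots> \<le> g\<^sup>2 * ((1 + ratio_sup ?\<omega> / real N * (osc ?\<omega> / (1 / inv_inf ?\<omega>))) * (\<integral>y. ?h y \<partial>mix \<omega> x)\<^sup>2)"
  proof (rule mult_left_mono)
    \<comment> \<open>The best lower bound for \<psi>; with it the quotient of the upper and lower
      bounds is \<open>ratio_sup\<close> itself and not the cruder pu / pl.\<close>
    define b where "b = (INF z\<in>space X. ?\<psi> z)"
    have bdd: "bdd_below (?\<psi> ` space X)" using psi_ge[OF \<omega>'] by (rule bdd_belowI2)
    have pl_b: "pl \<le> b" unfolding b_def using X_nonempty psi_ge[OF \<omega>'] by (intro cINF_greatest) auto
    show "t * (\<integral>z. (\<Sum>i<N. ?h (z i))\<^sup>2 / (\<Sum>i<N. ?\<psi> (z i)) \<partial>pk \<omega> x) / real N \<le>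
      (1 + ratio_sup ?\<omega> / real N * (osc ?\<omega> / (1 / inv_inf ?\<omega>))) * (\<integral>y. ?h y \<partial>mix \<omega> x)\<^sup>2"
      unfolding t_def tn_eq_mixture[OF \<omega> x] particle_kernel_def
    proof (rule second_moment_ratio[OF mix(1), where b = b])
      show "bounded_measurable (mix \<omega> x) ?\<psi>" "bounded_measurable (mix \<omega> x) ?h"
        using psi_BM[OF \<omega>'] Q.BM_h[OF \<omega>'] by (simp_all add: bounded_measurable_cong_sets[OF mix(2)])
      show "0 < b" using pl_b pl_pos by simp
      show "0 < 1 / inv_inf ?\<omega>" using inv_inf_props(2)[OF \<omega>'] by simp
      show "0 < N" by (rule N_pos)
      fix z assume "z \<in> space (mix \<omega> x)"
      then have z: "z \<in> space X" by (simp add: mix(3))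
      show "b \<le> ?\<psi> z" unfolding b_def using bdd z by (rule cINF_lower)
      have rs: "0 < ratio_sup ?\<omega>" using ratio_sup_props(2)[OF \<omega>'] by simp
      have "?\<psi> z / ratio_sup ?\<omega> \<le> b"
        unfolding b_def
      proof (rule cINF_greatest)
        fix z' assume z': "z' \<in> space X"
        show "?\<psi> z / ratio_sup ?\<omega> \<le> ?\<psi> z'"
          using ratio_sup_props(1)[OF \<omega>' z z'] psi_pos[OF \<omega>' z'] rs by (simp add: divide_le_eq mult.commute)
      qed (use z in auto)
      then show "?\<psi> z \<le> ratio_sup ?\<omega> * b" using rs by (simp add: divide_le_eq mult.commute)
      show "1 / inv_inf ?\<omega> * ?\<psi> z \<le> ?h z"
        using inv_inf_props(1,2)[OF \<omega>'] z Q.h_bounds(3)[OF \<omega>' z] by (simp add: divide_le_eq mult.commute)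
      show "?h z / ?\<psi> z - ?h z' / ?\<psi> z' \<le> osc ?\<omega>" if "z' \<in> space (mix \<omega> x)" for z'
        using that z by (intro osc_props(1)[OF \<omega>']) (simp_all add: mix(3))
    qed
  qed simp
  also have "\<dots> = (1 + ratio_sup ?\<omega> / real N * (inv_inf ?\<omega> * osc ?\<omega>)) * (g * (\<integral>y. ?h y \<partial>mix \<omega> x))\<^sup>2"
    by (simp add: power_mult_distrib mult_ac)
  also have "\<dots> = (1 + ratio_sup ?\<omega> / real N * (inv_inf ?\<omega> * osc ?\<omega>)) * ((Q.eig \<omega>)\<^sup>2 * F \<omega> x)"
    unfolding g_def mean_G_mixture[OF \<omega> x] F_def by (simp add: power_mult_distrib)
  also have "\<dots> \<le> (1 + 1 / (real N - 1) * D ?\<omega>) * ((Q.eig \<omega>)\<^sup>2 * F \<omega> x)"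
  proof (intro mult_right_mono add_left_mono)
    have r: "1 \<le> ratio_sup ?\<omega>" by (rule ratio_sup_props(2)[OF \<omega>'])
    \<comment> \<open>The sharper factor obtained so far is weakened to the stated one: with r =
      \<open>ratio_sup\<close> at least 1, r \<le> 2 r - 1, and N - 1 \<le> N.\<close>
    have "ratio_sup ?\<omega> / real N \<le> (2 * ratio_sup ?\<omega> - 1) / (real N - 1)"
      using r N2 by (intro frac_le) auto
    then have "ratio_sup ?\<omega> / real N * (inv_inf ?\<omega> * osc ?\<omega>) \<le>
        (2 * ratio_sup ?\<omega> - 1) / (real N - 1) * (inv_inf ?\<omega> * osc ?\<omega>)"
      using inv_inf_props(2)[OF \<omega>'] osc_props(2)[OF \<omega>'] by (intro mult_right_mono) auto
    then show "ratio_sup ?\<omega> / real N * (inv_inf ?\<omega> * osc ?\<omega>) \<le> 1 / (real N - 1) * D ?\<omega>"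
      by (simp add: D_def mult.assoc)
  qed (use F_bounds(3)[OF \<omega> x] in simp)
  finally show ?thesis by (simp add: mult.assoc)
qed

text \<open>Each step reads D at the environment where it arrives, so the hypothesis on c starts at
  shift 1 and not at 0.\<close>

lemma T_F_bound:
  assumes "\<omega> \<in> space E" "x \<in> space XN" and N2: "2 \<le> N" and c: "0 \<le> c"
    and "\<And>p. 1 + 1 / (real N - 1) * D (env_shift (int (Suc p)) \<omega>) \<le> c"
  shows "R.T n \<omega> (F (env_shift (int n) \<omega>)) x \<le> c ^ n * (\<Prod>p<n. Q.eig (env_shift (int p) \<omega>))\<^sup>2 * F \<omega> x"
  using assms(1,2,5)
proof (induction n arbitrary: \<omega> x)
  case 0
  then show ?case by (simp add: env_shift_0)
next
  case (Suc n)
  let ?\<omega> = "env_shift 1 \<omega>"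
  have \<omega>': "?\<omega> \<in> space E" using Suc.prems(1) by (rule env_shift_space)
  have shift: "env_shift (int p) ?\<omega> = env_shift (int (Suc p)) \<omega>" for p
    by (simp add: env_shift_env_shift add.commute)
  let ?P = "\<Prod>p<n. Q.eig (env_shift (int (Suc p)) \<omega>)"
  have "R.T (Suc n) \<omega> (F (env_shift (int (Suc n)) \<omega>)) x = R.L \<omega> (R.T n ?\<omega> (F (env_shift (int n) ?\<omega>))) x"
    by (simp add: shift)
  also have "\<dots> \<le> R.L \<omega> (\<lambda>y. c ^ n * ?P\<^sup>2 * F ?\<omega> y) x"
  proof (rule R.L_mono[OF Suc.prems(1,2)])
    show "bounded_measurable XN (R.T n ?\<omega> (F (env_shift (int n) ?\<omega>)))"
      by (intro R.BM_T \<omega>' F_BM env_shift_space)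
    show "bounded_measurable XN (\<lambda>y. c ^ n * ?P\<^sup>2 * F ?\<omega> y)"
      by (intro bounded_measurable_cmult F_BM \<omega>')
    show "R.T n ?\<omega> (F (env_shift (int n) ?\<omega>)) y \<le> c ^ n * ?P\<^sup>2 * F ?\<omega> y" if "y \<in> space XN" for y
      using Suc.IH[OF \<omega>' that] Suc.prems(3)[of "Suc _"] unfolding shift by blast
  qed
  also have "\<dots> = c ^ n * ?P\<^sup>2 * R.L \<omega> (F ?\<omega>) x" by (rule R.L_cmult)
  also have "\<dots> \<le> c ^ n * ?P\<^sup>2 * (c * (Q.eig \<omega>)\<^sup>2 * F \<omega> x)"
  proof (rule mult_left_mono)
    have "1 + 1 / (real N - 1) * D ?\<omega> \<le> c" using Suc.prems(3)[of 0] by simp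
    then have "(1 + 1 / (real N - 1) * D ?\<omega>) * ((Q.eig \<omega>)\<^sup>2 * F \<omega> x) \<le> c * ((Q.eig \<omega>)\<^sup>2 * F \<omega> x)"
      using F_bounds(3)[OF Suc.prems(1,2)] by (intro mult_right_mono) auto
    then show "R.L \<omega> (F ?\<omega>) x \<le> c * (Q.eig \<omega>)\<^sup>2 * F \<omega> x"
      using one_step_bound[OF Suc.prems(1,2) N2] by (simp add: mult.assoc)
  qed (use c in simp)
  also have "\<dots> = c ^ Suc n * (Q.eig \<omega> * ?P)\<^sup>2 * F \<omega> x"
    by (simp add: power_mult_distrib mult_ac)
  also have "Q.eig \<omega> * ?P = (\<Prod>p<Suc n. Q.eig (env_shift (int p) \<omega>))"
    by (subst prod.lessThan_Suc_shift) (simp add: env_shift_0)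
  finally show ?case .
qed

text \<open>The numerator pays R^2 for replacing 1 by a multiple of F at the end and R^2 for
  bounding F at the start. The denominator pays R^2 in the same way for \<open>h\<close>, and it is
  squared. Together this is R^8, and the products of eigenvalues cancel.\<close>

lemma V_tilde_bound:
  assumes \<omega>: "\<omega> \<in> space E" and N2: "2 \<le> N" and c: "0 \<le> c"
    and D: "\<And>p. 1 + 1 / (real N - 1) * D (env_shift (int (Suc p)) \<omega>) \<le> c"
    and m: "prob_space m" "sets m = sets X"
  shows "V_tilde X G M \<psi> N m n \<omega> \<le> Q.R ^ 8 * c ^ n"
proof -
  have R1: "1 \<le> Q.R" by (rule R1[OF \<omega>])
  have \<omega>n: "env_shift (int n) \<omega> \<in> space E" using \<omega> by (rule env_shift_space)
  define eig_prod where "eig_prod = (\<Prod>p<n. Q.eig (env_shift (int p) \<omega>))"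
  have eig_prod: "0 < eig_prod" unfolding eig_prod_def by (intro prod_pos ballI Q.eig_pos env_shift_space \<omega>)
  have num: "R.U n \<omega> x \<le> Q.R ^ 4 * c ^ n * eig_prod\<^sup>2" if x: "x \<in> space XN" for x
  proof -
    have "R.U n \<omega> x \<le> R.T n \<omega> (\<lambda>z. Q.R\<^sup>2 * F (env_shift (int n) \<omega>) z) x"
      unfolding R.U_def
    proof (rule R.T_mono[OF \<omega> x])
      show "1 \<le> Q.R\<^sup>2 * F (env_shift (int n) \<omega>) z" if "z \<in> space XN" for z
        using F_bounds(1)[OF \<omega>n that] R1 by (simp add: divide_le_eq mult.commute)
    qed (auto intro: bounded_measurable_cmult F_BM[OF \<omega>n])
    also have "\<dots> = Q.R\<^sup>2 * R.T n \<omega> (F (env_shift (int n) \<omega>)) x" by (simp add: R.T_cmult)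
    also have "\<dots> \<le> Q.R\<^sup>2 * (c ^ n * eig_prod\<^sup>2 * F \<omega> x)"
      unfolding eig_prod_def using T_F_bound[OF \<omega> x N2 c D] by (intro mult_left_mono) auto
    also have "\<dots> \<le> Q.R\<^sup>2 * (c ^ n * eig_prod\<^sup>2 * Q.R\<^sup>2)"
      using F_bounds(2)[OF \<omega> x] c by (intro mult_left_mono) auto
    also have "\<dots> = Q.R ^ 4 * c ^ n * eig_prod\<^sup>2" by (simp add: power2_eq_square power4_eq_xxxx mult_ac)
    finally show ?thesis .
  qed
  have den: "eig_prod / Q.R\<^sup>2 \<le> Q.U n \<omega> x" if x: "x \<in> space X" for x
  proof -
    have "eig_prod * (1 / Q.R) \<le> eig_prod * Q.h \<omega> x"
      using Q.h_bounds(1)[OF \<omega> x] eig_prod by (intro mult_left_mono) auto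
    also have "\<dots> = Q.T n \<omega> (Q.h (env_shift (int n) \<omega>)) x"
      using Q.T_h[OF \<omega> x, of n] by (simp add: eig_prod_def funpow_shift)
    also have "\<dots> \<le> Q.T n \<omega> (\<lambda>_. Q.R) x"
      using Q.h_bounds(2)[OF \<omega>n] by (intro Q.T_mono \<omega> x Q.BM_h \<omega>n) auto
    also have "\<dots> = Q.R * Q.U n \<omega> x" by (simp add: Q.T_const)
    finally show ?thesis using R1 by (simp add: divide_le_eq power2_eq_square mult_ac)
  qed
  let ?num = "\<integral>x. R.U n \<omega> x \<partial>PiM {..<N} (\<lambda>_. m)" and ?den = "\<integral>x. Q.U n \<omega> x \<partial>m"
  have num': "?num \<le> Q.R ^ 4 * c ^ n * eig_prod\<^sup>2"
    by (rule bounded_measurable_integral_le[OF R.BM_U[OF \<omega>] prob_space_PiM[OF m(1)] sets_prod_init[OF m(2)] num])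
  have den': "eig_prod / Q.R\<^sup>2 \<le> ?den"
    by (rule bounded_measurable_integral_ge[OF Q.BM_U[OF \<omega>] m den])
  have "0 < eig_prod / Q.R\<^sup>2" using eig_prod R1 by simp
  then have "?num / ?den\<^sup>2 \<le> (Q.R ^ 4 * c ^ n * eig_prod\<^sup>2) / (eig_prod / Q.R\<^sup>2)\<^sup>2"
    using num' den' c R1 by (intro frac_le power_mono) auto
  also have "\<dots> = Q.R ^ 8 * c ^ n"
    using eig_prod R1 by (simp add: power_divide field_simps flip: power_add power_mult)
  finally show ?thesis unfolding V_tilde_eq[OF \<omega> m] .
qed

lemma V_tilde_pos:
  assumes \<omega>: "\<omega> \<in> space E" and m: "prob_space m" "sets m = sets X"
  shows "0 < V_tilde X G M \<psi> N m n \<omega>"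
  unfolding V_tilde_eq[OF \<omega> m]
  using R.integral_U_pos[OF \<omega> prob_space_PiM[OF m(1)] sets_prod_init[OF m(2)]] Q.integral_U_pos[OF \<omega> m]
  by (intro divide_pos_pos zero_less_power)

theorem Upsilon_le:
  assumes P: "prob_space P" and sets_P: "sets P = sets E"
    and erg: "ergodic_system P (env_shift 1)" and N2: "2 \<le> N"
  shows "Upsilon P X G M \<psi> N \<le> ln (1 + 1 / (real N - 1) * D_const P X \<psi> (h_fun X G M \<mu>))"
proof -
  interpret P: ergodic_system P "env_shift 1" by fact
  have space_P: "space P = space E" using sets_P by (rule sets_eq_imp_space_eq)
  obtain cR where cR: "\<And>m. prob_space m \<Longrightarrow> sets m = sets XN \<Longrightarrow>
      AE \<omega> in P. (\<lambda>n. ln (\<integral>x. R.U n \<omega> x \<partial>m) / real n) \<longlonglongrightarrow> cR"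
    using R.growth_rate_exists[OF erg sets_P] by blast
  obtain cQ where cQ: "\<And>m. prob_space m \<Longrightarrow> sets m = sets X \<Longrightarrow>
      AE \<omega> in P. (\<lambda>n. ln (\<integral>x. Q.U n \<omega> x \<partial>m) / real n) \<longlonglongrightarrow> cQ"
    using Q.growth_rate_exists[OF erg sets_P] by blast
  define \<Upsilon> where "\<Upsilon> = cR - 2 * cQ"
  have lim: "AE \<omega> in P. (\<lambda>n. ln (V_tilde X G M \<psi> N m n \<omega>) / real n) \<longlonglongrightarrow> \<Upsilon>"
    if m: "prob_space m" "sets m = sets X" for m
    using cR[OF prob_space_PiM[OF m(1)] sets_prod_init[OF m(2)]] cQ[OF m] AE_space
  proof eventually_elim
    case (elim \<omega>)
    then have \<omega>: "\<omega> \<in> space E" by (simp add: space_P)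
    have V: "ln (V_tilde X G M \<psi> N m n \<omega>) / real n =
        ln (\<integral>x. R.U n \<omega> x \<partial>PiM {..<N} (\<lambda>_. m)) / real n - 2 * (ln (\<integral>x. Q.U n \<omega> x \<partial>m) / real n)" for n
      using R.integral_U_pos[OF \<omega> prob_space_PiM[OF m(1)] sets_prod_init[OF m(2)], of n] Q.integral_U_pos[OF \<omega> m, of n]
      by (simp add: V_tilde_eq[OF \<omega> m] ln_div ln_realpow diff_divide_distrib)
    show ?case
      unfolding \<Upsilon>_def V by (intro tendsto_intros elim)
  qed
  \<comment> \<open>The single law \<nu> already determines the limit: two candidate limits would
    agree almost everywhere, and in a probability space that makes the constants equal.\<close>
  have "Upsilon P X G M \<psi> N = \<Upsilon>"
    unfolding Upsilon_def
  proof (rule the_equality)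
    fix c
    assume c: "\<forall>\<mu>0. prob_space \<mu>0 \<and> sets \<mu>0 = sets X \<longrightarrow>
      (AE \<omega> in P. (\<lambda>n. ln (V_tilde X G M \<psi> N \<mu>0 n \<omega>) / real n) \<longlonglongrightarrow> c)"
    then have "AE \<omega> in P. (\<lambda>n. ln (V_tilde X G M \<psi> N \<nu> n \<omega>) / real n) \<longlonglongrightarrow> c"
      using nu by blast
    with lim[OF nu] have "AE \<omega> in P. c = \<Upsilon>"
      by eventually_elim (rule LIMSEQ_unique)
    then show "c = \<Upsilon>" by (cases "c = \<Upsilon>") (simp_all add: P.AE_False)
  qed (use lim in blast)
  moreover have "\<Upsilon> \<le> ln (1 + 1 / (real N - 1) * D_const P X \<psi> (h_fun X G M \<mu>))"
  proof -
    define f where "f \<omega> = C_const X \<psi> (h_fun X G M \<mu>) \<omega> *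
      (SUP (z, z')\<in>space X \<times> space X. \<bar>h_fun X G M \<mu> \<omega> z / \<psi> \<omega> z - h_fun X G M \<mu> \<omega> z' / \<psi> \<omega> z'\<bar>)" for \<omega>
    have f: "f \<omega> = D \<omega>" if "\<omega> \<in> space E" for \<omega>
      unfolding f_def by (rule D_eq[OF that])
    define B where "B = (2 * (pu / pl)) * (pu * Q.R) * (Q.R / pl)"
    have "0 \<le> f \<omega>" "f \<omega> \<le> B" if "\<omega> \<in> space P" for \<omega>
      using D_bounds[of \<omega>] f[of \<omega>] that unfolding space_P B_def by simp_all
    then have "AE \<omega> in P. 0 \<le> f \<omega>" "AE \<omega> in P. f \<omega> \<le> B"
      by (auto intro!: AE_I2)
    note ess = ess_sup_AE[OF P this]
    define d where "d = D_const P X \<psi> (h_fun X G M \<mu>)"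
    have d: "d = ess_sup P f" by (simp add: d_def D_const_def f_def[abs_def])
    define c where "c = 1 + 1 / (real N - 1) * d"
    have c1: "1 \<le> c" using ess(2) N2 by (simp add: c_def d)
    \<comment> \<open>The inequality does not mention \<omega>, so holding almost everywhere it
      simply holds. Invariance of P puts the essential bound at every point of the orbit, outside
      one null set.\<close>
    have "AE \<omega> in P. \<Upsilon> \<le> ln c"
      using lim[OF nu] P.AE_funpow_T[OF ess(1)] AE_space
    proof eventually_elim
      case (elim \<omega>)
      then have \<omega>: "\<omega> \<in> space E" by (simp add: space_P)
      have D: "D (env_shift (int p) \<omega>) \<le> d" for p
        using spec[OF elim(2), of p] by (simp only: d funpow_shift f[OF env_shift_space[OF \<omega>]])
      have "1 + 1 / (real N - 1) * D (env_shift (int (Suc p)) \<omega>) \<le> c" for p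
        unfolding c_def using N2 by (intro add_left_mono mult_left_mono D) simp
      then have V: "V_tilde X G M \<psi> N \<nu> n \<omega> \<le> Q.R ^ 8 * c ^ n" for n
        using c1 by (intro V_tilde_bound[OF \<omega> N2 _ _ nu]) auto
      \<comment> \<open>The factor R^8 contributes a multiple of 1/n and drops out in the
        limit.\<close>
      have "ln (V_tilde X G M \<psi> N \<nu> n \<omega>) / real n \<le> ln (Q.R ^ 8) * (1 / real n) + ln c" if "1 \<le> n" for n
      proof -
        have "ln (V_tilde X G M \<psi> N \<nu> n \<omega>) \<le> ln (Q.R ^ 8 * c ^ n)"
          using V[of n] V_tilde_pos[OF \<omega> nu, of n] by (subst ln_le_cancel_iff) auto
        also have "\<dots> = ln (Q.R ^ 8) + real n * ln c"
          using R1[OF \<omega>] c1 by (subst ln_mult) (auto simp: ln_realpow)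
        finally show ?thesis using that by (simp add: field_simps)
      qed
      moreover have "(\<lambda>n. ln (Q.R ^ 8) * (1 / real n) + ln c) \<longlonglongrightarrow> ln (Q.R ^ 8) * 0 + ln c"
        by (intro tendsto_intros lim_1_over_n)
      ultimately show ?case
        using elim(1) by (intro LIMSEQ_le[of _ \<Upsilon> _ "ln c"]) auto
    qed
    then have "\<Upsilon> \<le> ln c" by (cases "\<Upsilon> \<le> ln c") (simp_all add: P.AE_False)
    then show ?thesis by (simp add: c_def d_def)
  qed
  ultimately show ?thesis by simp
qed

end

text \<open>\<mu> is an arbitrary law for the past in \<open>h_fun\<close>, so the bound holds for
  every choice that represents \<open>h\<close>.\<close>

theorem proposition5:
  fixes X :: "'x measure" and Y :: "'y measure" and P :: "(int \<Rightarrow> 'y) measure"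
    and M :: "(int \<Rightarrow> 'y) \<Rightarrow> 'x \<Rightarrow> 'x measure"
    and G \<psi> :: "(int \<Rightarrow> 'y) \<Rightarrow> 'x \<Rightarrow> real"
    and \<nu> \<mu> :: "'x measure" and \<beta> \<epsilon>m \<epsilon>p :: real and N :: nat
  assumes P: "prob_space P" "sets P = sets (env_space Y)"
    and M: "(\<lambda>(\<omega>, x). M \<omega> x) \<in> measurable (env_space Y \<Otimes>\<^sub>M X) (prob_algebra X)"
    and G_measurable: "(\<lambda>(\<omega>, x). G \<omega> x) \<in> borel_measurable (env_space Y \<Otimes>\<^sub>M X)"
    and G_pos: "\<forall>\<omega>\<in>space (env_space Y). \<forall>x\<in>space X. 0 < G \<omega> x"
    and G_bounded: "\<exists>B. \<forall>\<omega>\<in>space (env_space Y). \<forall>x\<in>space X. G \<omega> x \<le> B"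
    and psi_measurable: "(\<lambda>(\<omega>, x). \<psi> \<omega> x) \<in> borel_measurable (env_space Y \<Otimes>\<^sub>M X)"
    and psi_pos: "\<forall>\<omega>\<in>space (env_space Y). \<forall>x\<in>space X. 0 < \<psi> \<omega> x"
    and psi_bounded: "\<exists>B. \<forall>\<omega>\<in>space (env_space Y). \<forall>x\<in>space X. \<psi> \<omega> x \<le> B"
    and preserves: "preserves P (env_shift 1)"
    and ergodic: "ergodic P (env_shift 1)"
    and beta: "1 \<le> \<beta>"
    and eps: "0 < \<epsilon>m" "0 < \<epsilon>p"
    and nu: "prob_space \<nu>" "sets \<nu> = sets X"
    and G_ratio: "\<forall>\<omega>\<in>space (env_space Y). \<forall>\<omega>'\<in>space (env_space Y). \<forall>x\<in>space X. \<forall>x'\<in>space X.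
      G \<omega> x / G \<omega>' x' \<le> \<beta>"
    and M_bounds: "\<forall>\<omega>\<in>space (env_space Y). \<forall>x\<in>space X. \<forall>A\<in>sets X.
      \<epsilon>m * measure \<nu> A \<le> measure (M \<omega> x) A \<and> measure (M \<omega> x) A \<le> \<epsilon>p * measure \<nu> A"
    and psi_ratio: "\<exists>K. \<forall>\<omega>\<in>space (env_space Y). \<forall>\<omega>'\<in>space (env_space Y).
      \<forall>x\<in>space X. \<forall>x'\<in>space X. \<psi> \<omega> x / \<psi> \<omega>' x' \<le> K"
    and mu: "prob_space \<mu>" "sets \<mu> = sets X"
    and N: "2 \<le> N"
  shows "Upsilon P X G M \<psi> N
    \<le> ln (1 + 1 / (real N - 1) * D_const P X \<psi> (h_fun X G M \<mu>))"
proof -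
  let ?E = "env_space Y"
  have space_P: "space P = space ?E" using P(2) by (rule sets_eq_imp_space_eq)
  have E_ne: "space ?E \<noteq> {}" using prob_space.not_empty[OF P(1)] by (simp add: space_P)
  have X_ne: "space X \<noteq> {}" using prob_space.not_empty[OF nu(1)] sets_eq_imp_space_eq[OF nu(2)] by simp
  \<comment> \<open>Comparing one fixed point with every other gives the lower bound f(\<omega>0,
    x0) / K; comparing it with itself gives 1 \<le> K.\<close>
  have lower: "\<exists>l>0. \<forall>\<omega>\<in>space ?E. \<forall>x\<in>space X. l \<le> f \<omega> x"
    if pos: "\<forall>\<omega>\<in>space ?E. \<forall>x\<in>space X. 0 < f \<omega> x"
      and ratio: "\<forall>\<omega>\<in>space ?E. \<forall>\<omega>'\<in>space ?E. \<forall>x\<in>space X. \<forall>x'\<in>space X. f \<omega> x / f \<omega>' x' \<le> K"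
    for f :: "(int \<Rightarrow> 'y) \<Rightarrow> 'x \<Rightarrow> real" and K
  proof -
    obtain \<omega>0 x0 where 0: "\<omega>0 \<in> space ?E" "x0 \<in> space X" using E_ne X_ne by blast
    have "f \<omega>0 x0 / f \<omega>0 x0 \<le> K" "0 < f \<omega>0 x0" using pos ratio 0 by blast+
    then have K: "1 \<le> K" by simp
    have "f \<omega>0 x0 / K \<le> f \<omega> x" if "\<omega> \<in> space ?E" "x \<in> space X" for \<omega> x
    proof -
      have "f \<omega>0 x0 / f \<omega> x \<le> K" "0 < f \<omega> x" using pos ratio 0 that by blast+
      then show ?thesis using K by (simp add: divide_le_eq mult.commute)
    qed
    then show ?thesis using K \<open>0 < f \<omega>0 x0\<close> by (intro exI[of _ "f \<omega>0 x0 / K"]) auto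
  qed
  obtain gl where gl: "0 < gl" "\<And>\<omega> x. \<omega> \<in> space ?E \<Longrightarrow> x \<in> space X \<Longrightarrow> gl \<le> G \<omega> x"
    using lower[OF G_pos G_ratio] by blast
  obtain pl where pl: "0 < pl" "\<And>\<omega> x. \<omega> \<in> space ?E \<Longrightarrow> x \<in> space X \<Longrightarrow> pl \<le> \<psi> \<omega> x"
    using lower[OF psi_pos] psi_ratio by blast
  obtain gu where gu: "\<And>\<omega> x. \<omega> \<in> space ?E \<Longrightarrow> x \<in> space X \<Longrightarrow> G \<omega> x \<le> gu"
    using G_bounded by blast
  obtain pu where pu: "\<And>\<omega> x. \<omega> \<in> space ?E \<Longrightarrow> x \<in> space X \<Longrightarrow> \<psi> \<omega> x \<le> pu"
    using psi_bounded by blast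
  have M_em: "ennreal \<epsilon>m * emeasure \<nu> A \<le> emeasure (M \<omega> x) A" "emeasure (M \<omega> x) A \<le> ennreal \<epsilon>p * emeasure \<nu> A"
    if "\<omega> \<in> space ?E" "x \<in> space X" "A \<in> sets X" for \<omega> x A
  proof -
    have "M \<omega> x \<in> space (prob_algebra X)"
      using measurable_space[OF M, of "(\<omega>, x)"] that by (auto simp: space_pair_measure)
    then interpret Mx: prob_space "M \<omega> x" by (simp add: space_prob_algebra)
    interpret \<nu>: prob_space \<nu> by fact
    show "ennreal \<epsilon>m * emeasure \<nu> A \<le> emeasure (M \<omega> x) A" "emeasure (M \<omega> x) A \<le> ennreal \<epsilon>p * emeasure \<nu> A"
      using M_bounds that eps
      by (auto simp: Mx.emeasure_eq_measure \<nu>.emeasure_eq_measure ennreal_mult'[symmetric] intro!: ennreal_leI)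
  qed
  interpret particle_model_past X Y M G \<psi> \<nu> \<epsilon>m \<epsilon>p gl gu pl pu N \<mu>
  proof (intro particle_model_past.intro particle_model_past_axioms.intro particle_model.intro)
    show "0 < N" using N by simp
  qed fact+
  have "ergodic_system P (env_shift 1)"
    by (intro ergodic_system.intro ergodic_system_axioms.intro P preserves ergodic)
  then show ?thesis
    by (rule Upsilon_le[OF P _ N])
qed

end
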